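(* (1) Every OMQ $\boldsymbol q=(\mathcal O,\psi(\boldsymbol t))$ with an $\mathit{LTL}^{\Box\bigcirc}_{\mathit{bool}}$ ontology $\mathcal O$ and an arbitrary $\mathrm{MFO}(<)$-formula $\psi(\boldsymbol t)$ is $\mathrm{FO}(\mathrm{RPR})$-rewritable. (2) Every OMQ $\boldsymbol q=(\mathcal O,\psi(\boldsymbol t))$ with an $\mathit{LTL}^{\Box}_{\mathit{horn}}$ ontology $\mathcal O$ and a quasi-positive $\mathrm{MFO}(<)$-formula $\psi(\boldsymbol t)$ is $\mathrm{FO}(<)$-rewritable. (3) Every OMQ $\boldsymbol q=(\mathcal O,\psi(\boldsymbol t))$ with an $\mathit{LTL}^{\Box\bigcirc}_{\mathit{core}}$ ontology $\mathcal O$ and a quasi-positive $\mathrm{MFO}(<)$-formula $\psi(\boldsymbol t)$ is $\mathrm{FO}(<,\equiv)$-rewritable.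
   Context: Ontologies. Fix a countably infinite set of atomic concepts. Basic temporal concepts are given by $C::=A_i\mid\Box_F C\mid\Box_P C\mid\bigcirc_F C\mid\bigcirc_P C$. An ontology $\mathcal O$ is a finite set of clauses (axioms) $C_1\land\dots\land C_k\to C_{k+1}\lor\dots\lor C_{k+m}$ with $k,m\ge0$ and basic temporal concepts $C_i$ (empty $\land$ is $\top$, empty $\lor$ is $\bot$). It is an $\mathit{LTL}^{\boldsymbol o}_{\boldsymbol c}$ ontology, for $\boldsymbol o\in\{\Box,\bigcirc,\Box\bigcirc\}$, if only the (future and past) operators indicated in $\boldsymbol o$ occur and all clauses satisfy: $m\le1$ if $\boldsymbol c=\mathit{horn}$; $k+m\le2$ if $\boldsymbol c=\mathit{krom}$; $k+m\le2$ and $m\le1$ if $\boldsymbol c=\mathit{core}$; no restriction if $\boldsymbol c=\mathit{bool}$. Semantics. An interpretation $\mathfrak M$ assigns to each atomic concept $A$ a set $A^{\mathfrak M}\subseteq\mathbb Z$; $(\Box_F C)^{\mathfrak M}=\{n\mid k\in C^{\mathfrak M}\ \forall k>n\}$, $(\Box_P C)^{\mathfrak M}=\{n\mid k\in C^{\mathfrak M}\ \forall k<n\}$, $(\bigcirc_F C)^{\mathfrak M}=\{n\mid n+1\in C^{\mathfrak M}\}$, $(\bigcirc_P C)^{\mathfrak M}=\{n\mid n-1\in C^{\mathfrak M}\}$. A clause is true in $\mathfrak M$ if $C_1^{\mathfrak M}\cap\dots\cap C_k^{\mathfrak M}\subseteq C_{k+1}^{\mathfrak M}\cup\dots\cup C_{k+m}^{\mathfrak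 M}$ (empty $\cap$ is $\mathbb Z$, empty $\cup$ is $\emptyset$). A data instance $\mathcal A$ is a finite set of ground atoms $A_i(\ell)$, $\ell\in\mathbb Z$; it is assumed throughout that the least integer $\min\mathcal A$ occurring in it is $0$ and the greatest one satisfies $\max\mathcal A\ge1$; $\mathrm{tem}(\mathcal A)=\{n\in\mathbb Z\mid\min\mathcal A\le n\le\max\mathcal A\}$. $\mathfrak M$ is a model of $(\mathcal O,\mathcal A)$ if all clauses of $\mathcal O$ are true in $\mathfrak M$ and $\ell\in A^{\mathfrak M}$ for all $A(\ell)\in\mathcal A$. Queries. $\mathrm{MFO}(<)$-formulas are first-order formulas built from atoms $A(t)$ ($A$ an atomic concept), $(t<t')$ and the abbreviations $(t=t')$, $(t=t'+1)$; they are evaluated in interpretations $\mathfrak M$ as in first-order logic over the domain $(\mathbb Z,<)$. A quasi-positive $\mathrm{MFO}(<)$-formula is built inductively from atoms $A(t)$, $(t<t')$, $(t=t')$, $(t=t'+1)$ using $\land,\lor,\forall,\exists$ and guarded universal quantification $\forall y((x<y<z)\to\varphi)$, $\forall y((x<y)\to\varphi)$, $\forall y((y<z)\to\varphi)$ with $\varphi$ quasi-positive. An OMQ is a pair $\boldsymbol q=(\mathcal O,\psi(\boldsymbol t))$, where $\boldsymbol t=(t_1,\dots,t_m)$, $m\ge0$, are the free (answer) variables of $\psi$. A tuple $\boldsymbol\ell$ in $\mathrm{tem}(\mathcal A)$ is a certain answer to $\boldsymbol q$ over $\mathcal A$ if $\mathfrak M\models\psi(\boldsymbol\ell)$ for every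 model $\mathfrak M$ of $(\mathcal O,\mathcal A)$; for $m=0$, $\boldsymbol q$ is entailed over $\mathcal A$ if $\mathfrak M\models\psi$ for every model $\mathfrak M$ of $(\mathcal O,\mathcal A)$. Rewritability. $\mathfrak S_{\mathcal A}$ is the finite first-order structure with domain $\mathrm{tem}(\mathcal A)$ ordered by $<$ in which $A(\ell)$ holds iff $A(\ell)\in\mathcal A$. For a class $\mathcal L$ of formulas, $\boldsymbol q$ is $\mathcal L$-rewritable if there is an $\mathcal L$-formula $\boldsymbol Q(\boldsymbol t)$ such that, for every data instance $\mathcal A$ and every $m$-tuple $\boldsymbol\ell$ in $\mathrm{tem}(\mathcal A)$, $\boldsymbol\ell$ is a certain answer to $\boldsymbol q$ over $\mathcal A$ iff $\mathfrak S_{\mathcal A}\models\boldsymbol Q(\boldsymbol\ell)$ (for $m=0$: an $\mathcal L$-sentence $\boldsymbol Q$ with $\boldsymbol q$ entailed over $\mathcal A$ iff $\mathfrak S_{\mathcal A}\models\boldsymbol Q$). $\mathrm{FO}(<)$ is first-order logic over the unary predicates for atomic concepts and $<$. $\mathrm{FO}(<,\equiv)$ additionally has unary predicates $t\equiv0\pmod n$, for each fixed $n>1$, true of $\ell$ iff $n$ divides $\ell$. $\mathrm{FO}(\mathrm{RPR})$ extends first-order logic over the unary predicates and the successor relation with relational primitive recursion: if $\Theta_1,\dots,\Theta_n,\Psi$ are $\mathrm{FO}(\mathrm{RPR})$-formulas, one may form $$\big[\,Q_i(\boldsymbol z_i,t)\equiv\Theta_i(\boldsymbol z_i,t,Q_1(\boldsymbol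 z_1,t-1),\dots,Q_n(\boldsymbol z_n,t-1)),\ 1\le i\le n\,\big]\ \Psi(\boldsymbol z,\boldsymbol z_1,\dots,\boldsymbol z_n),$$ where the bracketed part defines the relations $Q_i$ used in $\Psi$ by recursion on $t=0,1,2,\dots$ in $\mathrm{tem}(\mathcal A)$, with all $Q_i(\boldsymbol z_i,-1)$ taken to be false; each relation variable $Q_i$ occurs in only one recursive definition. *)

theory Defs
  imports Main
begin

section \<open>Temporal ontologies and data\<close>

type_synonym atom = nat

datatype concept =
    Atomic atom
  | BoxF concept
  | BoxP concept
  | NextF concept
  | NextP concept

datatype clause = Clause (body: "concept list") (head: "concept list")

datatype operators = Box | Next | BoxNext

datatype clause_shape = Horn | Krom | Core | Bool

primrec uses_box :: "concept \<Rightarrow> bool" where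
  "uses_box (Atomic A) \<longleftrightarrow> False"
| "uses_box (BoxF C) \<longleftrightarrow> True"
| "uses_box (BoxP C) \<longleftrightarrow> True"
| "uses_box (NextF C) \<longleftrightarrow> uses_box C"
| "uses_box (NextP C) \<longleftrightarrow> uses_box C"

primrec uses_next :: "concept \<Rightarrow> bool" where
  "uses_next (Atomic A) \<longleftrightarrow> False"
| "uses_next (BoxF C) \<longleftrightarrow> uses_next C"
| "uses_next (BoxP C) \<longleftrightarrow> uses_next C"
| "uses_next (NextF C) \<longleftrightarrow> True"
| "uses_next (NextP C) \<longleftrightarrow> True"

fun operators_ok :: "operators \<Rightarrow> concept \<Rightarrow> bool" where
  "operators_ok Box C \<longleftrightarrow> \<not> uses_next C"
| "operators_ok Next C \<longleftrightarrow> \<not> uses_box C"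
| "operators_ok BoxNext C \<longleftrightarrow> True"

fun shape_ok :: "clause_shape \<Rightarrow> clause \<Rightarrow> bool" where
  "shape_ok Horn (Clause Bs Hs) \<longleftrightarrow> length Hs \<le> 1"
| "shape_ok Krom (Clause Bs Hs) \<longleftrightarrow> length Bs + length Hs \<le> 2"
| "shape_ok Core (Clause Bs Hs) \<longleftrightarrow> length Bs + length Hs \<le> 2 \<and> length Hs \<le> 1"
| "shape_ok Bool (Clause Bs Hs) \<longleftrightarrow> True"

definition LTL_ontology :: "operators \<Rightarrow> clause_shape \<Rightarrow> clause set \<Rightarrow> bool" where
  "LTL_ontology os c \<O> \<longleftrightarrow> finite \<O> \<and>
     (\<forall>cl\<in>\<O>. shape_ok c cl \<and> (\<forall>C\<in>set (body cl) \<union> set (head cl). operators_ok os C))"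

type_synonym interp = "atom \<Rightarrow> int set"

primrec extension :: "interp \<Rightarrow> concept \<Rightarrow> int set" where
  "extension M (Atomic A) = M A"
| "extension M (BoxF C) = {n. \<forall>k>n. k \<in> extension M C}"
| "extension M (BoxP C) = {n. \<forall>k<n. k \<in> extension M C}"
| "extension M (NextF C) = {n. n + 1 \<in> extension M C}"
| "extension M (NextP C) = {n. n - 1 \<in> extension M C}"

definition clause_true :: "interp \<Rightarrow> clause \<Rightarrow> bool" where
  "clause_true M cl \<longleftrightarrow>
     (\<Inter>C\<in>set (body cl). extension M C) \<subseteq> (\<Union>C\<in>set (head cl). extension M C)"

type_synonym data = "(atom \<times> int) set"

definition min_data :: "data \<Rightarrow> int" where
  "min_data \<A> = Min (snd ` \<A>)"

definition max_data :: "data \<Rightarrow> int" where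
  "max_data \<A> = Max (snd ` \<A>)"

definition data_instance :: "data \<Rightarrow> bool" where
  "data_instance \<A> \<longleftrightarrow> finite \<A> \<and> \<A> \<noteq> {} \<and> min_data \<A> = 0 \<and> max_data \<A> \<ge> 1"

definition tem :: "data \<Rightarrow> int set" where
  "tem \<A> = {n. min_data \<A> \<le> n \<and> n \<le> max_data \<A>}"

definition model :: "interp \<Rightarrow> clause set \<Rightarrow> data \<Rightarrow> bool" where
  "model M \<O> \<A> \<longleftrightarrow> (\<forall>cl\<in>\<O>. clause_true M cl) \<and> (\<forall>(A, l)\<in>\<A>. l \<in> M A)"


section \<open>Formulas\<close>

text \<open>
  One type of formulas serves for queries and for rewritings; the individual languages are
  subsets of it. \<open>Succ x y\<close> stands for \<open>x = y + 1\<close>,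
  \<open>Cong0 n x\<close> for \<open>x \<equiv> 0 (mod n)\<close>,
  \<open>Rel Q us s\<close> for \<open>Q(us, s)\<close> and \<open>Prev Q us s\<close> for \<open>Q(us, s - 1)\<close>, where \<open>Q\<close> is a relation
  variable. \<open>Rpr t ds \<Psi>\<close> is the formula \<open>[Q(zs, t) \<equiv> \<Theta>, for (Q, zs, \<Theta>) in ds] \<Psi>\<close>.
\<close>

type_synonym var = nat
type_synonym rel = nat

datatype form =
    Atm atom var
  | Less var var
  | Equal var var
  | Succ var var
  | Cong0 nat var
  | Rel rel "var list" var
  | Prev rel "var list" var
  | Neg form
  | And form form
  | Or form form
  | Imp form form
  | All var form
  | Ex var form
  | Rpr var "(rel \<times> var list \<times> form) list" form

fun fv :: "form \<Rightarrow> var set" where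
  "fv (Atm A x) = {x}"
| "fv (Less x y) = {x, y}"
| "fv (Equal x y) = {x, y}"
| "fv (Succ x y) = {x, y}"
| "fv (Cong0 n x) = {x}"
| "fv (Rel Q us s) = set us \<union> {s}"
| "fv (Prev Q us s) = set us \<union> {s}"
| "fv (Neg \<phi>) = fv \<phi>"
| "fv (And \<phi> \<psi>) = fv \<phi> \<union> fv \<psi>"
| "fv (Or \<phi> \<psi>) = fv \<phi> \<union> fv \<psi>"
| "fv (Imp \<phi> \<psi>) = fv \<phi> \<union> fv \<psi>"
| "fv (All x \<phi>) = fv \<phi> - {x}"
| "fv (Ex x \<phi>) = fv \<phi> - {x}"
| "fv (Rpr t ds \<Psi>) = (\<Union>(Q, zs, \<Theta>)\<in>set ds. fv \<Theta> - insert t (set zs)) \<union> fv \<Psi>"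

text \<open>All relation variables defined in a formula, with repetitions.\<close>

fun defined_rels :: "form \<Rightarrow> rel list" where
  "defined_rels (Neg \<phi>) = defined_rels \<phi>"
| "defined_rels (And \<phi> \<psi>) = defined_rels \<phi> @ defined_rels \<psi>"
| "defined_rels (Or \<phi> \<psi>) = defined_rels \<phi> @ defined_rels \<psi>"
| "defined_rels (Imp \<phi> \<psi>) = defined_rels \<phi> @ defined_rels \<psi>"
| "defined_rels (All x \<phi>) = defined_rels \<phi>"
| "defined_rels (Ex x \<phi>) = defined_rels \<phi>"
| "defined_rels (Rpr t ds \<Psi>) =
     map fst ds @ concat (map (\<lambda>(Q, zs, \<Theta>). defined_rels \<Theta>) ds) @ defined_rels \<Psi>"
| "defined_rels _ = []"


subsection \<open>Semantics\<close>

type_synonym asg = "var \<Rightarrow> int"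
type_synonym rel_env = "rel \<Rightarrow> int list \<Rightarrow> int \<Rightarrow> bool"

definition upds :: "asg \<Rightarrow> var list \<Rightarrow> int list \<Rightarrow> asg" where
  "upds e xs as = (\<lambda>x. case map_of (zip xs as) x of Some a \<Rightarrow> a | None \<Rightarrow> e x)"

text \<open>
  \<open>rpr_upto ds t \<rho> e k\<close> interprets the relation variables defined in \<open>ds\<close> at the times
  \<open>0, ..., k - 1\<close>, as false at all other times, and the remaining relation variables as \<open>\<rho>\<close> does.
  The right-hand sides of the definitions are given here by their meanings.
\<close>

primrec rpr_upto ::
  "(rel \<times> var list \<times> (rel_env \<Rightarrow> asg \<Rightarrow> bool)) list \<Rightarrow> var \<Rightarrow> rel_env \<Rightarrow> asg \<Rightarrow> nat \<Rightarrow> rel_env"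
where
  "rpr_upto ds t \<rho> e 0 = (\<lambda>Q as s. map_of ds Q = None \<and> \<rho> Q as s)"
| "rpr_upto ds t \<rho> e (Suc k) = (\<lambda>Q as s.
     case map_of ds Q of
       None \<Rightarrow> \<rho> Q as s
     | Some (zs, \<theta>) \<Rightarrow>
         if s = int k then \<theta> (rpr_upto ds t \<rho> e k) (upds e (t # zs) (int k # as))
         else rpr_upto ds t \<rho> e k Q as s)"

definition rpr_env ::
  "(rel \<times> var list \<times> (rel_env \<Rightarrow> asg \<Rightarrow> bool)) list \<Rightarrow> var \<Rightarrow> rel_env \<Rightarrow> asg \<Rightarrow> rel_env"
where
  "rpr_env ds t \<rho> e = (\<lambda>Q as s. rpr_upto ds t \<rho> e (nat (s + 1)) Q as s)"

lemma rpr_env_None: "map_of ds Q = None \<Longrightarrow> rpr_env ds t \<rho> e Q = \<rho> Q"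
proof -
  assume "map_of ds Q = None"
  then have "rpr_upto ds t \<rho> e k Q as s = \<rho> Q as s" for k as s
    by (induction k) auto
  then show ?thesis by (simp add: rpr_env_def fun_eq_iff)
qed

lemma rpr_env_Some_neg:
  "map_of ds Q = Some (zs, \<theta>) \<Longrightarrow> s < 0 \<Longrightarrow> \<not> rpr_env ds t \<rho> e Q as s"
  by (simp add: rpr_env_def)

lemma rpr_env_Some:
  "map_of ds Q = Some (zs, \<theta>) \<Longrightarrow>
    rpr_env ds t \<rho> e Q as (int k) \<longleftrightarrow> \<theta> (rpr_upto ds t \<rho> e k) (upds e (t # zs) (int k # as))"
  by (simp add: rpr_env_def nat_add_distrib)

text \<open>
  Truth in the structure with domain \<open>D\<close>, a set of integers with the inherited order, and unary
  predicates \<open>I\<close>.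
\<close>

fun sat :: "int set \<Rightarrow> interp \<Rightarrow> form \<Rightarrow> rel_env \<Rightarrow> asg \<Rightarrow> bool" where
  "sat D I (Atm A x) \<rho> e \<longleftrightarrow> e x \<in> I A"
| "sat D I (Less x y) \<rho> e \<longleftrightarrow> e x < e y"
| "sat D I (Equal x y) \<rho> e \<longleftrightarrow> e x = e y"
| "sat D I (Succ x y) \<rho> e \<longleftrightarrow> e x = e y + 1"
| "sat D I (Cong0 n x) \<rho> e \<longleftrightarrow> int n dvd e x"
| "sat D I (Rel Q us s) \<rho> e \<longleftrightarrow> \<rho> Q (map e us) (e s)"
| "sat D I (Prev Q us s) \<rho> e \<longleftrightarrow> \<rho> Q (map e us) (e s - 1)"
| "sat D I (Neg \<phi>) \<rho> e \<longleftrightarrow> \<not> sat D I \<phi> \<rho> e"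
| "sat D I (And \<phi> \<psi>) \<rho> e \<longleftrightarrow> sat D I \<phi> \<rho> e \<and> sat D I \<psi> \<rho> e"
| "sat D I (Or \<phi> \<psi>) \<rho> e \<longleftrightarrow> sat D I \<phi> \<rho> e \<or> sat D I \<psi> \<rho> e"
| "sat D I (Imp \<phi> \<psi>) \<rho> e \<longleftrightarrow> (sat D I \<phi> \<rho> e \<longrightarrow> sat D I \<psi> \<rho> e)"
| "sat D I (All x \<phi>) \<rho> e \<longleftrightarrow> (\<forall>d\<in>D. sat D I \<phi> \<rho> (e(x := d)))"
| "sat D I (Ex x \<phi>) \<rho> e \<longleftrightarrow> (\<exists>d\<in>D. sat D I \<phi> \<rho> (e(x := d)))"
| "sat D I (Rpr t ds \<Psi>) \<rho> e \<longleftrightarrow>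
     sat D I \<Psi> (rpr_env (map (\<lambda>(Q, zs, \<Theta>). (Q, zs, sat D I \<Theta>)) ds) t \<rho> e) e"

text \<open>
  \<open>holds D I \<phi> ts ls\<close> is the truth of \<open>\<phi>(ls)\<close>, where \<open>ts\<close> lists the free variables of \<open>\<phi>\<close> and
  \<open>\<phi>\<close> has no free relation variables; the default values used here then do not matter.
\<close>

definition holds :: "int set \<Rightarrow> interp \<Rightarrow> form \<Rightarrow> var list \<Rightarrow> int list \<Rightarrow> bool" where
  "holds D I \<phi> ts ls \<longleftrightarrow> sat D I \<phi> (\<lambda>_ _ _. False) (upds (\<lambda>_. 0) ts ls)"


subsection \<open>Languages\<close>

text \<open>The first-order formulas over the atomic formulas in \<open>At\<close>.\<close>

inductive_set FOL :: "form set \<Rightarrow> form set" for At :: "form set" where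
  atomic: "\<phi> \<in> At \<Longrightarrow> \<phi> \<in> FOL At"
| Neg: "\<phi> \<in> FOL At \<Longrightarrow> Neg \<phi> \<in> FOL At"
| And: "\<phi> \<in> FOL At \<Longrightarrow> \<psi> \<in> FOL At \<Longrightarrow> And \<phi> \<psi> \<in> FOL At"
| Or: "\<phi> \<in> FOL At \<Longrightarrow> \<psi> \<in> FOL At \<Longrightarrow> Or \<phi> \<psi> \<in> FOL At"
| Imp: "\<phi> \<in> FOL At \<Longrightarrow> \<psi> \<in> FOL At \<Longrightarrow> Imp \<phi> \<psi> \<in> FOL At"
| All: "\<phi> \<in> FOL At \<Longrightarrow> All x \<phi> \<in> FOL At"
| Ex: "\<phi> \<in> FOL At \<Longrightarrow> Ex x \<phi> \<in> FOL At"

definition FO_less :: "form set" where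
  "FO_less = FOL ({Atm A x |A x. True} \<union> {Less x y |x y. True} \<union> {Equal x y |x y. True})"

definition FO_less_cong :: "form set" where
  "FO_less_cong = FOL ({Atm A x |A x. True} \<union> {Less x y |x y. True} \<union> {Equal x y |x y. True}
     \<union> {Cong0 n x |n x. n > 1})"

definition MFO :: "form set" where
  "MFO = FOL ({Atm A x |A x. True} \<union> {Less x y |x y. True} \<union> {Equal x y |x y. True}
     \<union> {Succ x y |x y. True})"

text \<open>
  In queries, \<open>Equal\<close> and \<open>Succ\<close> are abbreviations for formulas with \<open>Less\<close> only; being primitive
  here, they must have the meaning of these formulas over the integers.
\<close>

lemma sat_Equal_iff: "sat D I (Equal x y) \<rho> e \<longleftrightarrow> sat D I (And (Neg (Less x y)) (Neg (Less y x))) \<rho> e"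
  by auto

lemma sat_Succ_iff:
  assumes "z \<noteq> x" "z \<noteq> y"
  shows "sat UNIV I (Succ x y) \<rho> e \<longleftrightarrow>
    sat UNIV I (And (Less y x) (Neg (Ex z (And (Less y z) (Less z x))))) \<rho> e"
proof -
  have "b < a \<and> \<not> (\<exists>d. b < d \<and> d < a) \<longleftrightarrow> a = b + 1" for a b :: int
    by presburger
  then show ?thesis
    using assms by simp
qed

inductive quasi_positive :: "form \<Rightarrow> bool" where
  "quasi_positive (Atm A x)"
| "quasi_positive (Less x y)"
| "quasi_positive (Equal x y)"
| "quasi_positive (Succ x y)"
| "quasi_positive \<phi> \<Longrightarrow> quasi_positive \<psi> \<Longrightarrow> quasi_positive (And \<phi> \<psi>)"
| "quasi_positive \<phi> \<Longrightarrow> quasi_positive \<psi> \<Longrightarrow> quasi_positive (Or \<phi> \<psi>)"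
| "quasi_positive \<phi> \<Longrightarrow> quasi_positive (All x \<phi>)"
| "quasi_positive \<phi> \<Longrightarrow> quasi_positive (Ex x \<phi>)"
| "quasi_positive \<phi> \<Longrightarrow> quasi_positive (All y (Imp (And (Less x y) (Less y z)) \<phi>))"
| "quasi_positive \<phi> \<Longrightarrow> quasi_positive (All y (Imp (Less x y) \<phi>))"
| "quasi_positive \<phi> \<Longrightarrow> quasi_positive (All y (Imp (Less y z) \<phi>))"

lemma quasi_positive_MFO: "quasi_positive \<phi> \<Longrightarrow> \<phi> \<in> MFO"
  unfolding MFO_def by (induction rule: quasi_positive.induct) (blast intro: FOL.intros)+

text \<open>
  \<open>FO_RPR_in \<Gamma> \<Delta>\<close> contains the formulas with relational primitive recursion whose free relation
  variables are used only as atoms \<open>Q(us, s)\<close>, where \<open>\<Gamma> Q\<close> is the length of \<open>us\<close>, or as one of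
  the atoms \<open>Q(us, s - 1)\<close> with \<open>(Q, us, s)\<close> in \<open>\<Delta>\<close>. In the definition of \<open>Q\<^sub>i(zs\<^sub>i, t)\<close>, the
  simultaneously defined \<open>Q\<^sub>j\<close> occur only as \<open>Q\<^sub>j(zs\<^sub>j, t - 1)\<close>: the \<open>zs\<^sub>j\<close> are parameters
  of the recursion, which must not be replaced by other variables or bound by quantifiers.
  Allowing \<open>\<exists>u. Q(u, t - 1)\<close>, say, would be a much stronger form of recursion. The
  right-hand side has no free variables other than \<open>zs\<^sub>i\<close> and \<open>t\<close>.
\<close>

abbreviation avoiding :: "var set \<Rightarrow> (rel \<times> var list \<times> var) set \<Rightarrow> (rel \<times> var list \<times> var) set" where
  "avoiding X \<Delta> \<equiv> {(Q, us, s) \<in> \<Delta>. insert s (set us) \<inter> X = {}}"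

inductive FO_RPR_in :: "(rel \<rightharpoonup> nat) \<Rightarrow> (rel \<times> var list \<times> var) set \<Rightarrow> form \<Rightarrow> bool" where
  "FO_RPR_in \<Gamma> \<Delta> (Atm A x)"
| "FO_RPR_in \<Gamma> \<Delta> (Equal x y)"
| "FO_RPR_in \<Gamma> \<Delta> (Succ x y)"
| "\<Gamma> Q = Some (length us) \<Longrightarrow> FO_RPR_in \<Gamma> \<Delta> (Rel Q us s)"
| "(Q, us, s) \<in> \<Delta> \<Longrightarrow> FO_RPR_in \<Gamma> \<Delta> (Prev Q us s)"
| "FO_RPR_in \<Gamma> \<Delta> \<phi> \<Longrightarrow> FO_RPR_in \<Gamma> \<Delta> (Neg \<phi>)"
| "FO_RPR_in \<Gamma> \<Delta> \<phi> \<Longrightarrow> FO_RPR_in \<Gamma> \<Delta> \<psi> \<Longrightarrow> FO_RPR_in \<Gamma> \<Delta> (And \<phi> \<psi>)"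
| "FO_RPR_in \<Gamma> \<Delta> \<phi> \<Longrightarrow> FO_RPR_in \<Gamma> \<Delta> \<psi> \<Longrightarrow> FO_RPR_in \<Gamma> \<Delta> (Or \<phi> \<psi>)"
| "FO_RPR_in \<Gamma> \<Delta> \<phi> \<Longrightarrow> FO_RPR_in \<Gamma> \<Delta> \<psi> \<Longrightarrow> FO_RPR_in \<Gamma> \<Delta> (Imp \<phi> \<psi>)"
| "FO_RPR_in \<Gamma> (avoiding {x} \<Delta>) \<phi> \<Longrightarrow> FO_RPR_in \<Gamma> \<Delta> (All x \<phi>)"
| "FO_RPR_in \<Gamma> (avoiding {x} \<Delta>) \<phi> \<Longrightarrow> FO_RPR_in \<Gamma> \<Delta> (Ex x \<phi>)"
| "\<lbrakk>\<And>Q zs \<Theta>. (Q, zs, \<Theta>) \<in> set ds \<Longrightarrow>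
       distinct (t # zs) \<and> fv \<Theta> \<subseteq> insert t (set zs) \<and>
       FO_RPR_in \<Gamma>
         (avoiding (insert t (set zs)) \<Delta> \<union> {(Q', zs', t) |Q' zs' \<Theta>'. (Q', zs', \<Theta>') \<in> set ds}) \<Theta>;
    FO_RPR_in (\<Gamma> ++ map_of (map (\<lambda>(Q, zs, \<Theta>). (Q, length zs)) ds)) \<Delta> \<Psi>\<rbrakk>
   \<Longrightarrow> FO_RPR_in \<Gamma> \<Delta> (Rpr t ds \<Psi>)"

definition FO_RPR :: "form set" where
  "FO_RPR = {\<phi>. FO_RPR_in Map.empty {} \<phi> \<and> distinct (defined_rels \<phi>)}"


section \<open>Ontology-mediated queries\<close>

definition OMQ :: "clause set \<Rightarrow> form \<Rightarrow> var list \<Rightarrow> bool" where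
  "OMQ \<O> \<psi> ts \<longleftrightarrow> finite \<O> \<and> \<psi> \<in> MFO \<and> distinct ts \<and> set ts = fv \<psi>"

text \<open>For \<open>ts = []\<close>, the empty tuple is a certain answer iff the query is entailed.\<close>

definition certain_answer :: "clause set \<Rightarrow> form \<Rightarrow> var list \<Rightarrow> data \<Rightarrow> int list \<Rightarrow> bool" where
  "certain_answer \<O> \<psi> ts \<A> ls \<longleftrightarrow> (\<forall>M. model M \<O> \<A> \<longrightarrow> holds UNIV M \<psi> ts ls)"

definition holds_in_data :: "data \<Rightarrow> form \<Rightarrow> var list \<Rightarrow> int list \<Rightarrow> bool" where
  "holds_in_data \<A> \<phi> ts ls \<longleftrightarrow> holds (tem \<A>) (\<lambda>A. {l. (A, l) \<in> \<A>}) \<phi> ts ls"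

definition rewritable :: "form set \<Rightarrow> clause set \<Rightarrow> form \<Rightarrow> var list \<Rightarrow> bool" where
  "rewritable \<L> \<O> \<psi> ts \<longleftrightarrow> (\<exists>\<phi>\<in>\<L>. fv \<phi> = set ts \<and>
     (\<forall>\<A> ls. data_instance \<A> \<longrightarrow> length ls = length ts \<longrightarrow> set ls \<subseteq> tem \<A> \<longrightarrow>
        (certain_answer \<O> \<psi> ts \<A> ls \<longleftrightarrow> holds_in_data \<A> \<phi> ts ls)))"

end

theory Submission
  imports Defs
begin

text \<open>
  For (1), the models of \<open>\<O>\<close> that refute the query are the bi-infinite words satisfying a first-order
  formula. The finite words, up to interchangeability inside bi-infinite words satisfying that
  formula, form finitely many classes, and relational primitive recursion computes the classes of
  the words of length \<open>t + 1\<close> that extend the data up to time \<open>t\<close>.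

  For (2) and (3), let \<open>M\<close> be a model of a Horn ontology. The facts derived from the data and from the
  extensions in \<open>M\<close> of the box concepts form a model below \<open>M\<close>, and quasi-positive formulas are
  monotone, so it suffices to consider such models. They are given by finitely many cut points,
  over which one can quantify. Given the cuts, the derived facts are first-order definable over the
  integers: pointwise for box ontologies, and by walks in a finite graph, whose possible lengths are
  eventually periodic, for core ontologies. Finally, quantifiers over the integers are reduced to
  quantifiers over the data, since only a bounded neighbourhood of the data matters.
\<close>

section \<open>Definability by basic formulas\<close>

text \<open>Definability is treated semantically: closure lemmas compose predicates, and the
  formulas themselves stay implicit. The obstacle in (2) and (3) is the box: inferring one takes
  infinitely many premises. Once the extensions of the boxes are guessed, every derivation is
  finitary, and each guess costs only two integers. Wrong guesses do no harm: whatever the cuts, the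
  derived interpretation contains the data, and it only has to be checked against the clauses. Hence
  being a certain answer becomes a universal statement over cuts. In the core case each rule has at
  most one premise, so derivations are walks. A walk may wander far beyond its endpoints; its
  possible lengths are therefore studied through the dual objects, families of sets closed under the
  edges, which can be cut and rejoined locally. In (1) the query need not be monotone, so small
  models do not suffice; all refuting models are treated at once as words, sorted into Myhill-Nerode
  classes, where each quantifier costs one power set.\<close>

datatype bform =
    BAtom atom var
  | BLess var var
  | BCong nat var
  | BNeg bform
  | BAnd bform bform
  | BEx var bform

primrec bsat :: "int set \<Rightarrow> interp \<Rightarrow> bform \<Rightarrow> asg \<Rightarrow> bool" where
  "bsat D I (BAtom A x) e \<longleftrightarrow> e x \<in> I A"
| "bsat D I (BLess x y) e \<longleftrightarrow> e x < e y"
| "bsat D I (BCong n x) e \<longleftrightarrow> int n dvd e x"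
| "bsat D I (BNeg p) e \<longleftrightarrow> \<not> bsat D I p e"
| "bsat D I (BAnd p q) e \<longleftrightarrow> bsat D I p e \<and> bsat D I q e"
| "bsat D I (BEx x p) e \<longleftrightarrow> (\<exists>d\<in>D. bsat D I p (e(x := d)))"

primrec bfv :: "bform \<Rightarrow> var set" where
  "bfv (BAtom A x) = {x}"
| "bfv (BLess x y) = {x, y}"
| "bfv (BCong n x) = {x}"
| "bfv (BNeg p) = bfv p"
| "bfv (BAnd p q) = bfv p \<union> bfv q"
| "bfv (BEx x p) = bfv p - {x}"

primrec bvars :: "bform \<Rightarrow> var set" where
  "bvars (BAtom A x) = {x}"
| "bvars (BLess x y) = {x, y}"
| "bvars (BCong n x) = {x}"
| "bvars (BNeg p) = bvars p"
| "bvars (BAnd p q) = bvars p \<union> bvars q"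
| "bvars (BEx x p) = insert x (bvars p)"

primrec batoms :: "bform \<Rightarrow> atom set" where
  "batoms (BAtom A x) = {A}"
| "batoms (BLess x y) = {}"
| "batoms (BCong n x) = {}"
| "batoms (BNeg p) = batoms p"
| "batoms (BAnd p q) = batoms p \<union> batoms q"
| "batoms (BEx x p) = batoms p"

text \<open>The flag lets one development serve both first-order languages: \<open>False\<close>
  forbids congruences, and \<open>n > 1\<close> matches the congruence atoms of
  \<open>FO_less_cong\<close>.\<close>

primrec cong_ok :: "bool \<Rightarrow> bform \<Rightarrow> bool" where
  "cong_ok b (BAtom A x) \<longleftrightarrow> True"
| "cong_ok b (BLess x y) \<longleftrightarrow> True"
| "cong_ok b (BCong n x) \<longleftrightarrow> b \<and> n > 1"
| "cong_ok b (BNeg p) \<longleftrightarrow> cong_ok b p"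
| "cong_ok b (BAnd p q) \<longleftrightarrow> cong_ok b p \<and> cong_ok b q"
| "cong_ok b (BEx x p) \<longleftrightarrow> cong_ok b p"

primrec to_form :: "bform \<Rightarrow> form" where
  "to_form (BAtom A x) = Atm A x"
| "to_form (BLess x y) = Less x y"
| "to_form (BCong n x) = Cong0 n x"
| "to_form (BNeg p) = Neg (to_form p)"
| "to_form (BAnd p q) = And (to_form p) (to_form q)"
| "to_form (BEx x p) = Ex x (to_form p)"

lemma sat_to_form: "sat D I (to_form p) \<rho> e \<longleftrightarrow> bsat D I p e"
  by (induction p arbitrary: e) auto

lemma fv_to_form: "fv (to_form p) = bfv p"
  by (induction p) auto

lemma to_form_FO_less_cong: "cong_ok True p \<Longrightarrow> to_form p \<in> FO_less_cong"
  unfolding FO_less_cong_def by (induction p) (auto intro: FOL.intros)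

lemma to_form_FO_less: "cong_ok False p \<Longrightarrow> to_form p \<in> FO_less"
  unfolding FO_less_def by (induction p) (auto intro: FOL.intros)

lemma finite_bvars: "finite (bvars p)"
  by (induction p) auto

lemma finite_batoms: "finite (batoms p)"
  by (induction p) auto

lemma bfv_subset_bvars: "bfv p \<subseteq> bvars p"
  by (induction p) auto

lemma bsat_cong:
  "(\<And>x. x \<in> bfv p \<Longrightarrow> e x = e' x) \<Longrightarrow> (\<And>A. A \<in> batoms p \<Longrightarrow> I A = I' A) \<Longrightarrow>
    bsat D I p e \<longleftrightarrow> bsat D I' p e'"
proof (induction p arbitrary: e e')
  case (BEx x p)
  have "bsat D I p (e(x := d)) \<longleftrightarrow> bsat D I' p (e'(x := d))" for d
    using BEx.prems by (intro BEx.IH) auto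
  then show ?case by simp
next
  case (BAnd p q)
  have "bsat D I p e \<longleftrightarrow> bsat D I' p e'" "bsat D I q e \<longleftrightarrow> bsat D I' q e'"
    using BAnd.prems by (intro BAnd.IH; simp)+
  then show ?case by simp
qed auto

text \<open>A single formula has to work for all structures in \<open>K\<close>. The predicate also
  receives the domain, so that it can speak of \<open>Max D\<close> or quantify over
  \<open>D\<close>.\<close>

definition definable ::
  "bool \<Rightarrow> (int set \<times> interp) set \<Rightarrow> var set \<Rightarrow> (int set \<Rightarrow> interp \<Rightarrow> asg \<Rightarrow> bool) \<Rightarrow> bool" where
  "definable b K V F \<longleftrightarrow> (\<exists>p. cong_ok b p \<and> bfv p \<subseteq> V \<and>
     (\<forall>D I e. (D, I) \<in> K \<longrightarrow> e ` V \<subseteq> D \<longrightarrow> (bsat D I p e \<longleftrightarrow> F D I e)))"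

abbreviation integer_structures :: "(int set \<times> interp) set" where
  "integer_structures \<equiv> {UNIV} \<times> UNIV"

abbreviation data_structures :: "(int set \<times> interp) set" where
  "data_structures \<equiv> {({0..m}, I) |m I. m \<ge> 1 \<and> (\<forall>A. I A \<subseteq> {0..m})}"

lemma definable_cong:
  assumes "definable b K V F"
    and "\<And>D I e. (D, I) \<in> K \<Longrightarrow> e ` V \<subseteq> D \<Longrightarrow> F D I e \<longleftrightarrow> G D I e"
  shows "definable b K V G"
proof -
  obtain p where "cong_ok b p" "bfv p \<subseteq> V"
    "\<forall>D I e. (D, I) \<in> K \<longrightarrow> e ` V \<subseteq> D \<longrightarrow> (bsat D I p e \<longleftrightarrow> F D I e)"
    using assms(1) unfolding definable_def by blast
  then show ?thesis
    unfolding definable_def using assms(2) by (intro exI[of _ p]) simp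
qed

lemma definable_mono:
  assumes "definable b K V F" "V \<subseteq> W"
  shows "definable b K W F"
proof -
  obtain p where "cong_ok b p" "bfv p \<subseteq> V"
    "\<forall>D I e. (D, I) \<in> K \<longrightarrow> e ` V \<subseteq> D \<longrightarrow> (bsat D I p e \<longleftrightarrow> F D I e)"
    using assms(1) unfolding definable_def by blast
  moreover have "e ` V \<subseteq> D" if "e ` W \<subseteq> D" for e :: asg and D
    using that assms(2) by blast
  ultimately show ?thesis
    unfolding definable_def using assms(2) by (intro exI[of _ p]) auto
qed

section \<open>Closure properties of definability\<close>

lemma definable_atom: "x \<in> V \<Longrightarrow> definable b K V (\<lambda>D I e. e x \<in> I A)"
  unfolding definable_def by (intro exI[of _ "BAtom A x"]) auto

lemma definable_less: "x \<in> V \<Longrightarrow> y \<in> V \<Longrightarrow> definable b K V (\<lambda>D I e. e x < e y)"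
  unfolding definable_def by (intro exI[of _ "BLess x y"]) auto

lemma definable_dvd: "x \<in> V \<Longrightarrow> b \<Longrightarrow> n > 1 \<Longrightarrow> definable b K V (\<lambda>D I e. int n dvd e x)"
  unfolding definable_def by (intro exI[of _ "BCong n x"]) auto

lemma definable_not: "definable b K V F \<Longrightarrow> definable b K V (\<lambda>D I e. \<not> F D I e)"
  unfolding definable_def
proof (elim exE conjE, goal_cases)
  case (1 p)
  then show ?case by (intro exI[of _ "BNeg p"]) auto
qed

lemma definable_and:
  "definable b K V F \<Longrightarrow> definable b K V G \<Longrightarrow> definable b K V (\<lambda>D I e. F D I e \<and> G D I e)"
  unfolding definable_def
proof (elim exE conjE, goal_cases)
  case (1 p q)
  then show ?case by (intro exI[of _ "BAnd p q"]) auto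
qed

lemma definable_ex:
  "definable b K (insert x V) F \<Longrightarrow> definable b K V (\<lambda>D I e. \<exists>d\<in>D. F D I (e(x := d)))"
  unfolding definable_def
proof (elim exE conjE, goal_cases)
  case (1 p)
  have "bsat D I p (e(x := d)) \<longleftrightarrow> F D I (e(x := d))"
    if "(D, I) \<in> K" "e ` V \<subseteq> D" "d \<in> D" for D I e d
    using 1(3) that by (auto simp: image_subset_iff)
  then show ?case using 1(1,2) by (intro exI[of _ "BEx x p"]) auto
qed

lemma definable_const: "definable b K V (\<lambda>D I e. c)"
proof -
  \<comment> \<open>The formula must be closed, since \<open>V\<close> may be empty.\<close>
  have F: "definable b K V (\<lambda>D I e. False)"
    unfolding definable_def by (intro exI[of _ "BEx 0 (BLess 0 0)"]) auto
  show ?thesis using F definable_not[OF F] by (cases c) simp_all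
qed

lemma definable_or:
  "definable b K V F \<Longrightarrow> definable b K V G \<Longrightarrow> definable b K V (\<lambda>D I e. F D I e \<or> G D I e)"
  using definable_not[OF definable_and[OF definable_not definable_not], of b K V F G] by simp

lemma definable_imp:
  "definable b K V F \<Longrightarrow> definable b K V G \<Longrightarrow> definable b K V (\<lambda>D I e. F D I e \<longrightarrow> G D I e)"
  using definable_not[OF definable_and[OF _ definable_not], of b K V F G] by simp

lemma definable_iff:
  "definable b K V F \<Longrightarrow> definable b K V G \<Longrightarrow> definable b K V (\<lambda>D I e. F D I e \<longleftrightarrow> G D I e)"
  using definable_and[OF definable_imp definable_imp, of b K V F G G F]
  by (rule definable_cong) auto

lemma definable_eq:
  assumes "x \<in> V" "y \<in> V"
  shows "definable b K V (\<lambda>D I e. e x = e y)"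
  by (rule definable_cong[OF definable_and[OF definable_not definable_not,
        OF definable_less definable_less, OF assms assms(2,1)]]) auto

lemma definable_Bex:
  assumes "finite X" "\<And>i. i \<in> X \<Longrightarrow> definable b K V (F i)"
  shows "definable b K V (\<lambda>D I e. \<exists>i\<in>X. F i D I e)"
  using assms
proof (induction X rule: finite_induct)
  case empty
  then show ?case by (simp add: definable_const)
next
  case (insert i X)
  have "definable b K V (\<lambda>D I e. F i D I e \<or> (\<exists>i\<in>X. F i D I e))"
    using insert by (intro definable_or) auto
  then show ?case by simp
qed

lemma definable_Ball:
  assumes "finite X" "\<And>i. i \<in> X \<Longrightarrow> definable b K V (F i)"
  shows "definable b K V (\<lambda>D I e. \<forall>i\<in>X. F i D I e)"
  using definable_not[OF definable_Bex[OF assms(1) definable_not[OF assms(2)]]] by simp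

text \<open>Lets predicates bind a point \<open>d\<close> directly instead of a named variable: a
  variable outside \<open>V\<close> carries the point, and the last assumption says that
  \<open>G\<close> does not otherwise look at that variable.\<close>

lemma definable_ex_fresh:
  assumes "finite V"
    and "\<And>z. z \<notin> V \<Longrightarrow> definable b K (insert z V) (\<lambda>D I e. G D I e (e z))"
    and "\<And>z D I e d d'. z \<notin> V \<Longrightarrow> G D I (e(z := d)) d' \<longleftrightarrow> G D I e d'"
  shows "definable b K V (\<lambda>D I e. \<exists>d\<in>D. G D I e d)"
proof -
  obtain z where z: "z \<notin> V" using ex_new_if_finite[OF infinite_UNIV_nat assms(1)] by blast
  show ?thesis using definable_ex[OF assms(2)[OF z]] z by (simp add: assms(3))
qed

lemma definable_all_fresh:
  assumes "finite V"
    and "\<And>z. z \<notin> V \<Longrightarrow> definable b K (insert z V) (\<lambda>D I e. G D I e (e z))"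
    and "\<And>z D I e d d'. z \<notin> V \<Longrightarrow> G D I (e(z := d)) d' \<longleftrightarrow> G D I e d'"
  shows "definable b K V (\<lambda>D I e. \<forall>d\<in>D. G D I e d)"
proof -
  have "definable b K V (\<lambda>D I e. \<exists>d\<in>D. \<not> G D I e d)"
    using assms by (intro definable_ex_fresh definable_not) auto
  from definable_not[OF this] show ?thesis by simp
qed

text \<open>Quantifies over all variables of \<open>X\<close> at once, by way of a changed
  assignment; this is how all cuts are guessed simultaneously.\<close>

lemma definable_ex_vars:
  assumes "finite X" "definable b K (V \<union> X) F"
  shows "definable b K V (\<lambda>D I e. \<exists>e'. e' ` X \<subseteq> D \<and> (\<forall>x. x \<notin> X \<longrightarrow> e' x = e x) \<and> F D I e')"
  using assms
proof (induction X arbitrary: F rule: finite_induct)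
  case empty
  have "(\<forall>x. e' x = e x) \<longleftrightarrow> e' = e" for e e' :: asg
    by auto
  then show ?case using empty by simp
next
  case (insert z X)
  have eq: "(\<exists>e'. e' ` X \<subseteq> D \<and> (\<forall>x. x \<notin> X \<longrightarrow> e' x = e x) \<and> (\<exists>d\<in>D. F D I (e'(z := d)))) \<longleftrightarrow>
     (\<exists>e'. e' ` insert z X \<subseteq> D \<and> (\<forall>x. x \<notin> insert z X \<longrightarrow> e' x = e x) \<and> F D I e')"
    (is "?L \<longleftrightarrow> ?R") for D I e
  proof
    assume ?L
    then obtain e' d where "e' ` X \<subseteq> D" "\<forall>x. x \<notin> X \<longrightarrow> e' x = e x" "d \<in> D" "F D I (e'(z := d))"
      by blast
    then show ?R using insert.hyps(2) by (intro exI[of _ "e'(z := d)"]) auto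
  next
    assume ?R
    then obtain e' where "e' ` insert z X \<subseteq> D" "\<forall>x. x \<notin> insert z X \<longrightarrow> e' x = e x" "F D I e'"
      by blast
    \<comment> \<open>Resetting \<open>z\<close> to its old value restores agreement outside
      \<open>X\<close>; the value \<open>e' z\<close> becomes the witness of the inner
      quantifier.\<close>
    then show ?L using insert.hyps(2)
      by (intro exI[of _ "e'(z := e z)"] conjI bexI[of _ "e' z"]) auto
  qed
  have "definable b K (V \<union> X) (\<lambda>D I e. \<exists>d\<in>D. F D I (e(z := d)))"
    using insert.prems by (intro definable_ex) simp
  from insert.IH[OF this] show ?case by (simp only: eq)
qed

abbreviation convex_structures :: "(int set \<times> interp) set \<Rightarrow> bool" where
  "convex_structures K \<equiv> \<forall>(D, I)\<in>K. \<forall>a\<in>D. \<forall>b\<in>D. {a..b} \<subseteq> D"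

text \<open>In a convex domain the point \<open>e y + 1\<close> is present as soon as some point
  lies above \<open>e y\<close>, so the order alone determines the integer successor.\<close>

lemma definable_succ:
  assumes "convex_structures K" "x \<in> V" "y \<in> V"
  shows "definable b K V (\<lambda>D I e. e x = e y + 1)"
proof -
  have "definable b K {x, y} (\<lambda>D I e. e y < e x \<and> \<not> (\<exists>d\<in>D. e y < d \<and> d < e x))"
    by (intro definable_and definable_not definable_ex_fresh definable_less) auto
  then have "definable b K V (\<lambda>D I e. e y < e x \<and> \<not> (\<exists>d\<in>D. e y < d \<and> d < e x))"
    by (rule definable_mono) (use assms in auto)
  then show ?thesis
  proof (rule definable_cong)
    fix D I and e :: asg assume "(D, I) \<in> K" "e ` V \<subseteq> D"
    then have "{e y..e x} \<subseteq> D" using assms by (fastforce simp: image_subset_iff)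
    then show "e y < e x \<and> \<not> (\<exists>d\<in>D. e y < d \<and> d < e x) \<longleftrightarrow> e x = e y + 1"
      by (auto dest!: subsetD[where c = "e y + 1"])
  qed
qed

lemma definable_add:
  assumes K: "convex_structures K" and "x \<in> V" "y \<in> V"
  shows "definable b K V (\<lambda>D I e. e x = e y + int c)"
proof -
  have "definable b K {x, y} (\<lambda>D I e. e x = e y + int c)" for x y
  proof (induction c arbitrary: x)
    case 0
    then show ?case by (simp add: definable_eq)
  next
    case (Suc c)
    have "definable b K {x, y} (\<lambda>D I e. \<exists>d\<in>D. e x = d + 1 \<and> d = e y + int c)"
    proof (intro definable_ex_fresh definable_and)
      fix z assume "z \<notin> {x, y}"
      show "definable b K (insert z {x, y}) (\<lambda>D I e. e x = e z + 1)"
        by (rule definable_succ[OF K]) auto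
      show "definable b K (insert z {x, y}) (\<lambda>D I e. e z = e y + int c)"
        by (rule definable_mono[OF Suc]) auto
    qed auto
    then show ?case
    proof (rule definable_cong)
      fix D I and e :: asg assume DI: "(D, I) \<in> K" "e ` {x, y} \<subseteq> D"
      then have "{e y..e x} \<subseteq> D" using K by fastforce
      then show "(\<exists>d\<in>D. e x = d + 1 \<and> d = e y + int c) \<longleftrightarrow> e x = e y + int (Suc c)"
        by (auto dest!: subsetD[where c = "e y + int c"])
    qed
  qed
  then show ?thesis by (rule definable_mono) (use assms in auto)
qed

section \<open>From the integers to a data instance\<close>

primrec moduli :: "bform \<Rightarrow> nat set" where
  "moduli (BAtom A x) = {}"
| "moduli (BLess x y) = {}"
| "moduli (BCong n x) = {n}"
| "moduli (BNeg p) = moduli p"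
| "moduli (BAnd p q) = moduli p \<union> moduli q"
| "moduli (BEx x p) = moduli p"

lemma finite_moduli: "finite (moduli p)"
  by (induction p) auto

lemma cong_ok_moduli: "cong_ok b p \<Longrightarrow> n \<in> moduli p \<Longrightarrow> n > 1"
  by (induction p) auto

text \<open>
  Truth of a formula does not change when all points beyond a long gap outside the data are moved
  by a common period. With \<open>\<sigma> = 1\<close> the gap is to the right of the data, with \<open>\<sigma> = - 1\<close> to the left.
\<close>

definition shift_insensitive :: "int \<Rightarrow> int \<Rightarrow> bform \<Rightarrow> bool" where
  "shift_insensitive P G p \<longleftrightarrow> (\<forall>I e e' c \<sigma>. \<sigma> \<in> {1, -1} \<longrightarrow> (\<forall>A. \<forall>n\<in>I A. \<sigma> * n \<le> c) \<longrightarrow>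
    (\<forall>x\<in>bfv p. \<sigma> * e x \<le> c \<and> e' x = e x \<or> \<sigma> * e x > c + G \<and> e' x = e x + \<sigma> * P) \<longrightarrow>
    (bsat UNIV I p e \<longleftrightarrow> bsat UNIV I p e'))"

lemma shift_insensitiveD:
  assumes "shift_insensitive P G p" "\<sigma> \<in> {1, -1}" "\<And>A n. n \<in> I A \<Longrightarrow> \<sigma> * n \<le> c"
    and "\<And>x. x \<in> bfv p \<Longrightarrow> \<sigma> * e x \<le> c \<and> e' x = e x \<or> \<sigma> * e x > c + G \<and> e' x = e x + \<sigma> * P"
  shows "bsat UNIV I p e \<longleftrightarrow> bsat UNIV I p e'"
  using assms unfolding shift_insensitive_def by blast

lemma shift_insensitive_mono:
  assumes "shift_insensitive P G p" "G \<le> H"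
  shows "shift_insensitive P H p"
proof -
  have "bsat UNIV I p e \<longleftrightarrow> bsat UNIV I p e'"
    if "\<sigma> \<in> {1, -1}" "\<forall>A. \<forall>n\<in>I A. \<sigma> * n \<le> c" and
      "\<forall>x\<in>bfv p. \<sigma> * e x \<le> c \<and> e' x = e x \<or> \<sigma> * e x > c + H \<and> e' x = e x + \<sigma> * P"
    for I e e' c \<sigma>
  proof (rule shift_insensitiveD[OF assms(1) that(1)])
    fix x assume "x \<in> bfv p"
    then have "\<sigma> * e x \<le> c \<and> e' x = e x \<or> \<sigma> * e x > c + H \<and> e' x = e x + \<sigma> * P"
      using that(3) by blast
    then show "\<sigma> * e x \<le> c \<and> e' x = e x \<or> \<sigma> * e x > c + G \<and> e' x = e x + \<sigma> * P"
      using assms(2) by linarith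
  qed (use that(2) in blast)
  then show ?thesis unfolding shift_insensitive_def by blast
qed

text \<open>Only quantifiers enlarge the gap, from \<open>G\<close> to \<open>2 * G + P\<close>. A
  witness up to \<open>c + G + P\<close> stays where it is and still leaves a gap of
  \<open>G\<close> before the moved points; a witness beyond \<open>c + G\<close> moves along with
  them. \<open>P\<close> has to be a multiple of all moduli so that congruences survive the
  move.\<close>

lemma shift_insensitive_exists:
  fixes P :: int
  assumes "P > 0" "\<forall>n\<in>moduli p. int n dvd P"
  shows "\<exists>G\<ge>0. shift_insensitive P G p"
  using assms(2)
proof (induction p)
  case (BAtom A x)
  have "bsat UNIV I (BAtom A x) e \<longleftrightarrow> bsat UNIV I (BAtom A x) e'"
    if "\<sigma> \<in> {1, -1}" and I: "\<forall>A. \<forall>n\<in>I A. \<sigma> * n \<le> c"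
      and x: "\<sigma> * e x \<le> c \<and> e' x = e x \<or> \<sigma> * e x > c + 0 \<and> e' x = e x + \<sigma> * P"
    for I e e' c \<sigma>
  proof (cases "\<sigma> * e x \<le> c")
    case False
    then have "\<not> \<sigma> * e' x \<le> c" using x \<open>P > 0\<close> \<open>\<sigma> \<in> {1, -1}\<close> by auto
    then show ?thesis using I False by auto
  qed (use x in auto)
  then have "shift_insensitive P 0 (BAtom A x)" unfolding shift_insensitive_def by simp
  then show ?case by blast
next
  case (BLess x y)
  have "shift_insensitive P 0 (BLess x y)"
    using \<open>P > 0\<close> unfolding shift_insensitive_def by auto
  then show ?case by blast
next
  case (BCong n x)
  then have "int n dvd P" by simp
  then have "int n dvd e x + \<sigma> * P \<longleftrightarrow> int n dvd e x" for e :: asg and \<sigma>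
    by (simp add: dvd_add_left_iff)
  then have "shift_insensitive P 0 (BCong n x)"
    unfolding shift_insensitive_def by (auto simp del: mult_minus1)
  then show ?case by blast
next
  case (BNeg p)
  then show ?case by (simp add: shift_insensitive_def)
next
  case (BAnd p q)
  then obtain G H where GH: "G \<ge> 0" "shift_insensitive P G p" "H \<ge> 0" "shift_insensitive P H q"
    by auto
  then have "shift_insensitive P (max G H) p" "shift_insensitive P (max G H) q"
    by (auto intro: shift_insensitive_mono)
  then have "shift_insensitive P (max G H) (BAnd p q)"
    unfolding shift_insensitive_def bsat.simps bfv.simps ball_Un by blast
  then show ?case using GH(1) by (intro exI[of _ "max G H"]) simp
next
  case (BEx x p)
  then obtain G where G: "G \<ge> 0" "shift_insensitive P G p"
    by auto
  have "bsat UNIV I (BEx x p) e \<longleftrightarrow> bsat UNIV I (BEx x p) e'"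
    if \<sigma>: "\<sigma> \<in> {1, -1}" and I: "\<forall>A. \<forall>n\<in>I A. \<sigma> * n \<le> c"
      and *: "\<forall>y\<in>bfv (BEx x p).
        \<sigma> * e y \<le> c \<and> e' y = e y \<or> \<sigma> * e y > c + (2 * G + P) \<and> e' y = e y + \<sigma> * P"
    for I e e' c \<sigma>
  proof -
    have keep: "bsat UNIV I p (e(x := d)) \<longleftrightarrow> bsat UNIV I p (e'(x := d))"
      if d: "\<sigma> * d \<le> c + (G + P)" for d
    proof (rule shift_insensitiveD[OF G(2) \<sigma>, of I "max c (\<sigma> * d)"])
      fix A n assume "n \<in> I A"
      then have "\<sigma> * n \<le> c" using I by blast
      then show "\<sigma> * n \<le> max c (\<sigma> * d)" by simp
    next
      fix y assume y: "y \<in> bfv p"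
      show "\<sigma> * (e(x := d)) y \<le> max c (\<sigma> * d) \<and> (e'(x := d)) y = (e(x := d)) y \<or>
        \<sigma> * (e(x := d)) y > max c (\<sigma> * d) + G \<and> (e'(x := d)) y = (e(x := d)) y + \<sigma> * P"
      proof (cases "y = x")
        case False
        then have "\<sigma> * e y \<le> c \<and> e' y = e y \<or> \<sigma> * e y > c + (2 * G + P) \<and> e' y = e y + \<sigma> * P"
          using * y by simp
        then show ?thesis using False d G(1) \<open>P > 0\<close> by auto
      qed simp
    qed
    have move: "bsat UNIV I p (e(x := d)) \<longleftrightarrow> bsat UNIV I p (e'(x := d + \<sigma> * P))"
      if d: "\<sigma> * d > c + G" for d
    proof (rule shift_insensitiveD[OF G(2) \<sigma>, of I c])
      fix A n assume "n \<in> I A"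
      then show "\<sigma> * n \<le> c" using I by blast
    next
      fix y assume y: "y \<in> bfv p"
      show "\<sigma> * (e(x := d)) y \<le> c \<and> (e'(x := d + \<sigma> * P)) y = (e(x := d)) y \<or>
        \<sigma> * (e(x := d)) y > c + G \<and> (e'(x := d + \<sigma> * P)) y = (e(x := d)) y + \<sigma> * P"
      proof (cases "y = x")
        case False
        then have "\<sigma> * e y \<le> c \<and> e' y = e y \<or> \<sigma> * e y > c + (2 * G + P) \<and> e' y = e y + \<sigma> * P"
          using * y by simp
        then show ?thesis using False d G(1) \<open>P > 0\<close> by auto
      qed (use d in simp)
    qed
    show ?thesis
    proof
      assume "bsat UNIV I (BEx x p) e"
      then obtain d where d: "bsat UNIV I p (e(x := d))" by auto
      show "bsat UNIV I (BEx x p) e'"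
      proof (cases "\<sigma> * d \<le> c + (G + P)")
        case True
        then show ?thesis using d keep by auto
      next
        case False
        then have "\<sigma> * d > c + G" using \<open>P > 0\<close> by simp
        then show ?thesis using d move by auto
      qed
    next
      assume "bsat UNIV I (BEx x p) e'"
      then obtain d where d: "bsat UNIV I p (e'(x := d))" by auto
      show "bsat UNIV I (BEx x p) e"
      proof (cases "\<sigma> * d \<le> c + (G + P)")
        case True
        then show ?thesis using d keep by auto
      next
        case False
        \<comment> \<open>The summand \<open>P\<close> in the threshold pays for this: moved back by
          one period, the witness is still beyond the gap.\<close>
        then have "\<sigma> * (d - \<sigma> * P) > c + G" using \<sigma> by auto
        then show ?thesis using d move[of "d - \<sigma> * P"] by auto
      qed
    qed
  qed
  then have "shift_insensitive P (2 * G + P) (BEx x p)"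
    unfolding shift_insensitive_def by blast
  then show ?case using G(1) \<open>P > 0\<close> by (intro exI[of _ "2 * G + P"]) simp
qed

text \<open>A witness too far out is moved one period towards the data. Nothing else moves, because
  the data and the other variables lie within distance \<open>K\<close> of the data interval and the
  moved point stays more than \<open>G\<close> beyond that. The absolute value drops, so this
  ends.\<close>

lemma bsat_bounded_witness:
  assumes G: "shift_insensitive P G p" and "P > 0" "G \<ge> 0" "K \<ge> 0" "m \<ge> 0"
    and I: "\<forall>A. I A \<subseteq> {0..m}"
    and e: "\<And>y. y \<in> bfv p - {x} \<Longrightarrow> e y \<in> {- K..m + K}"
    and d: "bsat UNIV I p (e(x := d))"
  shows "\<exists>d\<in>{- (K + G + P)..m + (K + G + P)}. bsat UNIV I p (e(x := d))"
  using d
proof (induction "nat \<bar>d\<bar>" arbitrary: d rule: less_induct)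
  case less
  consider "d \<in> {- (K + G + P)..m + (K + G + P)}" | "d > m + (K + G + P)" | "d < - (K + G + P)"
    by fastforce
  then show ?case
  proof cases
    case 2
    have "bsat UNIV I p (e(x := d - P)) \<longleftrightarrow> bsat UNIV I p (e(x := d))"
    proof (rule shift_insensitiveD[OF G, of 1 I "m + K"])
      fix y assume "y \<in> bfv p"
      then show "1 * (e(x := d - P)) y \<le> m + K \<and> (e(x := d)) y = (e(x := d - P)) y \<or>
        m + K + G < 1 * (e(x := d - P)) y \<and> (e(x := d)) y = (e(x := d - P)) y + 1 * P"
        using e[of y] 2 by auto
    qed (use I \<open>K \<ge> 0\<close> in fastforce)+
    then show ?thesis using less(1)[of "d - P"] less(2) 2 assms(2-5) by auto
  next
    case 3
    have "bsat UNIV I p (e(x := d + P)) \<longleftrightarrow> bsat UNIV I p (e(x := d))"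
    proof (rule shift_insensitiveD[OF G, of "-1" I K])
      fix y assume "y \<in> bfv p"
      then show "-1 * (e(x := d + P)) y \<le> K \<and> (e(x := d)) y = (e(x := d + P)) y \<or>
        K + G < -1 * (e(x := d + P)) y \<and> (e(x := d)) y = (e(x := d + P)) y + -1 * P"
        using e[of y] 3 by auto
    qed (use I \<open>K \<ge> 0\<close> in fastforce)+
    then show ?thesis using less(1)[of "d + P"] less(2) 3 assms(2-5) by auto
  qed (use less in blast)
qed

text \<open>
  A variable \<open>x\<close> with \<open>s x = Some k\<close> stands for the point at distance \<open>k\<close> to the right of the data,
  or \<open>- k\<close> to the left, according to the sign of \<open>k\<close>.
\<close>

definition place :: "(var \<Rightarrow> int option) \<Rightarrow> int \<Rightarrow> asg \<Rightarrow> asg" where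
  "place s m e x = (case s x of None \<Rightarrow> e x | Some k \<Rightarrow> if k > 0 then m + k else k)"

lemma data_structuresE:
  assumes "(D, I) \<in> data_structures"
  obtains m where "D = {0..m}" "m \<ge> 1" "\<forall>A. I A \<subseteq> {0..m}" "Max D = m"
proof -
  obtain m where m: "D = {0..m}" "m \<ge> 1" "\<forall>A. I A \<subseteq> {0..m}" using assms by auto
  then have "Max D = m" by (intro Max_eqI) auto
  then show ?thesis using m that by blast
qed

lemma definable_is_max:
  "x \<in> V \<Longrightarrow> definable b data_structures V (\<lambda>D I e. e x = Max D)"
proof -
  assume x: "x \<in> V"
  have "definable b data_structures {x} (\<lambda>D I e. \<forall>y\<in>D. \<not> e x < y)"
    by (intro definable_all_fresh definable_not definable_less) auto
  then have "definable b data_structures V (\<lambda>D I e. \<forall>y\<in>D. \<not> e x < y)"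
    by (rule definable_mono) (use x in auto)
  then show ?thesis
  proof (rule definable_cong)
    fix D I and e :: asg assume "(D, I) \<in> data_structures" "e ` V \<subseteq> D"
    then show "(\<forall>y\<in>D. \<not> e x < y) \<longleftrightarrow> e x = Max D"
      using x by (elim data_structuresE) (auto simp: image_subset_iff not_less intro!: antisym)
  qed
qed

text \<open>The greatest multiple of \<open>n\<close> up to the maximum lies in the data, as the minimum is \<open>0\<close>.\<close>

lemma definable_max_dvd:
  assumes "b" "n > 1"
  shows "definable b data_structures V (\<lambda>D I e. int n dvd Max D + k)"
proof -
  have "definable b data_structures {} (\<lambda>D I e. \<exists>z\<in>D. \<exists>w\<in>D.
     z = Max D \<and> int n dvd w \<and> (\<exists>i\<in>{i. i < n \<and> int n dvd int i + k}. z = w + int i))"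
    using assms
    by (intro definable_ex_fresh definable_and definable_Bex definable_is_max definable_dvd
        definable_add) auto
  then have "definable b data_structures {} (\<lambda>D I e. int n dvd Max D + k)"
  proof (rule definable_cong)
    fix D I and e :: asg assume "(D, I) \<in> data_structures"
    then obtain m where D: "D = {0..m}" "m \<ge> 1" "Max D = m" by (rule data_structuresE)
    show "(\<exists>z\<in>D. \<exists>w\<in>D. z = Max D \<and> int n dvd w \<and>
        (\<exists>i\<in>{i. i < n \<and> int n dvd int i + k}. z = w + int i)) \<longleftrightarrow> int n dvd Max D + k"
      (is "?L \<longleftrightarrow> ?R")
    proof
      assume ?L
      then obtain w i where "Max D = w + int i" "int n dvd w" "int n dvd int i + k" by blast
      then show ?R by (metis add.assoc dvd_add)
    next
      assume R: ?R
      define w where "w = m div int n * int n"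
      define i where "i = nat (m mod int n)"
      have m: "m = w + int i" "i < n" "w \<ge> 0" "int n dvd w"
        using D assms by (auto simp: w_def i_def nat_less_iff pos_imp_zdiv_nonneg_iff)
      have "int n dvd int i + k"
        using R m D by (metis add.assoc dvd_add_right_iff)
      then show ?L using m D by (intro bexI[of _ m] bexI[of _ w]) auto
    qed
  qed
  then show ?thesis by (rule definable_mono) simp
qed

text \<open>Points outside the data carry no data atoms, their order is decided by their offsets,
  and their residues are those of a constant or of \<open>Max D\<close> plus a constant. So a
  displaced variable can be eliminated, and a quantifier over the integers splits into one over the
  data and finitely many offsets.\<close>

lemma definable_place:
  assumes "cong_ok b p" "K \<ge> 0" "\<And>x k. x \<in> bfv p \<Longrightarrow> s x = Some k \<Longrightarrow> k \<noteq> 0 \<and> \<bar>k\<bar> \<le> K"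
  shows "definable b data_structures {x \<in> bfv p. s x = None}
    (\<lambda>D I e. bsat UNIV I p (place s (Max D) e))"
  using assms
proof (induction p arbitrary: s K)
  case (BAtom A x)
  show ?case
  proof (cases "s x")
    case None
    then show ?thesis by (simp add: place_def definable_atom)
  next
    case (Some k)
    then have "k \<noteq> 0" using BAtom by simp
    have "definable b data_structures {z \<in> bfv (BAtom A x). s z = None} (\<lambda>D I e. False)"
      by (rule definable_const)
    then show ?thesis
    proof (rule definable_cong)
      fix D I and e :: asg assume "(D, I) \<in> data_structures"
      then obtain m where "D = {0..m}" "m \<ge> 1" "\<forall>A. I A \<subseteq> {0..m}" and m: "Max D = m"
        by (rule data_structuresE)
      then have "I A \<subseteq> {0..m}" by blast
      then show "False \<longleftrightarrow> bsat UNIV I (BAtom A x) (place s (Max D) e)"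
        using Some \<open>k \<noteq> 0\<close> m by (auto simp: place_def)
    qed
  qed
next
  case (BLess x y)
  show ?case
  proof (cases "s x = None \<and> s y = None")
    case True
    then show ?thesis by (simp add: place_def definable_less)
  next
    case False
    \<comment> \<open>Offsets compare like the points themselves: negative ones lie left of
      \<open>0\<close>, positive ones right of the maximum.\<close>
    have "definable b data_structures {z \<in> bfv (BLess x y). s z = None} (\<lambda>D I e.
       case (s x, s y) of (Some j, Some k) \<Rightarrow> j < k | (Some j, None) \<Rightarrow> j < 0 | (None, Some k) \<Rightarrow> k > 0)"
      by (rule definable_const)
    then show ?thesis
    proof (rule definable_cong)
      fix D I and e :: asg
      assume DI: "(D, I) \<in> data_structures" and e: "e ` {z \<in> bfv (BLess x y). s z = None} \<subseteq> D"
      from DI obtain m where "D = {0..m}" "m \<ge> 1" "\<forall>A. I A \<subseteq> {0..m}" and m: "Max D = m"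
        by (rule data_structuresE)
      then show "(case (s x, s y) of (Some j, Some k) \<Rightarrow> j < k | (Some j, None) \<Rightarrow> j < 0
          | (None, Some k) \<Rightarrow> k > 0) \<longleftrightarrow> bsat UNIV I (BLess x y) (place s (Max D) e)"
        using False BLess(3)[of x] BLess(3)[of y] e unfolding m
        by (cases "s x"; cases "s y") (auto simp: place_def image_subset_iff)
    qed
  qed
next
  case (BCong n x)
  then have n: "b" "n > 1" by auto
  show ?case
  proof (cases "s x")
    case None
    then show ?thesis using n by (simp add: place_def definable_dvd)
  next
    case (Some k)
    then show ?thesis using n
      by (cases "k > 0") (auto simp: place_def definable_max_dvd definable_const)
  qed
next
  case (BNeg p)
  then show ?case by (simp add: definable_not)
next
  case (BAnd p q)
  have "definable b data_structures {x \<in> bfv p. s x = None}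
      (\<lambda>D I e. bsat UNIV I p (place s (Max D) e))"
    by (rule BAnd.IH(1)[of K]) (use BAnd.prems in auto)
  moreover have "definable b data_structures {x \<in> bfv q. s x = None}
      (\<lambda>D I e. bsat UNIV I q (place s (Max D) e))"
    by (rule BAnd.IH(2)[of K]) (use BAnd.prems in auto)
  ultimately show ?case
    unfolding bsat.simps by (intro definable_and) (erule definable_mono; auto)+
next
  case (BEx x p)
  \<comment> \<open>The product of the moduli is a common period; without congruences it is
    \<open>1\<close>.\<close>
  define P where "P = int (\<Prod>(moduli p))"
  have "n > 0" if "n \<in> moduli p" for n
    using that \<open>cong_ok b (BEx x p)\<close> by (auto dest: cong_ok_moduli)
  then have "P > 0" "\<forall>n\<in>moduli p. int n dvd P"
    unfolding P_def by (auto simp: finite_moduli prod_pos intro: dvd_prodI)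
  then obtain G where G: "G \<ge> 0" "shift_insensitive P G p"
    using shift_insensitive_exists by blast
  \<comment> \<open>The range in which \<open>bsat_bounded_witness\<close> provides a witness, given
    that the offsets chosen so far are at most \<open>K\<close>.\<close>
  define B where "B = K + G + P"
  let ?V = "{y \<in> bfv (BEx x p). s y = None}"
  have "definable b data_structures {y \<in> bfv p. (s(x := v)) y = None}
      (\<lambda>D I e. bsat UNIV I p (place (s(x := v)) (Max D) e))"
    if "v \<in> insert None (Some ` ({- B..B} - {0}))" for v
    using that BEx.prems G \<open>P > 0\<close>
    by (intro BEx.IH[of B]) (fastforce simp: B_def split: if_splits)+
  then have in_out: "definable b data_structures (insert x ?V)
        (\<lambda>D I e. bsat UNIV I p (place (s(x := None)) (Max D) e))"
      "\<And>k. k \<in> {- B..B} - {0} \<Longrightarrow> definable b data_structures ?V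
        (\<lambda>D I e. bsat UNIV I p (place (s(x := Some k)) (Max D) e))"
    by (rule definable_mono; fastforce split: if_splits)+
  have "definable b data_structures ?V
     (\<lambda>D I e. (\<exists>d\<in>D. bsat UNIV I p (place (s(x := None)) (Max D) (e(x := d)))) \<or>
        (\<exists>k\<in>{- B..B} - {0}. bsat UNIV I p (place (s(x := Some k)) (Max D) e)))"
    by (intro definable_or definable_ex definable_Bex in_out) auto
  then show ?case
  proof (rule definable_cong)
    fix D I and e :: asg assume DI: "(D, I) \<in> data_structures" and e: "e ` ?V \<subseteq> D"
    obtain m where D: "D = {0..m}" "m \<ge> 1" "\<forall>A. I A \<subseteq> {0..m}" "Max D = m"
      by (rule data_structuresE[OF DI])
    let ?e = "place s m e"
    have place: "place (s(x := None)) m (e(x := d)) = ?e(x := d)"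
      "place (s(x := Some k)) m e = ?e(x := if k > 0 then m + k else k)" for d k
      by (auto simp: place_def fun_eq_iff split: option.split)
    have e: "?e y \<in> {- K..m + K}" if "y \<in> bfv p - {x}" for y
    proof (cases "s y")
      case None
      then have "e y \<in> {0..m}" using that e D(1) by (auto simp: image_subset_iff)
      then show ?thesis using None \<open>K \<ge> 0\<close> by (auto simp: place_def)
    next
      case (Some k)
      then have "\<bar>k\<bar> \<le> K" using that BEx.prems(3)[of y k] by simp
      then show ?thesis using Some D(2) by (auto simp: place_def)
    qed
    have "(\<exists>d. bsat UNIV I p (?e(x := d))) \<longleftrightarrow> (\<exists>d\<in>{- B..m + B}. bsat UNIV I p (?e(x := d)))"
      using bsat_bounded_witness[OF G(2) \<open>P > 0\<close> G(1) \<open>K \<ge> 0\<close>, of m I x ?e] D e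
      unfolding B_def by auto
    also have "{- B..m + B} = {0..m} \<union> (\<lambda>k. if k > 0 then m + k else k) ` ({- B..B} - {0})"
      (is "_ = ?R")
    proof
      have "d \<in> ?R" if "d \<in> {- B..m + B}" for d
      proof (cases "d > m")
        case True
        then show ?thesis using that by (intro UnI2 image_eqI[of _ _ "d - m"]) auto
      next
        case False
        then show ?thesis using that D(2) by (cases "d < 0") (auto intro!: image_eqI[of _ _ d])
      qed
      then show "{- B..m + B} \<subseteq> ?R" by blast
      have "B \<ge> 0" using G(1) \<open>P > 0\<close> \<open>K \<ge> 0\<close> by (simp add: B_def)
      then show "?R \<subseteq> {- B..m + B}" using D(2) by auto
    qed
    finally show "(\<exists>d\<in>D. bsat UNIV I p (place (s(x := None)) (Max D) (e(x := d)))) \<or>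
       (\<exists>k\<in>{- B..B} - {0}. bsat UNIV I p (place (s(x := Some k)) (Max D) e)) \<longleftrightarrow>
       bsat UNIV I (BEx x p) (place s (Max D) e)"
      unfolding D(4) place bsat.simps unfolding D(1) by (simp only: bex_Un bex_simps bex_UNIV)
  qed
qed

text \<open>Free variables range over the data, so the elimination of displaced variables starts
  with none displaced.\<close>

theorem definable_in_data:
  assumes "definable b integer_structures V F"
  shows "definable b data_structures V (\<lambda>D I e. F UNIV I e)"
proof -
  obtain p where p: "cong_ok b p" "bfv p \<subseteq> V" "\<And>I e. bsat UNIV I p e \<longleftrightarrow> F UNIV I e"
    using assms unfolding definable_def by auto
  have "definable b data_structures {x \<in> bfv p. (\<lambda>_. None :: int option) x = None}
      (\<lambda>D I e. bsat UNIV I p (place (\<lambda>_. None) (Max D) e))"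
    by (rule definable_place[OF p(1), of 0]) simp_all
  moreover have "place (\<lambda>_. None) m e = e" for m e
    by (simp add: place_def fun_eq_iff)
  ultimately have "definable b data_structures (bfv p) (\<lambda>D I e. F UNIV I e)"
    by (simp add: p(3))
  then show ?thesis using p(2) by (rule definable_mono)
qed

section \<open>Models of Horn ontologies\<close>

definition is_model :: "clause set \<Rightarrow> interp \<Rightarrow> interp \<Rightarrow> bool" where
  "is_model \<O> I M \<longleftrightarrow> (\<forall>cl\<in>\<O>. clause_true M cl) \<and> (\<forall>A. I A \<subseteq> M A)"

lemma model_iff_is_model: "model M \<O> \<A> \<longleftrightarrow> is_model \<O> (\<lambda>A. {l. (A, l) \<in> \<A>}) M"
  unfolding model_def is_model_def by auto

lemma clause_true_iff:
  "clause_true M cl \<longleftrightarrow>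
    (\<forall>n. (\<forall>C\<in>set (body cl). n \<in> extension M C) \<longrightarrow> (\<exists>C\<in>set (head cl). n \<in> extension M C))"
  unfolding clause_true_def by auto

lemma extension_mono: "(\<And>A. M A \<subseteq> N A) \<Longrightarrow> n \<in> extension M C \<Longrightarrow> n \<in> extension N C"
  by (induction C arbitrary: n) auto

text \<open>The guards of universal quantifiers mention only the order, so their negative position
  does not matter.\<close>

lemma sat_mono:
  "quasi_positive \<phi> \<Longrightarrow> (\<And>A. M A \<subseteq> N A) \<Longrightarrow> sat D M \<phi> \<rho> e \<Longrightarrow> sat D N \<phi> \<rho> e"
  by (induction arbitrary: e rule: quasi_positive.induct) auto

primrec subconcepts :: "concept \<Rightarrow> concept set" where
  "subconcepts (Atomic A) = {Atomic A}"
| "subconcepts (BoxF C) = insert (BoxF C) (subconcepts C)"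
| "subconcepts (BoxP C) = insert (BoxP C) (subconcepts C)"
| "subconcepts (NextF C) = insert (NextF C) (subconcepts C)"
| "subconcepts (NextP C) = insert (NextP C) (subconcepts C)"

definition subconcept_closed :: "concept set \<Rightarrow> bool" where
  "subconcept_closed S \<longleftrightarrow> (\<forall>C\<in>S. subconcepts C \<subseteq> S)"

definition ontology_concepts :: "clause set \<Rightarrow> concept set" where
  "ontology_concepts \<O> = (\<Union>cl\<in>\<O>. \<Union>C\<in>set (body cl) \<union> set (head cl). subconcepts C)"

lemma finite_subconcepts: "finite (subconcepts C)"
  by (induction C) auto

lemma self_subconcept: "C \<in> subconcepts C"
  by (induction C) auto

lemma subconcepts_trans: "B \<in> subconcepts C \<Longrightarrow> subconcepts B \<subseteq> subconcepts C"
  by (induction C) auto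

lemma finite_ontology_concepts: "finite \<O> \<Longrightarrow> finite (ontology_concepts \<O>)"
  unfolding ontology_concepts_def by (auto simp: finite_subconcepts)

lemma subconcept_closed_ontology: "subconcept_closed (ontology_concepts \<O>)"
  unfolding subconcept_closed_def ontology_concepts_def using subconcepts_trans by blast

lemma ontology_conceptsI:
  "Clause Bs Hs \<in> \<O> \<Longrightarrow> C \<in> set Bs \<union> set Hs \<Longrightarrow> C \<in> ontology_concepts \<O>"
  unfolding ontology_concepts_def using self_subconcept by force

lemma subconcept_closedD:
  assumes "subconcept_closed S"
  shows "BoxF C \<in> S \<Longrightarrow> C \<in> S" "BoxP C \<in> S \<Longrightarrow> C \<in> S" "NextF C \<in> S \<Longrightarrow> C \<in> S" "NextP C \<in> S \<Longrightarrow> C \<in> S"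
  using assms self_subconcept[of C] unfolding subconcept_closed_def by (force+)

fun is_box :: "concept \<Rightarrow> bool" where
  "is_box (BoxF C) = True"
| "is_box (BoxP C) = True"
| "is_box C = False"

text \<open>
  For guessed extensions \<open>\<beta>\<close> of the box concepts in \<open>S\<close>, the facts that hold without applying
  clauses or next-time operators. A box fact never has to be inferred from its instances.
\<close>

definition base_fact :: "concept set \<Rightarrow> interp \<Rightarrow> (concept \<Rightarrow> int set) \<Rightarrow> concept \<Rightarrow> int \<Rightarrow> bool" where
  "base_fact S I \<beta> C n \<longleftrightarrow> (\<exists>A. C = Atomic A \<and> n \<in> I A) \<or> C \<in> S \<and> is_box C \<and> n \<in> \<beta> C \<or>
     BoxF C \<in> S \<and> (\<exists>m. m < n \<and> m \<in> \<beta> (BoxF C)) \<or> BoxP C \<in> S \<and> (\<exists>m. n < m \<and> m \<in> \<beta> (BoxP C))"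

text \<open>The next-time rules go both ways, so that derivability of \<open>NextF C\<close> and
  \<open>NextP C\<close> coincides with that of \<open>C\<close> at the neighbouring point. Clauses
  with empty head derive nothing; they are tested afterwards in the resulting
  interpretation.\<close>

inductive derived :: "clause set \<Rightarrow> concept set \<Rightarrow> interp \<Rightarrow> (concept \<Rightarrow> int set) \<Rightarrow> concept \<Rightarrow> int \<Rightarrow> bool"
  for \<O> S I \<beta>
where
  base: "base_fact S I \<beta> C n \<Longrightarrow> derived \<O> S I \<beta> C n"
| clause: "Clause Bs [H] \<in> \<O> \<Longrightarrow> (\<And>B. B \<in> set Bs \<Longrightarrow> derived \<O> S I \<beta> B n) \<Longrightarrow> derived \<O> S I \<beta> H n"
| nextF_intro: "NextF C \<in> S \<Longrightarrow> derived \<O> S I \<beta> C (n + 1) \<Longrightarrow> derived \<O> S I \<beta> (NextF C) n"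
| nextF_elim: "NextF C \<in> S \<Longrightarrow> derived \<O> S I \<beta> (NextF C) n \<Longrightarrow> derived \<O> S I \<beta> C (n + 1)"
| nextP_intro: "NextP C \<in> S \<Longrightarrow> derived \<O> S I \<beta> C (n - 1) \<Longrightarrow> derived \<O> S I \<beta> (NextP C) n"
| nextP_elim: "NextP C \<in> S \<Longrightarrow> derived \<O> S I \<beta> (NextP C) n \<Longrightarrow> derived \<O> S I \<beta> C (n - 1)"

definition derived_interp :: "clause set \<Rightarrow> concept set \<Rightarrow> interp \<Rightarrow> (concept \<Rightarrow> int set) \<Rightarrow> interp" where
  "derived_interp \<O> S I \<beta> A = {n. derived \<O> S I \<beta> (Atomic A) n}"

lemma derived_sound:
  assumes M: "is_model \<O> I M" and \<beta>: "\<And>C. C \<in> S \<Longrightarrow> is_box C \<Longrightarrow> \<beta> C = extension M C"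
    and "derived \<O> S I \<beta> C n"
  shows "n \<in> extension M C"
  using assms(3)
proof (induction rule: derived.induct)
  case (base C n)
  then show ?case
    unfolding base_fact_def using M by (force simp: is_model_def \<beta>)
next
  case (clause Bs H n)
  then have "clause_true M (Clause Bs [H])" using M by (simp add: is_model_def)
  then show ?case using clause.IH by (simp add: clause_true_iff)
qed auto

text \<open>For a box this rests on comparing with \<open>M\<close>. A box true in the derived
  interpretation is true in \<open>M\<close>, which is larger, hence was guessed and is a base fact.
  Conversely, a derived box is true in \<open>M\<close> by soundness, hence was guessed, and then
  all its instances are base facts.\<close>

lemma extension_derived_interp:
  assumes M: "is_model \<O> I M" and \<beta>: "\<And>C. C \<in> S \<Longrightarrow> is_box C \<Longrightarrow> \<beta> C = extension M C"
    and S: "subconcept_closed S" and "C \<in> S"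
  shows "n \<in> extension (derived_interp \<O> S I \<beta>) C \<longleftrightarrow> derived \<O> S I \<beta> C n"
  using \<open>C \<in> S\<close>
proof (induction C arbitrary: n)
  case (Atomic A)
  then show ?case by (simp add: derived_interp_def)
next
  case (BoxF C)
  have "C \<in> S" using S BoxF.prems by (auto dest: subconcept_closedD)
  have sub: "derived_interp \<O> S I \<beta> A \<subseteq> M A" for A
    using derived_sound[OF M \<beta>, where C = "Atomic A"] by (auto simp: derived_interp_def)
  show ?case
  proof
    assume "n \<in> extension (derived_interp \<O> S I \<beta>) (BoxF C)"
    then have "n \<in> \<beta> (BoxF C)"
      using extension_mono[of "derived_interp \<O> S I \<beta>" M, OF sub] BoxF.prems \<beta> by fastforce
    then show "derived \<O> S I \<beta> (BoxF C) n"
      using BoxF.prems by (intro derived.base) (simp add: base_fact_def)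
  next
    assume "derived \<O> S I \<beta> (BoxF C) n"
    then have "n \<in> \<beta> (BoxF C)" using derived_sound[OF M \<beta>] BoxF.prems \<beta> by fastforce
    then have "derived \<O> S I \<beta> C k" if "k > n" for k
      using that BoxF.prems by (intro derived.base) (auto simp: base_fact_def)
    then show "n \<in> extension (derived_interp \<O> S I \<beta>) (BoxF C)"
      using BoxF.IH \<open>C \<in> S\<close> by simp
  qed
next
  case (BoxP C)
  have "C \<in> S" using S BoxP.prems by (auto dest: subconcept_closedD)
  have sub: "derived_interp \<O> S I \<beta> A \<subseteq> M A" for A
    using derived_sound[OF M \<beta>, where C = "Atomic A"] by (auto simp: derived_interp_def)
  show ?case
  proof
    assume "n \<in> extension (derived_interp \<O> S I \<beta>) (BoxP C)"
    then have "n \<in> \<beta> (BoxP C)"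
      using extension_mono[of "derived_interp \<O> S I \<beta>" M, OF sub] BoxP.prems \<beta> by fastforce
    then show "derived \<O> S I \<beta> (BoxP C) n"
      using BoxP.prems by (intro derived.base) (simp add: base_fact_def)
  next
    assume "derived \<O> S I \<beta> (BoxP C) n"
    then have "n \<in> \<beta> (BoxP C)" using derived_sound[OF M \<beta>] BoxP.prems \<beta> by fastforce
    then have "derived \<O> S I \<beta> C k" if "k < n" for k
      using that BoxP.prems by (intro derived.base) (auto simp: base_fact_def)
    then show "n \<in> extension (derived_interp \<O> S I \<beta>) (BoxP C)"
      using BoxP.IH \<open>C \<in> S\<close> by simp
  qed
next
  case (NextF C)
  then have "C \<in> S" using S by (auto dest: subconcept_closedD)
  then show ?case using NextF by (auto intro: nextF_intro nextF_elim)
next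
  case (NextP C)
  then have "C \<in> S" using S by (auto dest: subconcept_closedD)
  then show ?case using NextP by (auto intro: nextP_intro nextP_elim)
qed

text \<open>A derived body is true in \<open>M\<close>, so \<open>M\<close> makes some head concept
  true; thus the head is not empty, and the clause rule derives its only member.\<close>

lemma derived_interp_model:
  assumes M: "is_model \<O> I M" and \<beta>: "\<And>C. C \<in> S \<Longrightarrow> is_box C \<Longrightarrow> \<beta> C = extension M C"
    and S: "subconcept_closed S" "ontology_concepts \<O> \<subseteq> S"
    and horn: "\<forall>cl\<in>\<O>. length (head cl) \<le> 1"
  shows "is_model \<O> I (derived_interp \<O> S I \<beta>)"
  unfolding is_model_def
proof (intro conjI ballI allI)
  fix A show "I A \<subseteq> derived_interp \<O> S I \<beta> A"
    by (auto simp: derived_interp_def base_fact_def intro: derived.base)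
next
  fix cl assume cl: "cl \<in> \<O>"
  obtain Bs Hs where cl_eq: "cl = Clause Bs Hs" by (cases cl)
  have in_S: "C \<in> S" if "C \<in> set Bs \<union> set Hs" for C
    using that cl cl_eq S(2) ontology_conceptsI by blast
  note ext = extension_derived_interp[OF M \<beta> S(1), simplified]
  have cl_M: "clause_true M cl" using M cl by (simp add: is_model_def)
  show "clause_true (derived_interp \<O> S I \<beta>) cl"
    unfolding clause_true_iff cl_eq
  proof (intro allI impI)
    fix n assume "\<forall>C\<in>set (body (Clause Bs Hs)). n \<in> extension (derived_interp \<O> S I \<beta>) C"
    then have B: "\<forall>C\<in>set Bs. derived \<O> S I \<beta> C n" using ext in_S by simp
    then have "\<exists>C\<in>set Hs. n \<in> extension M C"
      using derived_sound[OF M \<beta>] cl_M by (simp add: cl_eq clause_true_iff)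
    moreover have "length Hs \<le> 1" using horn cl cl_eq by force
    ultimately obtain H where H: "Hs = [H]" by (cases Hs) auto
    then have "derived \<O> S I \<beta> H n" using cl cl_eq B derived.clause by blast
    then show "\<exists>C\<in>set (head (Clause Bs Hs)). n \<in> extension (derived_interp \<O> S I \<beta>) C"
      using H ext in_S by simp
  qed
qed

text \<open>
  The extensions of box concepts are closed upwards or downwards, so that two integers \<open>a, b\<close>
  encode one: it is everything if \<open>a < b\<close>, empty if \<open>a > b\<close>, and ends at \<open>a\<close> if \<open>a = b\<close>.
\<close>

fun cut_set :: "concept \<Rightarrow> int \<times> int \<Rightarrow> int set" where
  "cut_set (BoxF C) (a, b) = {n. a < b \<or> a = b \<and> a \<le> n}"
| "cut_set C (a, b) = {n. a < b \<or> a = b \<and> n \<le> a}"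

text \<open>If a nonempty box extension had no end point, stepping from a member would never leave
  it, and together with its closure in the other direction it would contain all integers.\<close>

lemma extension_box_cut:
  assumes "is_box C"
  shows "\<exists>c. extension M C = cut_set C c"
proof (cases "extension M C = UNIV \<or> extension M C = {}")
  case True
  have "cut_set C (0, 1) = UNIV" "cut_set C (1, 0) = {}" by (cases C; simp)+
  then show ?thesis using True by metis
next
  case False
  then obtain x y where xy: "x \<in> extension M C" "y \<notin> extension M C" by auto
  show ?thesis
  proof (cases C)
    case (BoxF C')
    have up: "n \<in> extension M C" if "m \<in> extension M C" "m \<le> n" for m n
      using that BoxF by auto
    have "\<exists>a. a \<in> extension M C \<and> a - 1 \<notin> extension M C"
    proof (rule ccontr)
      assume no_cut: "\<not> ?thesis"
      have "z \<in> extension M C" if "z \<le> x" for z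
        using that by (induction z rule: int_le_induct) (use xy(1) no_cut in auto)
      then show False using up xy by (meson linear)
    qed
    then obtain a where a: "a \<in> extension M C" "a - 1 \<notin> extension M C" by blast
    have "extension M C = {n. a \<le> n}"
    proof (intro set_eqI iffI)
      fix n assume "n \<in> extension M C"
      then show "n \<in> {n. a \<le> n}" using up[of n "a - 1"] a(2) by force
    qed (use up a(1) in auto)
    then show ?thesis using BoxF by (intro exI[of _ "(a, a)"]) simp
  next
    case (BoxP C')
    have down: "n \<in> extension M C" if "m \<in> extension M C" "n \<le> m" for m n
      using that BoxP by auto
    have "\<exists>a. a \<in> extension M C \<and> a + 1 \<notin> extension M C"
    proof (rule ccontr)
      assume no_cut: "\<not> ?thesis"
      have "z \<in> extension M C" if "x \<le> z" for z
        using that by (induction z rule: int_ge_induct) (use xy(1) no_cut in auto)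
      then show False using down xy by (meson linear)
    qed
    then obtain a where a: "a \<in> extension M C" "a + 1 \<notin> extension M C" by blast
    have "extension M C = {n. n \<le> a}"
    proof (intro set_eqI iffI)
      fix n assume "n \<in> extension M C"
      then show "n \<in> {n. n \<le> a}" using down[of n "a + 1"] a(2) by force
    qed (use down a(1) in auto)
    then show ?thesis using BoxP by (intro exI[of _ "(a, a)"]) simp
  qed (use assms in auto)
qed

text \<open>From left to right the cuts are arbitrary: the derived interpretation contains
  \<open>I\<close> anyway, so it is a model once it satisfies the clauses. From right to left, the
  cuts of the box extensions of a model \<open>M\<close> yield a model below \<open>M\<close>, and
  truth of the query is passed up to \<open>M\<close>.\<close>

lemma certain_iff_all_cuts:
  assumes S: "subconcept_closed S" "ontology_concepts \<O> \<subseteq> S"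
    and horn: "\<forall>cl\<in>\<O>. length (head cl) \<le> 1" and "quasi_positive \<psi>"
  shows "(\<forall>M. is_model \<O> I M \<longrightarrow> sat UNIV M \<psi> \<rho> e) \<longleftrightarrow>
    (\<forall>\<gamma>. let N = derived_interp \<O> S I (\<lambda>C. cut_set C (\<gamma> C)) in
       (\<forall>cl\<in>\<O>. clause_true N cl) \<longrightarrow> sat UNIV N \<psi> \<rho> e)" (is "?L \<longleftrightarrow> ?R")
proof
  assume L: ?L
  have "I A \<subseteq> derived_interp \<O> S I \<beta> A" for A \<beta>
    by (auto simp: derived_interp_def base_fact_def intro: derived.base)
  then show ?R using L by (simp add: is_model_def Let_def)
next
  assume R: ?R
  show ?L
  proof (intro allI impI)
    fix M assume M: "is_model \<O> I M"
    have "\<forall>C. is_box C \<longrightarrow> (\<exists>c. extension M C = cut_set C c)"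
      using extension_box_cut by blast
    then obtain \<gamma> where \<gamma>: "\<And>C. is_box C \<Longrightarrow> cut_set C (\<gamma> C) = extension M C"
      by metis
    let ?N = "derived_interp \<O> S I (\<lambda>C. cut_set C (\<gamma> C))"
    have "is_model \<O> I ?N" by (rule derived_interp_model[OF M _ S horn]) (rule \<gamma>)
    then have "sat UNIV ?N \<psi> \<rho> e" using R by (simp add: is_model_def Let_def)
    moreover have "?N A \<subseteq> M A" for A
      using derived_sound[OF M \<gamma>, where C = "Atomic A"]
      by (auto simp: derived_interp_def)
    ultimately show "sat UNIV M \<psi> \<rho> e" using sat_mono[OF assms(4)] by blast
  qed
qed

section \<open>Definability of the derived facts\<close>

lemma definable_int_ex:
  assumes "finite V"
    and "\<And>z. z \<notin> V \<Longrightarrow> definable b integer_structures (insert z V) (\<lambda>D I e. G I e (e z))"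
    and "\<And>z I e d d'. z \<notin> V \<Longrightarrow> G I (e(z := d)) d' \<longleftrightarrow> G I e d'"
  shows "definable b integer_structures V (\<lambda>D I e. \<exists>d. G I e d)"
proof -
  have "definable b integer_structures V (\<lambda>D I e. \<exists>d\<in>D. G I e d)"
    using assms by (rule definable_ex_fresh)
  then show ?thesis by (rule definable_cong) auto
qed

lemma definable_int_all:
  assumes "finite V"
    and "\<And>z. z \<notin> V \<Longrightarrow> definable b integer_structures (insert z V) (\<lambda>D I e. G I e (e z))"
    and "\<And>z I e d d'. z \<notin> V \<Longrightarrow> G I (e(z := d)) d' \<longleftrightarrow> G I e d'"
  shows "definable b integer_structures V (\<lambda>D I e. \<forall>d. G I e d)"
proof -
  have "definable b integer_structures V (\<lambda>D I e. \<exists>d. \<not> G I e d)"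
    using assms by (intro definable_int_ex definable_not) auto
  from definable_not[OF this] show ?thesis by simp
qed

lemma definable_le: "x \<in> V \<Longrightarrow> y \<in> V \<Longrightarrow> definable b K V (\<lambda>D I e. e x \<le> e y)"
  using definable_not[OF definable_less, of y V x b K] by (simp add: not_less)

section \<open>Base facts relative to cuts stored in variables\<close>

definition cuts_at :: "(concept \<Rightarrow> var) \<Rightarrow> (concept \<Rightarrow> var) \<Rightarrow> asg \<Rightarrow> concept \<Rightarrow> int set" where
  "cuts_at u v e C = cut_set C (e (u C), e (v C))"

lemma cuts_at_upd: "x \<notin> u ` S \<union> v ` S \<Longrightarrow> C \<in> S \<Longrightarrow> cuts_at u v (e(x := d)) C = cuts_at u v e C"
  unfolding cuts_at_def by auto

lemma definable_cuts_at:
  assumes "C \<in> S" "is_box C" "x \<in> V" "u ` S \<union> v ` S \<subseteq> V"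
  shows "definable b K V (\<lambda>D I e. e x \<in> cuts_at u v e C)"
proof -
  have uv: "u C \<in> V" "v C \<in> V" using assms by auto
  show ?thesis
  proof (cases C)
    case (BoxF C')
    have "definable b K V (\<lambda>D I e. e (u C) < e (v C) \<or> e (u C) = e (v C) \<and> e (u C) \<le> e x)"
      using uv assms(3) by (intro definable_or definable_and definable_less definable_eq definable_le)
    then show ?thesis by (simp add: cuts_at_def BoxF)
  next
    case (BoxP C')
    have "definable b K V (\<lambda>D I e. e (u C) < e (v C) \<or> e (u C) = e (v C) \<and> e x \<le> e (u C))"
      using uv assms(3) by (intro definable_or definable_and definable_less definable_eq definable_le)
    then show ?thesis by (simp add: cuts_at_def BoxP)
  qed (use assms in auto)
qed

lemma base_fact_cong:
  "(\<And>C. C \<in> S \<Longrightarrow> \<beta> C = \<beta>' C) \<Longrightarrow> base_fact S I \<beta> C n \<longleftrightarrow> base_fact S I \<beta>' C n"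
  unfolding base_fact_def by auto

lemma derived_cong:
  assumes "\<And>C. C \<in> S \<Longrightarrow> \<beta> C = \<beta>' C"
  shows "derived \<O> S I \<beta> C n \<longleftrightarrow> derived \<O> S I \<beta>' C n"
proof -
  have "derived \<O> S I \<beta>' C n" if "derived \<O> S I \<beta> C n" "\<And>C. C \<in> S \<Longrightarrow> \<beta> C = \<beta>' C" for \<beta> \<beta>'
    using that(1) by (induction rule: derived.induct)
      (auto intro: derived.intros simp: base_fact_cong[OF that(2)])
  then show ?thesis using assms by metis
qed

lemma definable_base_fact:
  assumes S: "finite S" and "x \<in> V" "u ` S \<union> v ` S \<subseteq> V" "finite V"
  shows "definable b integer_structures V (\<lambda>D I e. base_fact S I (cuts_at u v e) C (e x))"
  unfolding base_fact_def
proof (intro definable_or)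
  have "definable b integer_structures V (\<lambda>D I e. \<exists>A\<in>{A. C = Atomic A}. e x \<in> I A)"
    using assms by (intro definable_Bex definable_atom) (cases C; simp)+
  then show "definable b integer_structures V (\<lambda>D I e. \<exists>A. C = Atomic A \<and> e x \<in> I A)" by simp
  show "definable b integer_structures V (\<lambda>D I e. C \<in> S \<and> is_box C \<and> e x \<in> cuts_at u v e C)"
  proof (cases "C \<in> S \<and> is_box C")
    case True
    then show ?thesis using assms definable_cuts_at[of C S x V u v b] by simp
  qed (use definable_const[of b _ V False] in auto)
  show "definable b integer_structures V
    (\<lambda>D I e. BoxF C \<in> S \<and> (\<exists>m. m < e x \<and> m \<in> cuts_at u v e (BoxF C)))"
  proof (cases "BoxF C \<in> S")
    case True
    have "definable b integer_structures V (\<lambda>D I e. \<exists>m. m < e x \<and> m \<in> cuts_at u v e (BoxF C))"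
    proof (intro definable_int_ex definable_and definable_less)
      fix z
      show "definable b integer_structures (insert z V) (\<lambda>D I e. e z \<in> cuts_at u v e (BoxF C))"
        using True assms by (intro definable_cuts_at) auto
    next
      fix z I d d' and e :: asg assume "z \<notin> V"
      then have "cuts_at u v (e(z := d)) (BoxF C) = cuts_at u v e (BoxF C)" "z \<noteq> x"
        using cuts_at_upd[OF _ True, of z u v] assms(2,3) by blast+
      then show "d' < (e(z := d)) x \<and> d' \<in> cuts_at u v (e(z := d)) (BoxF C) \<longleftrightarrow>
          d' < e x \<and> d' \<in> cuts_at u v e (BoxF C)" by simp
    qed (use assms in auto)
    then show ?thesis using True by simp
  qed (use definable_const[of b _ V False] in auto)
  show "definable b integer_structures V
    (\<lambda>D I e. BoxP C \<in> S \<and> (\<exists>m. e x < m \<and> m \<in> cuts_at u v e (BoxP C)))"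
  proof (cases "BoxP C \<in> S")
    case True
    have "definable b integer_structures V (\<lambda>D I e. \<exists>m. e x < m \<and> m \<in> cuts_at u v e (BoxP C))"
    proof (intro definable_int_ex definable_and definable_less)
      fix z
      show "definable b integer_structures (insert z V) (\<lambda>D I e. e z \<in> cuts_at u v e (BoxP C))"
        using True assms by (intro definable_cuts_at) auto
    next
      fix z I d d' and e :: asg assume "z \<notin> V"
      then have "cuts_at u v (e(z := d)) (BoxP C) = cuts_at u v e (BoxP C)" "z \<noteq> x"
        using cuts_at_upd[OF _ True, of z u v] assms(2,3) by blast+
      then show "(e(z := d)) x < d' \<and> d' \<in> cuts_at u v (e(z := d)) (BoxP C) \<longleftrightarrow>
          e x < d' \<and> d' \<in> cuts_at u v e (BoxP C)" by simp
    qed (use assms in auto)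
    then show ?thesis using True by simp
  qed (use definable_const[of b _ V False] in auto)
qed

subsection \<open>Horn ontologies without next-time operators\<close>

inductive horn_closure :: "clause set \<Rightarrow> concept set \<Rightarrow> concept \<Rightarrow> bool" for \<O> X where
  member: "C \<in> X \<Longrightarrow> horn_closure \<O> X C"
| clause: "Clause Bs [H] \<in> \<O> \<Longrightarrow> (\<And>B. B \<in> set Bs \<Longrightarrow> horn_closure \<O> X B) \<Longrightarrow> horn_closure \<O> X H"

text \<open>Without next-time operators no rule relates different points, so what is derived at
  \<open>n\<close> depends only on the base facts at \<open>n\<close>. The first disjunct takes care
  of concepts outside \<open>S\<close>, such as atoms that occur only in the data and the
  query.\<close>

lemma derived_iff_horn_closure:
  assumes S: "ontology_concepts \<O> \<subseteq> S" and no_next: "\<forall>C\<in>S. \<not> uses_next C"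
  shows "derived \<O> S I \<beta> C n \<longleftrightarrow>
    base_fact S I \<beta> C n \<or> horn_closure \<O> {B \<in> S. base_fact S I \<beta> B n} C"
proof
  assume "derived \<O> S I \<beta> C n"
  then show "base_fact S I \<beta> C n \<or> horn_closure \<O> {B \<in> S. base_fact S I \<beta> B n} C"
  proof (induction rule: derived.induct)
    case (clause Bs H n)
    have "horn_closure \<O> {B \<in> S. base_fact S I \<beta> B n} B" if "B \<in> set Bs" for B
    proof -
      have "B \<in> S" using clause.hyps(1) that S ontology_conceptsI by blast
      then show ?thesis using clause.IH[OF that] by (auto intro: horn_closure.member)
    qed
    then show ?case using clause.hyps(1) horn_closure.clause by blast
  qed (use no_next in \<open>force\<close>)+
next
  have "derived \<O> S I \<beta> C n" if "horn_closure \<O> {B \<in> S. base_fact S I \<beta> B n} C"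
    using that by (induction rule: horn_closure.induct) (auto intro: derived.intros)
  then show "base_fact S I \<beta> C n \<or> horn_closure \<O> {B \<in> S. base_fact S I \<beta> B n} C \<Longrightarrow> derived \<O> S I \<beta> C n"
    by (auto intro: derived.base)
qed

text \<open>A finite disjunction over the possible sets of base facts from \<open>S\<close> at the
  point whose propositional closure contains \<open>C\<close>.\<close>

lemma definable_derived_horn:
  assumes S: "finite S" "ontology_concepts \<O> \<subseteq> S" "\<forall>C\<in>S. \<not> uses_next C"
    and V: "x \<in> V" "u ` S \<union> v ` S \<subseteq> V" "finite V"
  shows "definable b integer_structures V (\<lambda>D I e. derived \<O> S I (cuts_at u v e) C (e x))"
proof -
  have "definable b integer_structures V (\<lambda>D I e. base_fact S I (cuts_at u v e) C (e x) \<or>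
     (\<exists>X\<in>{X \<in> Pow S. horn_closure \<O> X C}. \<forall>B\<in>S. (B \<in> X) = base_fact S I (cuts_at u v e) B (e x)))"
    using S(1) V
    by (intro definable_or definable_Bex definable_Ball definable_iff definable_base_fact definable_const)
      auto
  then show ?thesis
  proof (rule definable_cong)
    fix D I e
    let ?X = "{B \<in> S. base_fact S I (cuts_at u v e) B (e x)}"
    have "(\<exists>X\<in>{X \<in> Pow S. horn_closure \<O> X C}. \<forall>B\<in>S. (B \<in> X) = base_fact S I (cuts_at u v e) B (e x))
       \<longleftrightarrow> horn_closure \<O> ?X C"
    proof
      assume "\<exists>X\<in>{X \<in> Pow S. horn_closure \<O> X C}. \<forall>B\<in>S. (B \<in> X) = base_fact S I (cuts_at u v e) B (e x)"
      then obtain X where X: "X \<subseteq> S" "horn_closure \<O> X C"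
        "\<forall>B\<in>S. (B \<in> X) = base_fact S I (cuts_at u v e) B (e x)" by blast
      then have "X = ?X" by blast
      then show "horn_closure \<O> ?X C" using X(2) by simp
    next
      assume "horn_closure \<O> ?X C"
      then show "\<exists>X\<in>{X \<in> Pow S. horn_closure \<O> X C}.
          \<forall>B\<in>S. (B \<in> X) = base_fact S I (cuts_at u v e) B (e x)"
        by (intro bexI[of _ ?X]) auto
    qed
    then show "(base_fact S I (cuts_at u v e) C (e x) \<or> (\<exists>X\<in>{X \<in> Pow S. horn_closure \<O> X C}.
        \<forall>B\<in>S. (B \<in> X) = base_fact S I (cuts_at u v e) B (e x))) \<longleftrightarrow>
      derived \<O> S I (cuts_at u v e) C (e x)"
      unfolding derived_iff_horn_closure[OF S(2,3)] by simp
  qed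
qed

subsection \<open>Core ontologies\<close>

inductive walk :: "('v \<times> int \<times> 'v) set \<Rightarrow> 'v \<Rightarrow> 'v \<Rightarrow> int \<Rightarrow> bool" for E where
  refl: "walk E u u 0"
| step: "walk E u v d \<Longrightarrow> (v, k, w) \<in> E \<Longrightarrow> walk E u w (d + k)"

text \<open>The weight is the displacement in time: an edge \<open>(C, k, C')\<close> leads from
  \<open>C\<close> at \<open>n\<close> to \<open>C'\<close> at \<open>n + k\<close>.\<close>

definition core_edges :: "clause set \<Rightarrow> concept set \<Rightarrow> (concept \<times> int \<times> concept) set" where
  "core_edges \<O> S = {(B, 0, H) |B H. Clause [B] [H] \<in> \<O>} \<union>
     {(C, -1, NextF C) |C. NextF C \<in> S} \<union> {(NextF C, 1, C) |C. NextF C \<in> S} \<union>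
     {(C, 1, NextP C) |C. NextP C \<in> S} \<union> {(NextP C, -1, C) |C. NextP C \<in> S}"

lemma core_edges_subset:
  assumes S: "subconcept_closed S" "ontology_concepts \<O> \<subseteq> S"
  shows "core_edges \<O> S \<subseteq> S \<times> {-1, 0, 1} \<times> S"
proof -
  have "B \<in> S" "H \<in> S" if "Clause [B] [H] \<in> \<O>" for B H
    using ontology_conceptsI[OF that] S(2) by auto
  moreover have "C \<in> S" if "NextF C \<in> S \<or> NextP C \<in> S" for C
    using that subconcept_closedD(3,4)[OF S(1)] by blast
  ultimately show ?thesis unfolding core_edges_def by blast
qed

text \<open>Every rule has at most one premise, so a derivation is a chain. It starts from a base
  fact or from a clause with empty body, which applies at every point \<open>m\<close>.\<close>

lemma derived_iff_walk:
  assumes S: "subconcept_closed S" "ontology_concepts \<O> \<subseteq> S"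
    and core: "\<forall>Bs H. Clause Bs [H] \<in> \<O> \<longrightarrow> length Bs \<le> 1"
  shows "derived \<O> S I \<beta> C n \<longleftrightarrow> base_fact S I \<beta> C n \<or>
    (\<exists>B\<in>S. \<exists>m. (base_fact S I \<beta> B m \<or> Clause [] [B] \<in> \<O>) \<and> walk (core_edges \<O> S) B C (n - m))"
    (is "_ \<longleftrightarrow> ?P C n")
proof
  have edge: "?P C' n'" if "?P C n" "(C, k, C') \<in> core_edges \<O> S" "n' = n + k" for C C' n n' k
  proof -
    have "C \<in> S" using that(2) core_edges_subset[OF S] by auto
    then have "\<exists>B\<in>S. \<exists>m. (base_fact S I \<beta> B m \<or> Clause [] [B] \<in> \<O>) \<and> walk (core_edges \<O> S) B C (n - m)"
      using that(1) walk.refl[of _ C] by (metis diff_self)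
    then obtain B m where "B \<in> S" "base_fact S I \<beta> B m \<or> Clause [] [B] \<in> \<O>"
      "walk (core_edges \<O> S) B C (n - m)" by blast
    moreover from this(3) have "walk (core_edges \<O> S) B C' (n' - m)"
      using walk.step[OF _ that(2)] that(3) by (metis add.commute add_diff_eq)
    ultimately show ?thesis by blast
  qed
  assume "derived \<O> S I \<beta> C n"
  then show "?P C n"
  proof (induction rule: derived.induct)
    case (base C n)
    then show ?case by blast
  next
    case (clause Bs H n)
    consider "Bs = []" | B where "Bs = [B]"
      using core clause.hyps(1) by (cases Bs) fastforce+
    then show ?case
    proof cases
      case 1
      have "H \<in> S" using clause.hyps(1) ontology_conceptsI S(2) by fastforce
      moreover have "walk (core_edges \<O> S) H H (n - n)" by (simp add: walk.refl)
      ultimately show ?thesis using clause.hyps(1) 1 by blast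
    next
      case 2
      have "?P B n" using clause.IH[of B] 2 by simp
      moreover have "(B, 0, H) \<in> core_edges \<O> S"
        using clause.hyps(1) 2 by (simp add: core_edges_def)
      ultimately show ?thesis by (rule edge) simp
    qed
  next
    case (nextF_intro C n)
    show ?case by (rule edge[OF nextF_intro.IH, of "-1"]) (use nextF_intro.hyps in \<open>auto simp: core_edges_def\<close>)
  next
    case (nextF_elim C n)
    show ?case by (rule edge[OF nextF_elim.IH, of "1"]) (use nextF_elim.hyps in \<open>auto simp: core_edges_def\<close>)
  next
    case (nextP_intro C n)
    show ?case by (rule edge[OF nextP_intro.IH, of "1"]) (use nextP_intro.hyps in \<open>auto simp: core_edges_def\<close>)
  next
    case (nextP_elim C n)
    show ?case by (rule edge[OF nextP_elim.IH, of "-1"]) (use nextP_elim.hyps in \<open>auto simp: core_edges_def\<close>)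
  qed
next
  have along: "derived \<O> S I \<beta> C (m + d)" if "walk (core_edges \<O> S) B C d" "derived \<O> S I \<beta> B m" for B C d m
    using that
  proof (induction rule: walk.induct)
    case (step u v d k w)
    then have "derived \<O> S I \<beta> v (m + d)" by blast
    moreover have "derived \<O> S I \<beta> (NextF w) (m + d) \<Longrightarrow> NextF w \<in> S \<Longrightarrow> derived \<O> S I \<beta> w (m + (d + 1))"
      using derived.nextF_elim[of w S \<O> I \<beta> "m + d"] by (simp add: add.assoc)
    moreover have "derived \<O> S I \<beta> v (m + d) \<Longrightarrow> NextP v \<in> S \<Longrightarrow> derived \<O> S I \<beta> (NextP v) (m + (d + 1))"
      using derived.nextP_intro[of v S \<O> I \<beta> "m + d + 1"] by (simp add: add.assoc)
    moreover have "derived \<O> S I \<beta> v (m + d) \<Longrightarrow> NextF v \<in> S \<Longrightarrow> derived \<O> S I \<beta> (NextF v) (m + (d - 1))"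
      using derived.nextF_intro[of v S \<O> I \<beta> "m + d - 1"] by (simp add: algebra_simps)
    moreover have "derived \<O> S I \<beta> (NextP w) (m + d) \<Longrightarrow> NextP w \<in> S \<Longrightarrow> derived \<O> S I \<beta> w (m + (d - 1))"
      using derived.nextP_elim[of w S \<O> I \<beta> "m + d"] by (simp add: algebra_simps)
    ultimately show ?case using step.hyps(2) unfolding core_edges_def
      by (auto intro: derived.clause)
  qed simp
  assume "?P C n"
  then show "derived \<O> S I \<beta> C n"
  proof
    assume "\<exists>B\<in>S. \<exists>m. (base_fact S I \<beta> B m \<or> Clause [] [B] \<in> \<O>) \<and> walk (core_edges \<O> S) B C (n - m)"
    then obtain B m where B: "base_fact S I \<beta> B m \<or> Clause [] [B] \<in> \<O>"
      and w: "walk (core_edges \<O> S) B C (n - m)" by blast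
    from B have "derived \<O> S I \<beta> B m" by (auto intro: derived.base derived.clause)
    from along[OF w this] show ?thesis by simp
  qed (rule derived.base)
qed

subsection \<open>Lengths of walks\<close>

text \<open>
  There is no walk of length \<open>d\<close> from \<open>u\<close> to \<open>v\<close> iff some sets \<open>X n\<close> of vertices, closed under the
  edges, have \<open>u \<in> X 0\<close> and \<open>v \<notin> X d\<close>. Whether such a family can be completed between \<open>0\<close> and \<open>d\<close>
  depends on the \<open>d\<close>-th power of a relation on a finite set, and these powers are eventually periodic.
\<close>

definition transfer :: "'v set \<Rightarrow> ('v \<times> int \<times> 'v) set \<Rightarrow> ('v set \<times> 'v set) set" where
  "transfer W E = {(Y, Z). Y \<subseteq> W \<and> Z \<subseteq> W \<and> (\<forall>(a, k, b)\<in>E.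
     (k = 0 \<longrightarrow> a \<in> Y \<longrightarrow> b \<in> Y) \<and> (k = 1 \<longrightarrow> a \<in> Y \<longrightarrow> b \<in> Z) \<and> (k = -1 \<longrightarrow> a \<in> Z \<longrightarrow> b \<in> Y))}"

text \<open>A walk cannot leave a closed family, and the endpoints of the walks from
  \<open>u\<close>, sorted by length, form one. The gain is locality: the condition on a family
  concerns only neighbouring sets, although a walk of length \<open>d\<close> may leave the interval
  between \<open>0\<close> and \<open>d\<close>.\<close>

lemma walk_iff_closed_sets:
  assumes E: "E \<subseteq> W \<times> {-1, 0, 1} \<times> W" and "u \<in> W"
  shows "walk E u v d \<longleftrightarrow>
    (\<forall>X. (\<forall>n. (X n, X (n + 1)) \<in> transfer W E) \<longrightarrow> u \<in> X 0 \<longrightarrow> v \<in> X d)"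
proof
  assume "walk E u v d"
  then show "\<forall>X. (\<forall>n. (X n, X (n + 1)) \<in> transfer W E) \<longrightarrow> u \<in> X 0 \<longrightarrow> v \<in> X d"
  proof (induction rule: walk.induct)
    case (step u v d k w)
    show ?case
    proof (intro allI impI)
      fix X :: "int \<Rightarrow> 'a set" assume X: "\<forall>n. (X n, X (n + 1)) \<in> transfer W E" and "u \<in> X 0"
      then have "v \<in> X d" using step.IH by blast
      moreover have "k \<in> {-1, 0, 1}" using step.hyps(2) E by auto
      \<comment> \<open>An edge of weight \<open>-1\<close> is governed by the pair at
        \<open>d - 1\<close>, the others by the pair at \<open>d\<close>.\<close>
      ultimately show "w \<in> X (d + k)"
        using X[rule_format, of d] X[rule_format, of "d - 1"] step.hyps(2) unfolding transfer_def
        by fastforce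
    qed
  qed simp
next
  assume R: "\<forall>X. (\<forall>n. (X n, X (n + 1)) \<in> transfer W E) \<longrightarrow> u \<in> X 0 \<longrightarrow> v \<in> X d"
  have in_W: "w \<in> W" if "walk E u w n" for w n
    using that \<open>u \<in> W\<close> by (induction rule: walk.induct) (use E in auto)
  have "({w. walk E u w n}, {w. walk E u w (n + 1)}) \<in> transfer W E" for n
  proof -
    have "walk E u b n" if "walk E u a n" "(a, 0, b) \<in> E" for a b
      using walk.step[OF that] by simp
    moreover have "walk E u b n" if "walk E u a (n + 1)" "(a, -1, b) \<in> E" for a b
      using walk.step[OF that] by simp
    ultimately show ?thesis unfolding transfer_def using in_W by (auto intro: walk.step)
  qed
  moreover have "u \<in> {w. walk E u w 0}" by (simp add: walk.refl)
  ultimately have "v \<in> {w. walk E u w d}"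
    using R[rule_format, of "\<lambda>n. {w. walk E u w n}"] by blast
  then show "walk E u v d" by simp
qed

lemma relpow_eventually_periodic:
  assumes "finite A" "R \<subseteq> A \<times> A"
  shows "\<exists>i p. p > 0 \<and> (\<forall>d\<ge>i. R ^^ (d + p) = R ^^ d)"
proof -
  \<comment> \<open>Only positive powers are counted: the power \<open>0\<close> is the identity on
    the whole type and need not lie in \<open>A \<times> A\<close>.\<close>
  have "R ^^ Suc n \<subseteq> A \<times> A" for n
    using assms(2) by (induction n) auto
  then have "range (\<lambda>n. R ^^ Suc n) \<subseteq> Pow (A \<times> A)" by blast
  then have "finite (range (\<lambda>n. R ^^ Suc n))" using assms(1) finite_subset by blast
  then have "\<not> inj (\<lambda>n. R ^^ Suc n)" using finite_imageD infinite_UNIV_nat by blast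
  then obtain a b where ab: "a \<noteq> b" "R ^^ Suc a = R ^^ Suc b"
    unfolding inj_def by blast
  define i j where "i = min a b" and "j = max a b"
  have "i < j" "R ^^ Suc i = R ^^ Suc j"
    using ab by (auto simp: i_def j_def min_def max_def simp del: relpow.simps)
  define p where "p = j - i"
  have "Suc i + p = Suc j" using \<open>i < j\<close> by (simp add: p_def)
  then have p: "p > 0" "R ^^ (Suc i + p) = R ^^ Suc i"
    using \<open>i < j\<close> \<open>R ^^ Suc i = R ^^ Suc j\<close> by (simp add: p_def, simp only:)
  have "R ^^ (d + p) = R ^^ d" if "d \<ge> Suc i" for d
  proof -
    obtain k where d: "d = Suc i + k" using \<open>d \<ge> Suc i\<close> le_Suc_ex by blast
    then have "d + p = (Suc i + p) + k" by simp
    then show ?thesis using p(2) by (simp only: d relpow_add)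
  qed
  then show ?thesis using p(1) by blast
qed

text \<open>If the \<open>d\<close>-th and \<open>d'\<close>-th powers of the transfer relation
  agree, the stretch of a closed family between \<open>0\<close> and \<open>d\<close> can be
  replaced by one of length \<open>d'\<close> with the same ends. So a family that excludes walks of
  length \<open>d\<close> yields one that excludes walks of length \<open>d'\<close>.\<close>

lemma walk_eventually_periodic:
  assumes E: "E \<subseteq> W \<times> {-1, 0, 1} \<times> W" and W: "finite W" "u \<in> W"
  shows "\<exists>i p :: nat. p > 0 \<and> (\<forall>d\<ge>i. walk E u v (int (d + p)) \<longleftrightarrow> walk E u v (int d))"
proof -
  let ?R = "transfer W E"
  have "?R \<subseteq> Pow W \<times> Pow W" unfolding transfer_def by auto
  then obtain i p where ip: "p > 0" "\<And>d. d \<ge> i \<Longrightarrow> ?R ^^ (d + p) = ?R ^^ d"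
    using relpow_eventually_periodic[of "Pow W" ?R] W(1) by auto
  have transfer_walk: "walk E u v (int d)" if "?R ^^ d = ?R ^^ d'" "walk E u v (int d')" for d d'
    unfolding walk_iff_closed_sets[OF E W(2)]
  proof (intro allI impI)
    fix X :: "int \<Rightarrow> 'a set" assume X: "\<forall>n. (X n, X (n + 1)) \<in> ?R" "u \<in> X 0"
    have "(X 0, X (int d)) \<in> ?R ^^ d"
      unfolding relpow_fun_conv using X(1)
      by (intro exI[of _ "\<lambda>n. X (int n)"]) (auto simp: add.commute)
    then have "(X 0, X (int d)) \<in> ?R ^^ d'" using that(1) by simp
    then obtain f where f: "f 0 = X 0" "f d' = X (int d)" "\<forall>n<d'. (f n, f (Suc n)) \<in> ?R"
      unfolding relpow_fun_conv by blast
    \<comment> \<open>The part left of \<open>0\<close> is kept, \<open>f\<close> fills the stretch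
      up to \<open>d'\<close>, and the part of \<open>X\<close> from \<open>d\<close> on is shifted
      to start at \<open>d'\<close>.\<close>
    define Y where "Y n = (if n < 0 then X n else if n \<le> int d' then f (nat n) else X (n - int d' + int d))" for n
    have "(Y n, Y (n + 1)) \<in> ?R" for n
    proof -
      consider "n < -1" | "n = -1" | "0 \<le> n" "n < int d'" | "n = int d'" | "n > int d'" by linarith
      then show ?thesis
      proof cases
        case 2
        then show ?thesis using X(1)[rule_format, of "-1"] f(1) by (simp add: Y_def)
      next
        case 3
        then have "nat (n + 1) = Suc (nat n)" "nat n < d'" by auto
        then show ?thesis using 3 f(3) by (simp add: Y_def)
      next
        case 4
        then show ?thesis using X(1)[rule_format, of "int d"] f(2) by (simp add: Y_def add.commute)
      next
        case 5
        then show ?thesis using X(1)[rule_format, of "n - int d' + int d"]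
          by (simp add: Y_def algebra_simps)
      qed (use X(1) in \<open>simp add: Y_def\<close>)
    qed
    moreover have "u \<in> Y 0" using X(2) f(1) by (simp add: Y_def)
    ultimately have "v \<in> Y (int d')"
      using that(2) unfolding walk_iff_closed_sets[OF E W(2)] by blast
    then show "v \<in> X (int d)" using f(2) by (simp add: Y_def)
  qed
  have "walk E u v (int (d + p)) \<longleftrightarrow> walk E u v (int d)" if "d \<ge> i" for d
    using transfer_walk[of d "d + p"] transfer_walk[of "d + p" d] ip(2)[OF that] by blast
  then show ?thesis using ip(1) by blast
qed

text \<open>Brings negative lengths under the periodicity result, which speaks of natural numbers
  only.\<close>

lemma walk_negated_edges:
  "walk ((\<lambda>(a, k, b). (a, - k, b)) ` E) u v d \<longleftrightarrow> walk E u v (- d)"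
proof -
  have *: "walk ((\<lambda>(a, k, b). (a, - k, b)) ` E) u v (- d)" if "walk E u v d" for E :: "('a \<times> int \<times> 'a) set" and d
    using that
  proof (induction rule: walk.induct)
    case (step u v d k w)
    have "(v, - k, w) \<in> (\<lambda>(a, k, b). (a, - k, b)) ` E" using step.hyps(2) by force
    from walk.step[OF step.IH this] show ?case by simp
  qed (auto intro: walk.refl[of _ u for u, simplified])
  have "(\<lambda>(a, k, b). (a, - k, b)) ` (\<lambda>(a, k, b). (a, - k, b)) ` E = E"
    by (force simp: image_image)
  then show ?thesis using *[of E "- d"] *[of "(\<lambda>(a, k, b). (a, - k, b)) ` E" d] by auto
qed

section \<open>Walk lengths in first-order logic with congruences\<close>

lemma definable_dvd_diff:
  assumes "n > 1" "x \<in> V" "y \<in> V" "finite V"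
  shows "definable True integer_structures V (\<lambda>D I e. int n dvd e y - e x)"
proof -
  \<comment> \<open>Congruence atoms speak of single points, so a difference is treated by comparing
    residues; the integer \<open>w\<close> moves the residue \<open>j\<close> to
    \<open>0\<close>.\<close>
  have residue: "definable True integer_structures V (\<lambda>D I e. \<exists>w. e z = w + int j \<and> int n dvd w)"
    if "z \<in> V" for z j
    using that assms
    by (intro definable_int_ex definable_and definable_add definable_dvd) auto
  have "definable True integer_structures V
    (\<lambda>D I e. \<exists>j\<in>{..<n}. (\<exists>w. e x = w + int j \<and> int n dvd w) \<and> (\<exists>w. e y = w + int j \<and> int n dvd w))"
    using assms by (intro definable_Bex definable_and residue) auto
  then show ?thesis
  proof (rule definable_cong)
    fix e :: asg
    have eq: "(\<exists>w. a = w + int j \<and> int n dvd w) \<longleftrightarrow> int n dvd a - int j" for a j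
      by (metis add.commute add_diff_cancel_left' diff_add_cancel)
    show "(\<exists>j\<in>{..<n}. (\<exists>w. e x = w + int j \<and> int n dvd w) \<and> (\<exists>w. e y = w + int j \<and> int n dvd w)) \<longleftrightarrow>
      int n dvd e y - e x" (is "?L \<longleftrightarrow> ?R")
      unfolding eq
    proof
      assume "\<exists>j\<in>{..<n}. int n dvd e x - int j \<and> int n dvd e y - int j"
      then obtain j where "int n dvd e x - int j" "int n dvd e y - int j" by blast
      then have "int n dvd (e y - int j) - (e x - int j)" by (rule dvd_diff[rotated])
      then show ?R by simp
    next
      assume R: ?R
      define j where "j = nat (e x mod int n)"
      have j: "int j = e x mod int n" "j < n" using assms(1) by (auto simp: j_def nat_less_iff)
      then have x: "int n dvd e x - int j" by (simp add: minus_mod_eq_mult_div)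
      then have "int n dvd (e y - e x) + (e x - int j)" using R dvd_add by blast
      then have "int n dvd e y - int j" by simp
      then show "\<exists>j\<in>{..<n}. int n dvd e x - int j \<and> int n dvd e y - int j" using x j(2) by blast
    qed
  qed
qed

lemma definable_eventually_periodic:
  assumes p: "p > 0" "\<And>d. d \<ge> i \<Longrightarrow> R (d + p) \<longleftrightarrow> R d" and V: "x \<in> V" "y \<in> V" "finite V"
  shows "definable True integer_structures V (\<lambda>D I e. \<exists>d. e y = e x + int d \<and> R d)"
proof -
  \<comment> \<open>Doubling keeps a period and makes it greater than \<open>1\<close>, as
    congruence atoms demand.\<close>
  define q where "q = 2 * p"
  have q: "q > 1" using p(1) by (simp add: q_def)
  have step: "R (d + k * q) \<longleftrightarrow> R d" if "d \<ge> i" for d k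
  proof (induction k)
    case (Suc k)
    have "d + Suc k * q = (d + k * q + p) + p" by (simp add: q_def)
    then have "R (d + Suc k * q) \<longleftrightarrow> R (d + k * q)"
      using p(2)[of "d + k * q"] p(2)[of "d + k * q + p"] that by (simp only: trans_le_add1)
    then show ?case using Suc by simp
  qed simp
  \<comment> \<open>Distances below \<open>i\<close> are listed one by one; from \<open>i\<close>
    on, a distance is represented by the member of its residue class between \<open>i\<close> and
    \<open>i + q\<close>.\<close>
  have "definable True integer_structures V (\<lambda>D I e. (\<exists>c\<in>{c. c < i \<and> R c}. e y = e x + int c) \<or>
     (\<exists>c\<in>{c. i \<le> c \<and> c < i + q \<and> R c}. \<exists>w. w = e x + int c \<and> w \<le> e y \<and> int q dvd e y - w))"
    using V q
    by (intro definable_or definable_Bex definable_int_ex definable_and definable_add definable_le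
        definable_dvd_diff) auto
  then show ?thesis
  proof (rule definable_cong)
    fix e :: asg
    show "(\<exists>c\<in>{c. c < i \<and> R c}. e y = e x + int c) \<or>
       (\<exists>c\<in>{c. i \<le> c \<and> c < i + q \<and> R c}. \<exists>w. w = e x + int c \<and> w \<le> e y \<and> int q dvd e y - w) \<longleftrightarrow>
       (\<exists>d. e y = e x + int d \<and> R d)" (is "?A \<or> ?B \<longleftrightarrow> ?C")
    proof
      assume "?A \<or> ?B"
      then show ?C
      proof
        assume ?B
        then obtain c where c: "c \<ge> i" "R c" "e x + int c \<le> e y" "int q dvd e y - (e x + int c)"
          by auto
        then obtain k where k: "e y - (e x + int c) = int q * k" by blast
        then have "0 \<le> int q * k" using c(3) by simp
        then have "k \<ge> 0" using q by (simp add: zero_le_mult_iff)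
        then have "e y = e x + int (c + nat k * q)" using k by (simp add: mult.commute)
        moreover have "R (c + nat k * q)" using step c by blast
        ultimately show ?C by blast
      qed blast
    next
      assume ?C
      then obtain d where d: "e y = e x + int d" "R d" by blast
      show "?A \<or> ?B"
      proof (cases "d < i")
        case True
        then show ?thesis using d by blast
      next
        case False
        define c where "c = i + (d - i) mod q"
        have eq: "d = c + (d - i) div q * q" using False by (simp add: c_def)
        have c: "i \<le> c" "c < i + q" using q by (auto simp: c_def)
        have "R c" using step[OF c(1), of "(d - i) div q"] d(2) eq by simp
        moreover have "e y - (e x + int c) = int ((d - i) div q) * int q"
          using d(1) by (subst (asm) eq) simp
        moreover have "e x + int c \<le> e y" using d(1) eq by simp
        ultimately have ?B using c by auto
        then show ?thesis ..
      qed
    qed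
  qed
qed

lemma definable_walk:
  assumes E: "E \<subseteq> W \<times> {-1, 0, 1} \<times> W" and W: "finite W" "a \<in> W"
    and V: "x \<in> V" "y \<in> V" "finite V"
  shows "definable True integer_structures V (\<lambda>D I e. walk E a b (e y - e x))"
proof -
  let ?E = "(\<lambda>(a, k, b). (a, - k, b)) ` E"
  have E': "?E \<subseteq> W \<times> {-1, 0, 1} \<times> W" using E by auto
  obtain i p where "p > 0" "\<forall>d\<ge>i. walk E a b (int (d + p)) \<longleftrightarrow> walk E a b (int d)"
    using walk_eventually_periodic[OF E W] by blast
  then have "definable True integer_structures V (\<lambda>D I e. \<exists>d. e y = e x + int d \<and> walk E a b (int d))"
    using V by (intro definable_eventually_periodic[of p i]) auto
  moreover obtain i' p' where "p' > 0" "\<forall>d\<ge>i'. walk ?E a b (int (d + p')) \<longleftrightarrow> walk ?E a b (int d)"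
    using walk_eventually_periodic[OF E' W] by blast
  then have "definable True integer_structures V (\<lambda>D I e. \<exists>d. e x = e y + int d \<and> walk ?E a b (int d))"
    using V by (intro definable_eventually_periodic[of p' i']) auto
  ultimately have "definable True integer_structures V (\<lambda>D I e.
     (\<exists>d. e y = e x + int d \<and> walk E a b (int d)) \<or> (\<exists>d. e x = e y + int d \<and> walk ?E a b (int d)))"
    by (rule definable_or)
  then show ?thesis
  proof (rule definable_cong)
    fix e :: asg
    show "(\<exists>d. e y = e x + int d \<and> walk E a b (int d)) \<or> (\<exists>d. e x = e y + int d \<and> walk ?E a b (int d))
       \<longleftrightarrow> walk E a b (e y - e x)" (is "?L \<longleftrightarrow> ?R")
    proof
      assume ?L
      then show ?R by (auto simp: walk_negated_edges)
    next
      assume R: ?R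
      show ?L
      proof (cases "e x \<le> e y")
        case True
        then have "e y = e x + int (nat (e y - e x))" "walk E a b (int (nat (e y - e x)))"
          using R by auto
        then show ?thesis by blast
      next
        case False
        then have "e x = e y + int (nat (e x - e y))" "walk ?E a b (int (nat (e x - e y)))"
          using R by (auto simp: walk_negated_edges)
        then show ?thesis by blast
      qed
    qed
  qed
qed

lemma definable_derived_core:
  assumes S: "finite S" "subconcept_closed S" "ontology_concepts \<O> \<subseteq> S"
    and core: "\<forall>Bs H. Clause Bs [H] \<in> \<O> \<longrightarrow> length Bs \<le> 1"
    and V: "x \<in> V" "u ` S \<union> v ` S \<subseteq> V" "finite V"
  shows "definable True integer_structures V (\<lambda>D I e. derived \<O> S I (cuts_at u v e) C (e x))"
  unfolding derived_iff_walk[OF S(2,3) core]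
proof (intro definable_or definable_Bex definable_base_fact)
  fix B assume B: "B \<in> S"
  show "definable True integer_structures V (\<lambda>D I e. \<exists>m.
      (base_fact S I (cuts_at u v e) B m \<or> Clause [] [B] \<in> \<O>) \<and> walk (core_edges \<O> S) B C (e x - m))"
  proof (intro definable_int_ex definable_and definable_or definable_const)
    fix z
    show "definable True integer_structures (insert z V) (\<lambda>D I e. base_fact S I (cuts_at u v e) B (e z))"
      using S V by (intro definable_base_fact) auto
    show "definable True integer_structures (insert z V) (\<lambda>D I e. walk (core_edges \<O> S) B C (e x - e z))"
      by (rule definable_walk[OF core_edges_subset[OF S(2,3)] S(1) B]) (use V in auto)
  next
    fix z I d d' and e :: asg assume z: "z \<notin> V"
    have "base_fact S I (cuts_at u v (e(z := d))) B d' \<longleftrightarrow> base_fact S I (cuts_at u v e) B d'"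
    proof (rule base_fact_cong, rule cuts_at_upd)
      show "z \<notin> u ` S \<union> v ` S" using z V(2) by blast
    qed
    moreover have "z \<noteq> x" using z V by blast
    ultimately show "(base_fact S I (cuts_at u v (e(z := d))) B d' \<or> Clause [] [B] \<in> \<O>) \<and>
        walk (core_edges \<O> S) B C ((e(z := d)) x - d') \<longleftrightarrow>
       (base_fact S I (cuts_at u v e) B d' \<or> Clause [] [B] \<in> \<O>) \<and> walk (core_edges \<O> S) B C (e x - d')"
      by simp
  qed (use V in auto)
qed (use S V in auto)

section \<open>First-order rewritings\<close>

lemma definable_extension: "definable b integer_structures {x} (\<lambda>D I e. e x \<in> extension I C)"
proof (induction C arbitrary: x)
  case (Atomic A)
  then show ?case by (simp add: definable_atom)
next
  case (BoxF C)
  have "definable b integer_structures {x} (\<lambda>D I e. \<forall>d. e x < d \<longrightarrow> d \<in> extension I C)"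
    by (intro definable_int_all definable_imp definable_less definable_mono[OF BoxF]) auto
  then show ?case by simp
next
  case (BoxP C)
  have "definable b integer_structures {x} (\<lambda>D I e. \<forall>d. d < e x \<longrightarrow> d \<in> extension I C)"
    by (intro definable_int_all definable_imp definable_less definable_mono[OF BoxP]) auto
  then show ?case by simp
next
  case (NextF C)
  have "definable b integer_structures {x} (\<lambda>D I e. \<exists>d. d = e x + 1 \<and> d \<in> extension I C)"
    by (intro definable_int_ex definable_and definable_succ definable_mono[OF NextF]) auto
  then show ?case by simp
next
  case (NextP C)
  have "definable b integer_structures {x} (\<lambda>D I e. \<exists>d. e x = d + 1 \<and> d \<in> extension I C)"
    by (intro definable_int_ex definable_and definable_succ definable_mono[OF NextP]) auto
  then show ?case
  proof (rule definable_cong)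
    fix I and e :: asg
    have "e x = d + 1 \<longleftrightarrow> d = e x - 1" for d by auto
    then show "(\<exists>d. e x = d + 1 \<and> d \<in> extension I C) \<longleftrightarrow> e x \<in> extension I (NextP C)" by simp
  qed
qed

lemma definable_clause_true: "definable b integer_structures V (\<lambda>D I e. clause_true I cl)"
proof -
  have "definable b integer_structures {} (\<lambda>D I e. clause_true I cl)"
    unfolding clause_true_iff
    by (intro definable_int_all definable_imp definable_Ball definable_Bex
        definable_mono[OF definable_extension]) auto
  then show ?thesis by (rule definable_mono) simp
qed

lemma definable_MFO:
  assumes "\<phi> \<in> MFO"
  shows "definable b integer_structures (fv \<phi>) (\<lambda>D I e. sat UNIV I \<phi> \<rho> e)"
  using assms unfolding MFO_def
proof (induction rule: FOL.induct)
  case (atomic \<phi>)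
  have "definable b integer_structures {x, y} (\<lambda>D I e. e x = e y + 1)" for x y
    by (rule definable_succ) auto
  with atomic show ?case
    by (auto intro: definable_atom definable_less definable_eq)
next
  case (All \<phi> x)
  have "definable b integer_structures (fv (All x \<phi>)) (\<lambda>D I e. \<exists>d\<in>D. \<not> sat UNIV I \<phi> \<rho> (e(x := d)))"
    by (intro definable_ex definable_not definable_mono[OF All.IH]) auto
  from definable_not[OF this] show ?case by (rule definable_cong) auto
next
  case (Ex \<phi> x)
  have "definable b integer_structures (fv (Ex x \<phi>)) (\<lambda>D I e. \<exists>d\<in>D. sat UNIV I \<phi> \<rho> (e(x := d)))"
    by (intro definable_ex definable_mono[OF Ex.IH]) auto
  then show ?case by (rule definable_cong) auto
next
  case (And \<phi> \<psi>)
  show ?case unfolding sat.simps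
    by (intro definable_and And.IH[THEN definable_mono]) auto
next
  case (Or \<phi> \<psi>)
  show ?case unfolding sat.simps
    by (intro definable_or Or.IH[THEN definable_mono]) auto
next
  case (Imp \<phi> \<psi>)
  show ?case unfolding sat.simps
    by (intro definable_imp Imp.IH[THEN definable_mono]) auto
qed (simp add: definable_not)

text \<open>Replaces each atom of \<open>p\<close> by a definition of \<open>N\<close>. The
  definition has the parameters \<open>U\<close>, so no variable of \<open>p\<close>, free or bound,
  may lie in \<open>U\<close>; otherwise a quantifier of \<open>p\<close> could capture a
  parameter.\<close>

lemma definable_substitute:
  assumes N: "\<And>A x. x \<notin> U \<Longrightarrow> definable b integer_structures (insert x U) (\<lambda>D I e. e x \<in> N I e A)"
    and cong: "\<And>I e x d. x \<notin> U \<Longrightarrow> N I (e(x := d)) = N I e"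
    and "cong_ok b p" "bvars p \<inter> U = {}"
  shows "definable b integer_structures (bfv p \<union> U) (\<lambda>D I e. bsat UNIV (N I e) p e)"
  using assms(3,4)
proof (induction p)
  case (BAtom A x)
  then show ?case using N[of x A] by simp
next
  case (BLess x y)
  show ?case unfolding bsat.simps by (rule definable_less) auto
next
  case (BCong n x)
  then show ?case unfolding bsat.simps by (intro definable_dvd) auto
next
  case (BNeg p)
  then show ?case by (simp add: definable_not)
next
  case (BAnd p q)
  then have "definable b integer_structures (bfv p \<union> U) (\<lambda>D I e. bsat UNIV (N I e) p e)"
    "definable b integer_structures (bfv q \<union> U) (\<lambda>D I e. bsat UNIV (N I e) q e)"
    by auto
  then show ?case unfolding bsat.simps
    by (intro definable_and) (erule definable_mono; auto)+
next
  case (BEx x p)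
  then have "definable b integer_structures (bfv p \<union> U) (\<lambda>D I e. bsat UNIV (N I e) p e)" by auto
  then have "definable b integer_structures (insert x (bfv (BEx x p) \<union> U)) (\<lambda>D I e. bsat UNIV (N I e) p e)"
    by (rule definable_mono) auto
  then have "definable b integer_structures (bfv (BEx x p) \<union> U)
      (\<lambda>D I e. \<exists>d\<in>D. bsat UNIV (N I (e(x := d))) p (e(x := d)))"
    by (rule definable_ex)
  moreover have "x \<notin> U" using BEx.prems by auto
  ultimately show ?case by (elim definable_cong) (auto simp: cong)
qed

lemma cong_ok_mono: "cong_ok False p \<Longrightarrow> cong_ok b p"
  by (induction p) auto

lemma fresh_variable_pairs:
  fixes S :: "'c set"
  assumes "finite S" "finite (X :: var set)"
  obtains u v where "inj_on u S" "inj_on v S" "u ` S \<inter> v ` S = {}" "X \<inter> (u ` S \<union> v ` S) = {}"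
proof -
  obtain f :: "'c \<Rightarrow> nat" where f: "inj_on f S"
    using finite_imp_inj_to_nat_seg[OF assms(1)] by blast
  obtain N where N: "\<forall>x\<in>X. x < N" using assms(2) finite_nat_set_iff_bounded by blast
  show ?thesis
  proof
    show "inj_on (\<lambda>C. N + 2 * f C) S" "inj_on (\<lambda>C. N + 2 * f C + 1) S"
      using f by (auto simp: inj_on_def)
    show "(\<lambda>C. N + 2 * f C) ` S \<inter> (\<lambda>C. N + 2 * f C + 1) ` S = {}"
      by auto presburger
    show "X \<inter> ((\<lambda>C. N + 2 * f C) ` S \<union> (\<lambda>C. N + 2 * f C + 1) ` S) = {}"
      using N by fastforce
  qed
qed

lemma derived_interp_cong:
  "(\<And>C. C \<in> S \<Longrightarrow> \<beta> C = \<beta>' C) \<Longrightarrow> derived_interp \<O> S I \<beta> = derived_interp \<O> S I \<beta>'"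
  using derived_cong[of S \<beta> \<beta>' \<O> I] by (auto simp: derived_interp_def fun_eq_iff)

text \<open>A formula without congruences expresses over an arbitrary interpretation that the query
  holds if the clauses do. The derived facts are substituted for its atoms, and the cut variables
  are quantified universally. Only the definability of the derived facts depends on the kind of
  ontology.\<close>

lemma definable_certain:
  assumes S: "finite S" "subconcept_closed S" "ontology_concepts \<O> \<subseteq> S" and "finite \<O>"
    and horn: "\<forall>cl\<in>\<O>. length (head cl) \<le> 1" and \<psi>: "quasi_positive \<psi>"
    and derived: "\<And>u v V x C. x \<in> V \<Longrightarrow> u ` S \<union> v ` S \<subseteq> V \<Longrightarrow> finite V \<Longrightarrow>
      definable b integer_structures V (\<lambda>D I e. derived \<O> S I (cuts_at u v e) C (e x))"
  shows "definable b integer_structures (fv \<psi>) (\<lambda>D I e. \<forall>M. is_model \<O> I M \<longrightarrow> sat UNIV M \<psi> \<rho> e)"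
proof -
  have "definable False integer_structures (fv \<psi>)
      (\<lambda>D I e. (\<forall>cl\<in>\<O>. clause_true I cl) \<longrightarrow> sat UNIV I \<psi> \<rho> e)"
    using \<open>finite \<O>\<close> \<psi>
    by (intro definable_imp definable_Ball definable_clause_true definable_MFO quasi_positive_MFO)
  then obtain p where p: "cong_ok False p" "bfv p \<subseteq> fv \<psi>"
    "\<And>I e. bsat UNIV I p e \<longleftrightarrow> ((\<forall>cl\<in>\<O>. clause_true I cl) \<longrightarrow> sat UNIV I \<psi> \<rho> e)"
    unfolding definable_def by auto
  obtain u v where uv: "inj_on u S" "inj_on v S" "u ` S \<inter> v ` S = {}" "bvars p \<inter> (u ` S \<union> v ` S) = {}"
    using fresh_variable_pairs[OF S(1) finite_bvars] by metis
  define U where "U = u ` S \<union> v ` S"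
  have U: "finite U" "bvars p \<inter> U = {}" "bfv p \<inter> U = {}"
    using S(1) uv(4) bfv_subset_bvars[of p] by (auto simp: U_def)
  define N where "N I e = derived_interp \<O> S I (cuts_at u v e)" for I e
  have "definable b integer_structures (bfv p \<union> U) (\<lambda>D I e. bsat UNIV (N I e) p e)"
  proof (rule definable_substitute)
    fix A x
    show "definable b integer_structures (insert x U) (\<lambda>D I e. e x \<in> N I e A)"
      using derived[of x "insert x U" u v "Atomic A"] U(1)
      by (simp add: N_def derived_interp_def U_def subset_insertI2)
  next
    fix I e x d assume "x \<notin> U"
    then show "N I (e(x := d)) = N I e"
      unfolding N_def by (intro derived_interp_cong cuts_at_upd) (simp_all add: U_def)
  qed (use cong_ok_mono p(1) U(2) in auto)
  \<comment> \<open>Universal quantification over all cut variables, as a negated existential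
    one.\<close>
  from definable_not[OF definable_ex_vars[OF U(1) definable_not[OF this]]]
  have "definable b integer_structures (bfv p)
    (\<lambda>D I e. \<not> (\<exists>e'. e' ` U \<subseteq> D \<and> (\<forall>x. x \<notin> U \<longrightarrow> e' x = e x) \<and> \<not> bsat UNIV (N I e') p e'))" .
  then have "definable b integer_structures (bfv p) (\<lambda>D I e. \<forall>M. is_model \<O> I M \<longrightarrow> sat UNIV M \<psi> \<rho> e)"
  proof (rule definable_cong)
    fix D I and e :: asg assume "(D, I) \<in> integer_structures"
    then have [simp]: "D = UNIV" by simp
    have bsat_eq: "bsat UNIV J p e' \<longleftrightarrow> bsat UNIV J p e" if "\<forall>x. x \<notin> U \<longrightarrow> e' x = e x" for e' J
      using that U(3) by (intro bsat_cong) auto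
    have "(\<forall>e'. (\<forall>x. x \<notin> U \<longrightarrow> e' x = e x) \<longrightarrow> bsat UNIV (N I e') p e') \<longleftrightarrow>
        (\<forall>\<gamma>. bsat UNIV (derived_interp \<O> S I (\<lambda>C. cut_set C (\<gamma> C))) p e)" (is "?L \<longleftrightarrow> ?R")
    proof
      assume L: ?L
      show ?R
      proof
        fix \<gamma>
        \<comment> \<open>The cuts are written into the variables assigned to the concepts;
          injectivity and disjointness of \<open>u\<close> and \<open>v\<close> on \<open>S\<close>
          make this consistent.\<close>
        define e' where "e' x = (if x \<in> u ` S then fst (\<gamma> (inv_into S u x))
          else if x \<in> v ` S then snd (\<gamma> (inv_into S v x)) else e x)" for x
        have "cuts_at u v e' C = cut_set C (\<gamma> C)" if "C \<in> S" for C
        proof -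
          have "v C \<notin> u ` S" using that uv(3) by blast
          then show ?thesis using that uv(1,2) by (simp add: cuts_at_def e'_def)
        qed
        then have "N I e' = derived_interp \<O> S I (\<lambda>C. cut_set C (\<gamma> C))"
          unfolding N_def by (rule derived_interp_cong)
        moreover have e': "\<forall>x. x \<notin> U \<longrightarrow> e' x = e x" by (simp add: e'_def U_def)
        ultimately show "bsat UNIV (derived_interp \<O> S I (\<lambda>C. cut_set C (\<gamma> C))) p e"
          using L bsat_eq[OF e'] by metis
      qed
    next
      assume R: ?R
      show ?L
      proof (intro allI impI)
        fix e' assume "\<forall>x. x \<notin> U \<longrightarrow> e' x = e x"
        moreover have "bsat UNIV (N I e') p e"
          using R[rule_format, of "\<lambda>C. (e' (u C), e' (v C))"] by (simp add: N_def cuts_at_def[abs_def])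
        ultimately show "bsat UNIV (N I e') p e'" using bsat_eq by blast
      qed
    qed
    then show "\<not> (\<exists>e'. e' ` U \<subseteq> D \<and> (\<forall>x. x \<notin> U \<longrightarrow> e' x = e x) \<and> \<not> bsat UNIV (N I e') p e') \<longleftrightarrow>
        (\<forall>M. is_model \<O> I M \<longrightarrow> sat UNIV M \<psi> \<rho> e)"
      unfolding certain_iff_all_cuts[OF S(2,3) horn \<psi>] p(3) Let_def by auto
  qed
  then show ?thesis using p(2) by (rule definable_mono)
qed

section \<open>From definability over data instances to rewritings\<close>

lemma data_instance_structure:
  assumes "data_instance \<A>"
  shows "(tem \<A>, \<lambda>A. {l. (A, l) \<in> \<A>}) \<in> data_structures" "tem \<A> = {0..max_data \<A>}"
proof -
  have "finite (snd ` \<A>)" "min_data \<A> = 0" "max_data \<A> \<ge> 1"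
    using assms by (auto simp: data_instance_def)
  then have "0 \<le> l \<and> l \<le> max_data \<A>" if "(A, l) \<in> \<A>" for A l
    using that by (metis Max_ge Min_le image_eqI max_data_def min_data_def snd_conv)
  moreover show "tem \<A> = {0..max_data \<A>}" using \<open>min_data \<A> = 0\<close> by (auto simp: tem_def)
  ultimately show "(tem \<A>, \<lambda>A. {l. (A, l) \<in> \<A>}) \<in> data_structures"
    using \<open>max_data \<A> \<ge> 1\<close> by (auto intro!: exI[of _ "max_data \<A>"])
qed

lemma upds_in:
  assumes "length as = length xs" "x \<in> set xs"
  shows "upds e xs as x \<in> set as"
proof -
  obtain a where a: "map_of (zip xs as) x = Some a"
    using map_of_zip_is_Some[of xs as x] assms by auto
  then have "a \<in> set as" by (meson map_of_SomeD set_zip_rightD)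
  then show ?thesis using a by (simp add: upds_def)
qed

lemma rewritable_if_definable:
  assumes "definable b data_structures (set ts)
      (\<lambda>D I e. \<forall>M. is_model \<O> I M \<longrightarrow> sat UNIV M \<psi> (\<lambda>_ _ _. False) e)"
    and L: "\<And>p. cong_ok b p \<Longrightarrow> to_form p \<in> \<L>"
  shows "rewritable \<L> \<O> \<psi> ts"
proof -
  obtain p where p: "cong_ok b p" "bfv p \<subseteq> set ts"
    "\<And>D I e. (D, I) \<in> data_structures \<Longrightarrow> e ` set ts \<subseteq> D \<Longrightarrow> bsat D I p e \<longleftrightarrow>
       (\<forall>M. is_model \<O> I M \<longrightarrow> sat UNIV M \<psi> (\<lambda>_ _ _. False) e)"
    using assms(1) unfolding definable_def by blast
  \<comment> \<open>\<open>rewritable\<close> demands exactly the free variables \<open>ts\<close>;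
    the conjuncts added here are always true.\<close>
  define q where "q = foldr (\<lambda>x. BAnd (BNeg (BLess x x))) ts p"
  have q: "cong_ok b q" "bfv q = set ts \<union> bfv p" "bsat D I q e \<longleftrightarrow> bsat D I p e" for D I e
    using p(1) unfolding q_def by (induction ts) auto
  have "certain_answer \<O> \<psi> ts \<A> ls \<longleftrightarrow> holds_in_data \<A> (to_form q) ts ls"
    if "data_instance \<A>" "length ls = length ts" "set ls \<subseteq> tem \<A>" for \<A> ls
  proof -
    have "upds (\<lambda>_. 0) ts ls ` set ts \<subseteq> tem \<A>" using upds_in that(2,3) by blast
    then show ?thesis
      using p(3)[OF data_instance_structure(1)[OF that(1)]]
      by (simp add: certain_answer_def holds_in_data_def holds_def sat_to_form q(3) model_iff_is_model)
  qed
  moreover have "fv (to_form q) = set ts" using q(2) p(2) by (auto simp: fv_to_form)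
  ultimately show ?thesis unfolding rewritable_def using L[OF q(1)] by blast
qed

lemma Horn_head: "shape_ok Horn cl \<Longrightarrow> length (head cl) \<le> 1"
  by (cases cl) simp

lemma Core_head: "shape_ok Core cl \<Longrightarrow> length (head cl) \<le> 1"
  by (cases cl) simp

lemma uses_next_subconcept: "B \<in> subconcepts C \<Longrightarrow> uses_next B \<Longrightarrow> uses_next C"
  by (induction C) auto

theorem rewritable_box_horn:
  assumes "OMQ \<O> \<psi> ts" "LTL_ontology Box Horn \<O>" "quasi_positive \<psi>"
  shows "rewritable FO_less \<O> \<psi> ts"
proof (rule rewritable_if_definable[where b = False])
  let ?S = "ontology_concepts \<O>"
  have O: "finite \<O>" "\<forall>cl\<in>\<O>. length (head cl) \<le> 1"
    using assms(2) Horn_head by (auto simp: LTL_ontology_def)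
  have no_next: "\<not> uses_next C" if "cl \<in> \<O>" "C \<in> set (body cl) \<union> set (head cl)" for cl C
    using assms(2) that by (simp add: LTL_ontology_def)
  have S: "\<forall>C\<in>?S. \<not> uses_next C"
    using no_next uses_next_subconcept unfolding ontology_concepts_def by blast
  have "definable False integer_structures (fv \<psi>)
      (\<lambda>D I e. \<forall>M. is_model \<O> I M \<longrightarrow> sat UNIV M \<psi> (\<lambda>_ _ _. False) e)"
    using O S assms(3)
    by (intro definable_certain[of ?S] definable_derived_horn finite_ontology_concepts
        subconcept_closed_ontology) auto
  then show "definable False data_structures (set ts)
      (\<lambda>D I e. \<forall>M. is_model \<O> I M \<longrightarrow> sat UNIV M \<psi> (\<lambda>_ _ _. False) e)"
    using definable_in_data assms(1) by (auto simp: OMQ_def)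
qed (rule to_form_FO_less)

theorem rewritable_core:
  assumes "OMQ \<O> \<psi> ts" "LTL_ontology BoxNext Core \<O>" "quasi_positive \<psi>"
  shows "rewritable FO_less_cong \<O> \<psi> ts"
proof (rule rewritable_if_definable[where b = True])
  let ?S = "ontology_concepts \<O>"
  \<comment> \<open>A core clause with a head has at most one body concept, because body and head
    together have at most two.\<close>
  have O: "finite \<O>" "\<forall>cl\<in>\<O>. length (head cl) \<le> 1" "\<forall>Bs H. Clause Bs [H] \<in> \<O> \<longrightarrow> length Bs \<le> 1"
    using assms(2) Core_head by (auto simp: LTL_ontology_def)
  have "definable True integer_structures (fv \<psi>)
      (\<lambda>D I e. \<forall>M. is_model \<O> I M \<longrightarrow> sat UNIV M \<psi> (\<lambda>_ _ _. False) e)"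
    using O assms(3)
    by (intro definable_certain[of ?S] definable_derived_core finite_ontology_concepts
        subconcept_closed_ontology) auto
  then show "definable True data_structures (set ts)
      (\<lambda>D I e. \<forall>M. is_model \<O> I M \<longrightarrow> sat UNIV M \<psi> (\<lambda>_ _ _. False) e)"
    using definable_in_data assms(1) by (auto simp: OMQ_def)
qed (rule to_form_FO_less_cong)

section \<open>Rewritings with relational primitive recursion\<close>

subsection \<open>Bi-infinite words\<close>

text \<open>
  A letter consists of the atomic concepts and of the variables that hold at a point. A word in
  which every free variable occurs exactly once is an interpretation with an assignment.
\<close>

type_synonym letter = "atom set \<times> var set"
type_synonym word = "int \<Rightarrow> letter"

definition unmark :: "var \<Rightarrow> letter \<Rightarrow> letter" where
  "unmark x a = (fst a, snd a - {x})"

text \<open>The counterpart on words of the update \<open>e(x := n)\<close>.\<close>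

definition mark :: "var \<Rightarrow> int \<Rightarrow> word \<Rightarrow> word" where
  "mark x n w = (\<lambda>k. unmark x (w k))(n := (fst (w n), insert x (snd (w n))))"

text \<open>Defined on all words, even where a variable is missing or repeated, because
  interchangeability quantifies over arbitrary contexts. The value for \<open>BCong\<close> is a
  default; \<open>word_sat_iff\<close> concerns congruence-free formulas.\<close>

primrec word_sat :: "bform \<Rightarrow> word \<Rightarrow> bool" where
  "word_sat (BAtom A x) w \<longleftrightarrow> (\<exists>n. x \<in> snd (w n) \<and> A \<in> fst (w n))"
| "word_sat (BLess x y) w \<longleftrightarrow> (\<exists>m n. m < n \<and> x \<in> snd (w m) \<and> y \<in> snd (w n))"
| "word_sat (BCong k x) w \<longleftrightarrow> False"
| "word_sat (BNeg p) w \<longleftrightarrow> \<not> word_sat p w"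
| "word_sat (BAnd p q) w \<longleftrightarrow> word_sat p w \<and> word_sat q w"
| "word_sat (BEx x p) w \<longleftrightarrow> (\<exists>n. word_sat p (mark x n w))"

lemma word_sat_iff:
  assumes "cong_ok False p" "\<And>x n. x \<in> bfv p \<Longrightarrow> x \<in> snd (w n) \<longleftrightarrow> n = e x"
  shows "word_sat p w \<longleftrightarrow> bsat UNIV (\<lambda>A. {n. A \<in> fst (w n)}) p e"
  using assms
proof (induction p arbitrary: w e)
  case (BEx x p)
  have "word_sat p (mark x n w) \<longleftrightarrow> bsat UNIV (\<lambda>A. {k. A \<in> fst (mark x n w k)}) p (e(x := n))" for n
    using BEx.prems by (intro BEx.IH) (auto simp: mark_def unmark_def)
  moreover have "fst (mark x n w k) = fst (w k)" for n k
    by (simp add: mark_def unmark_def)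
  ultimately show ?case by simp
qed auto

section \<open>Finite words in two-sided contexts\<close>

definition glue :: "word \<Rightarrow> letter list \<Rightarrow> word \<Rightarrow> word" where
  "glue l u r n = (if n < 0 then l n else if n < int (length u) then u ! nat n else r (n - int (length u)))"

lemma glue_left: "n < 0 \<Longrightarrow> glue l u r n = l n"
  by (simp add: glue_def)

lemma glue_middle: "i < length u \<Longrightarrow> glue l u r (int i) = u ! i"
  by (simp add: glue_def)

lemma glue_right: "n \<ge> 0 \<Longrightarrow> glue l u r (int (length u) + n) = r n"
  by (simp add: glue_def)

lemma glue_cases:
  obtains "n < 0" "glue l u r n = l n"
  | i where "i < length u" "n = int i" "glue l u r n = u ! i"
  | k where "k \<ge> 0" "n = int (length u) + k" "glue l u r n = r k"
proof -
  consider "n < 0" | "0 \<le> n" "n < int (length u)" | "n \<ge> int (length u)" by linarith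
  then show thesis
  proof cases
    case 1
    then show thesis using that(1) by (simp add: glue_left)
  next
    case 2
    then show thesis using that(2)[of "nat n"] by (simp add: glue_def)
  next
    case 3
    then show thesis using that(3)[of "n - int (length u)"] by (simp add: glue_def)
  qed
qed

text \<open>A last letter can be moved into the right context, which makes equality of classes a
  right congruence.\<close>

lemma glue_snoc: "glue l (u @ [a]) r = glue l u (\<lambda>n. if n = 0 then a else r (n - 1))"
  by (auto simp: glue_def nth_append fun_eq_iff nat_less_iff algebra_simps)

lemma ex_glue:
  "(\<exists>n. P (glue l u r n)) \<longleftrightarrow> (\<exists>n<0. P (l n)) \<or> (\<exists>a\<in>set u. P a) \<or> (\<exists>n\<ge>0. P (r n))"
  (is "?L \<longleftrightarrow> ?R")
proof
  assume ?L
  then obtain n where "P (glue l u r n)" by blast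
  then show ?R by (cases rule: glue_cases[of n l u r]) auto
next
  assume ?R
  then show ?L
  proof (elim disjE exE bexE conjE)
    fix a assume "a \<in> set u" "P a"
    then obtain i where "i < length u" "u ! i = a" by (auto simp: in_set_conv_nth)
    then show ?L using \<open>P a\<close> glue_middle by metis
  qed (metis glue_left glue_right)+
qed

text \<open>The point is that \<open>u\<close> enters the right-hand side only through three truth
  values: whether \<open>P\<close> occurs, whether \<open>Q\<close> occurs, and whether
  \<open>P\<close> occurs before \<open>Q\<close>.\<close>

lemma ex_less_glue:
  "(\<exists>m n. m < n \<and> P (glue l u r m) \<and> Q (glue l u r n)) \<longleftrightarrow>
     (\<exists>m n. m < n \<and> n < 0 \<and> P (l m) \<and> Q (l n)) \<or>
     (\<exists>m<0. P (l m)) \<and> ((\<exists>a\<in>set u. Q a) \<or> (\<exists>n\<ge>0. Q (r n))) \<or>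
     (\<exists>i j. i < j \<and> j < length u \<and> P (u ! i) \<and> Q (u ! j)) \<or>
     (\<exists>a\<in>set u. P a) \<and> (\<exists>n\<ge>0. Q (r n)) \<or>
     (\<exists>m n. 0 \<le> m \<and> m < n \<and> P (r m) \<and> Q (r n))"
  (is "?L \<longleftrightarrow> ?R")
proof
  assume ?L
  then obtain m n where "m < n" "P (glue l u r m)" "Q (glue l u r n)" by blast
  then show ?R
    by (cases rule: glue_cases[of m l u r]; cases rule: glue_cases[of n l u r]) (simp; force)+
next
  let ?n = "int (length u)"
  have L: ?L if "m < n" "P (glue l u r m)" "Q (glue l u r n)" for m n using that by blast
  assume ?R
  then show ?L
  proof (elim disjE exE bexE conjE)
    fix m n :: int assume "m < n" "n < 0" "P (l m)" "Q (l n)"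
    then show ?L by (intro L[of m n]) (simp_all add: glue_left)
  next
    fix m :: int and a assume "m < 0" "P (l m)" "a \<in> set u" "Q a"
    then obtain i where "i < length u" "u ! i = a" by (auto simp: in_set_conv_nth)
    then show ?L using \<open>m < 0\<close> \<open>P (l m)\<close> \<open>Q a\<close>
      by (intro L[of m "int i"]) (simp_all add: glue_left glue_middle)
  next
    fix m n :: int assume "m < 0" "P (l m)" "0 \<le> n" "Q (r n)"
    then show ?L by (intro L[of m "?n + n"]) (simp_all add: glue_left glue_right)
  next
    fix i j assume "i < j" "j < length u" "P (u ! i)" "Q (u ! j)"
    then show ?L by (intro L[of "int i" "int j"]) (simp_all add: glue_middle)
  next
    fix a and n :: int assume "a \<in> set u" "P a" "0 \<le> n" "Q (r n)"
    then obtain i where "i < length u" "u ! i = a" by (auto simp: in_set_conv_nth)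
    then show ?L using \<open>P a\<close> \<open>0 \<le> n\<close> \<open>Q (r n)\<close>
      by (intro L[of "int i" "?n + n"]) (simp_all add: glue_middle glue_right)
  next
    fix m n :: int assume "0 \<le> m" "m < n" "P (r m)" "Q (r n)"
    then show ?L by (intro L[of "?n + m" "?n + n"]) (simp_all add: glue_right)
  qed
qed

definition mark_list :: "var \<Rightarrow> nat \<Rightarrow> letter list \<Rightarrow> letter list" where
  "mark_list x i u = (map (unmark x) u)[i := (fst (u ! i), insert x (snd (u ! i)))]"

lemma mark_glue_left:
  "n < 0 \<Longrightarrow> mark x n (glue l u r) = glue (mark x n l) (map (unmark x) u) (\<lambda>k. unmark x (r k))"
  by (auto simp: mark_def glue_def fun_eq_iff nat_less_iff)

lemma mark_glue_middle:
  "i < length u \<Longrightarrow> mark x (int i) (glue l u r) =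
    glue (\<lambda>k. unmark x (l k)) (mark_list x i u) (\<lambda>k. unmark x (r k))"
  by (auto simp: mark_def mark_list_def glue_def fun_eq_iff nat_less_iff nth_list_update)

lemma mark_glue_right:
  "n \<ge> 0 \<Longrightarrow> mark x (int (length u) + n) (glue l u r) =
    glue (\<lambda>k. unmark x (l k)) (map (unmark x) u) (mark x n r)"
  by (auto simp: mark_def glue_def fun_eq_iff nat_less_iff)

subsection \<open>Finite index\<close>

text \<open>The Myhill-Nerode congruence of a set of bi-infinite words, with contexts on both
  sides.\<close>

definition interchangeable :: "(word \<Rightarrow> bool) \<Rightarrow> letter list \<Rightarrow> letter list \<Rightarrow> bool" where
  "interchangeable \<Phi> u v \<longleftrightarrow> (\<forall>l r. \<Phi> (glue l u r) \<longleftrightarrow> \<Phi> (glue l v r))"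

definition cls :: "(word \<Rightarrow> bool) \<Rightarrow> letter list \<Rightarrow> letter list set" where
  "cls \<Phi> u = {v. interchangeable \<Phi> u v}"

lemma cls_eq_iff: "cls \<Phi> u = cls \<Phi> v \<longleftrightarrow> interchangeable \<Phi> u v"
  unfolding cls_def interchangeable_def by blast

lemma cls_snoc: "cls \<Phi> u = cls \<Phi> v \<Longrightarrow> cls \<Phi> (u @ [a]) = cls \<Phi> (v @ [a])"
  unfolding cls_eq_iff interchangeable_def glue_snoc by blast

text \<open>A class is determined by the value of \<open>f\<close>; one implication suffices, as
  \<open>u\<close> and \<open>v\<close> can be exchanged.\<close>

lemma finite_indexI:
  assumes "finite (range f)" "\<And>u v l r. f u = f v \<Longrightarrow> \<Phi> (glue l u r) \<Longrightarrow> \<Phi> (glue l v r)"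
  shows "finite (range (cls \<Phi>))"
proof -
  have "cls \<Phi> u = cls \<Phi> v" if "f u = f v" for u v
    unfolding cls_eq_iff interchangeable_def using assms(2)[OF that] assms(2)[OF that[symmetric]] by blast
  then have "cls \<Phi> u = cls \<Phi> (SOME v. f v = f u)" for u
    by (metis (mono_tags, lifting) someI_ex)
  then have "range (cls \<Phi>) \<subseteq> (\<lambda>y. cls \<Phi> (SOME v. f v = y)) ` range f" by blast
  then show ?thesis using assms(1) by (meson finite_imageI finite_subset)
qed

lemma clsD: "cls \<Phi> u = cls \<Phi> v \<Longrightarrow> \<Phi> (glue l u r) \<longleftrightarrow> \<Phi> (glue l v r)"
  unfolding cls_eq_iff interchangeable_def by blast

lemma word_sat_finite_index: "finite (range (cls (word_sat p)))"
proof (induction p)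
  case (BAtom A x)
  show ?case
    by (rule finite_indexI[of "\<lambda>u. \<exists>a\<in>set u. x \<in> snd a \<and> A \<in> fst a"])
      (simp_all add: ex_glue[where P = "\<lambda>a. x \<in> snd a \<and> A \<in> fst a"])
next
  case (BLess x y)
  show ?case
    by (rule finite_indexI[of "\<lambda>u. (\<exists>a\<in>set u. x \<in> snd a, \<exists>a\<in>set u. y \<in> snd a,
          \<exists>i j. i < j \<and> j < length u \<and> x \<in> snd (u ! i) \<and> y \<in> snd (u ! j))"])
      (simp_all add: ex_less_glue[where P = "\<lambda>a. x \<in> snd a" and Q = "\<lambda>a. y \<in> snd a"])
next
  case (BCong n x)
  show ?case by (rule finite_indexI[of "\<lambda>_. True"]) simp_all
next
  case (BNeg p)
  show ?case
  proof (rule finite_indexI[OF BNeg])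
    fix u v l r assume "cls (word_sat p) u = cls (word_sat p) v"
    from clsD[OF this]
    show "word_sat (BNeg p) (glue l u r) \<Longrightarrow> word_sat (BNeg p) (glue l v r)" by simp
  qed
next
  case (BAnd p q)
  have "range (\<lambda>u. (cls (word_sat p) u, cls (word_sat q) u)) \<subseteq>
      range (cls (word_sat p)) \<times> range (cls (word_sat q))" by auto
  then have "finite (range (\<lambda>u. (cls (word_sat p) u, cls (word_sat q) u)))"
    using BAnd finite_subset by blast
  then show ?case
  proof (rule finite_indexI)
    fix u v l r
    assume "(cls (word_sat p) u, cls (word_sat q) u) = (cls (word_sat p) v, cls (word_sat q) v)"
    then have "cls (word_sat p) u = cls (word_sat p) v" "cls (word_sat q) u = cls (word_sat q) v"
      by simp_all
    from this[THEN clsD]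
    show "word_sat (BAnd p q) (glue l u r) \<Longrightarrow> word_sat (BAnd p q) (glue l v r)" by simp
  qed
next
  \<comment> \<open>The witness lies outside the finite word or at one of its positions. Hence it
    suffices to know the class of the unmarked word and the set of classes obtained by marking one
    position: finitely many values, by a power set.\<close>
  case (BEx x p)
  define f where "f u = (cls (word_sat p) (map (unmark x) u),
    (\<lambda>i. cls (word_sat p) (mark_list x i u)) ` {..<length u})" for u
  have "range f \<subseteq> range (cls (word_sat p)) \<times> Pow (range (cls (word_sat p)))"
    unfolding f_def by auto
  then have "finite (range f)" using BEx by (meson finite_Pow_iff finite_SigmaI finite_subset)
  then show ?case
  proof (rule finite_indexI)
    fix u v l r assume f: "f u = f v" and "word_sat (BEx x p) (glue l u r)"
    then obtain n where n: "word_sat p (mark x n (glue l u r))" by auto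
    have unmarked: "cls (word_sat p) (map (unmark x) u) = cls (word_sat p) (map (unmark x) v)"
      using f by (simp add: f_def)
    have "\<exists>n. word_sat p (mark x n (glue l v r))"
    proof (cases rule: glue_cases[of n l u r])
      case 1
      then have "word_sat p (mark x n (glue l v r))"
        using n clsD[OF unmarked] by (simp add: mark_glue_left)
      then show ?thesis ..
    next
      case (2 i)
      then have "cls (word_sat p) (mark_list x i u) \<in>
          (\<lambda>i. cls (word_sat p) (mark_list x i u)) ` {..<length u}" by blast
      also have "\<dots> = (\<lambda>i. cls (word_sat p) (mark_list x i v)) ` {..<length v}"
        using f by (simp add: f_def)
      finally obtain j where j: "j < length v"
        "cls (word_sat p) (mark_list x i u) = cls (word_sat p) (mark_list x j v)"
        by blast
      then have "word_sat p (mark x (int j) (glue l v r))"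
        using n 2 clsD[OF j(2)] by (simp add: mark_glue_middle)
      then show ?thesis ..
    next
      case (3 k)
      then have "word_sat p (mark x (int (length v) + k) (glue l v r))"
        using n clsD[OF unmarked] by (simp add: mark_glue_right)
      then show ?thesis ..
    qed
    then show "word_sat (BEx x p) (glue l v r)" by simp
  qed
qed

subsection \<open>Reachable classes\<close>

text \<open>The data bound the atoms of a letter only from below, as a model may add facts, whereas
  the positions of the variables are fixed by the assignment.\<close>

definition fits :: "bform \<Rightarrow> var set \<Rightarrow> interp \<Rightarrow> asg \<Rightarrow> int \<Rightarrow> letter \<Rightarrow> bool" where
  "fits p V I e t a \<longleftrightarrow> (\<forall>A\<in>batoms p. t \<in> I A \<longrightarrow> A \<in> fst a) \<and> (\<forall>x\<in>V. x \<in> snd a \<longleftrightarrow> e x = t)"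

definition alphabet :: "bform \<Rightarrow> var set \<Rightarrow> letter set" where
  "alphabet p V = Pow (batoms p) \<times> Pow V"

definition reachable ::
  "bform \<Rightarrow> var set \<Rightarrow> interp \<Rightarrow> asg \<Rightarrow> letter list set \<Rightarrow> nat \<Rightarrow> bool" where
  "reachable p V I e c k \<longleftrightarrow> (\<exists>u. length u = Suc k \<and>
     (\<forall>j\<le>k. u ! j \<in> alphabet p V \<and> fits p V I e (int j) (u ! j)) \<and> cls (word_sat p) u = c)"

text \<open>By \<open>cls_snoc\<close> the choice of the representative does not matter.\<close>

definition class_step :: "bform \<Rightarrow> letter list set \<Rightarrow> letter \<Rightarrow> letter list set" where
  "class_step p c a = cls (word_sat p) ((SOME u. cls (word_sat p) u = c) @ [a])"

lemma class_step_cls: "class_step p (cls (word_sat p) u) a = cls (word_sat p) (u @ [a])"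
  unfolding class_step_def
proof (rule cls_snoc)
  show "cls (word_sat p) (SOME v. cls (word_sat p) v = cls (word_sat p) u) = cls (word_sat p) u"
    by (rule someI_ex) blast
qed

lemma reachable_0:
  "reachable p V I e c 0 \<longleftrightarrow>
    (\<exists>a\<in>alphabet p V. fits p V I e 0 a \<and> cls (word_sat p) [a] = c)" (is "?L \<longleftrightarrow> ?R")
proof
  assume ?L
  then obtain u where u: "length u = Suc 0" "u ! 0 \<in> alphabet p V" "fits p V I e 0 (u ! 0)"
    "cls (word_sat p) u = c"
    by (auto simp: reachable_def)
  moreover from u(1) have "u = [u ! 0]" by (auto simp: length_Suc_conv)
  ultimately show ?R by metis
next
  assume ?R
  then obtain a where "a \<in> alphabet p V" "fits p V I e 0 a" "cls (word_sat p) [a] = c" by blast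
  then show ?L unfolding reachable_def by (intro exI[of _ "[a]"]) simp
qed

lemma reachable_Suc:
  "reachable p V I e c (Suc k) \<longleftrightarrow> (\<exists>a\<in>alphabet p V. \<exists>c'. fits p V I e (int (Suc k)) a \<and>
     reachable p V I e c' k \<and> class_step p c' a = c)" (is "?L \<longleftrightarrow> ?R")
proof
  assume ?L
  then obtain u where u: "length u = Suc (Suc k)"
    "\<forall>j\<le>Suc k. u ! j \<in> alphabet p V \<and> fits p V I e (int j) (u ! j)" "cls (word_sat p) u = c"
    unfolding reachable_def by blast
  obtain v a where v: "u = v @ [a]" using u(1) by (cases u rule: rev_cases) auto
  then have len: "length v = Suc k" using u(1) by simp
  then have "u ! Suc k = a" using v by (simp add: nth_append)
  then have "a \<in> alphabet p V" "fits p V I e (int (Suc k)) a"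
    using u(2)[rule_format, of "Suc k"] by auto
  moreover have "reachable p V I e (cls (word_sat p) v) k"
    unfolding reachable_def
  proof (intro exI[of _ v] conjI allI impI)
    fix j assume "j \<le> k"
    then show "v ! j \<in> alphabet p V" "fits p V I e (int j) (v ! j)"
      using u(2)[rule_format, of j] v len by (auto simp: nth_append)
  qed (auto simp: len)
  moreover have "class_step p (cls (word_sat p) v) a = c" using u(3) v class_step_cls by simp
  ultimately show ?R by blast
next
  assume ?R
  then obtain a v where a: "a \<in> alphabet p V" "fits p V I e (int (Suc k)) a"
    and v: "length v = Suc k" "\<forall>j\<le>k. v ! j \<in> alphabet p V \<and> fits p V I e (int j) (v ! j)"
      "class_step p (cls (word_sat p) v) a = c"
    unfolding reachable_def by blast
  show ?L unfolding reachable_def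
  proof (intro exI[of _ "v @ [a]"] conjI allI impI)
    fix j assume "j \<le> Suc k"
    then show "(v @ [a]) ! j \<in> alphabet p V" "fits p V I e (int j) ((v @ [a]) ! j)"
      using a v(1,2) by (cases "j = Suc k"; auto simp: nth_append)+
  qed (use v class_step_cls in auto)
qed

text \<open>The free variables take values in the data, so the contexts carry no variables; their
  atoms are unconstrained. The condition does not mention the data and can be decided once for each
  class.\<close>

definition accepting :: "bform \<Rightarrow> letter list set \<Rightarrow> bool" where
  "accepting p c \<longleftrightarrow> (\<exists>u l r. cls (word_sat p) u = c \<and> (\<forall>n<0. snd (l n) = {}) \<and>
     (\<forall>n\<ge>0. snd (r n) = {}) \<and> word_sat p (glue l u r))"

lemma satisfiable_iff_reachable:
  assumes p: "cong_ok False p" "bfv p \<subseteq> V"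
    and I: "\<And>A. I A \<subseteq> {0..int m}" and e: "e ` V \<subseteq> {0..int m}"
  shows "(\<exists>M. (\<forall>A. I A \<subseteq> M A) \<and> bsat UNIV M p e) \<longleftrightarrow> (\<exists>c. reachable p V I e c m \<and> accepting p c)"
    (is "?L \<longleftrightarrow> ?R")
proof
  assume ?L
  then obtain M where M: "\<And>A. I A \<subseteq> M A" "bsat UNIV M p e" by blast
  \<comment> \<open>Recording only the atoms of \<open>p\<close> and the variables in
    \<open>V\<close> keeps the letters in a finite alphabet.\<close>
  define w where "w n = ({A \<in> batoms p. n \<in> M A}, {x \<in> V. e x = n})" for n :: int
  define u where "u = map (\<lambda>j. w (int j)) [0..<Suc m]"
  have u: "length u = Suc m" "\<And>j. j \<le> m \<Longrightarrow> u ! j = w (int j)"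
    by (auto simp: u_def simp del: upt_Suc)
  have w: "glue w u (\<lambda>n. w (n + int (Suc m))) = w"
    using u by (auto simp: glue_def fun_eq_iff)
  have "word_sat p w \<longleftrightarrow> bsat UNIV (\<lambda>A. {n. A \<in> fst (w n)}) p e"
    using p by (intro word_sat_iff) (auto simp: w_def)
  also have "\<dots> \<longleftrightarrow> bsat UNIV M p e"
    by (intro bsat_cong) (auto simp: w_def)
  finally have "word_sat p w" using M(2) by simp
  moreover have "snd (w n) = {}" if "n < 0 \<or> n > int m" for n
    using that e by (force simp: w_def)
  ultimately have "accepting p (cls (word_sat p) u)"
    unfolding accepting_def
    by (intro exI[of _ u] exI[of _ w] exI[of _ "\<lambda>n. w (n + int (Suc m))"]) (auto simp: w[simplified])
  moreover have "reachable p V I e (cls (word_sat p) u) m"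
    unfolding reachable_def using u M(1)
    by (intro exI[of _ u]) (auto simp: w_def alphabet_def fits_def)
  ultimately show ?R by blast
next
  assume ?R
  then obtain u u' l r where u: "length u = Suc m"
      "\<And>j. j \<le> m \<Longrightarrow> u ! j \<in> alphabet p V \<and> fits p V I e (int j) (u ! j)"
    and "cls (word_sat p) u' = cls (word_sat p) u" "word_sat p (glue l u' r)"
    and marks: "\<forall>n<0. snd (l n) = {}" "\<forall>n\<ge>0. snd (r n) = {}"
    unfolding reachable_def accepting_def by blast
  \<comment> \<open>Acceptance is witnessed by some member \<open>u'\<close> of the class; it is
    exchanged for the word \<open>u\<close> that fits the data.\<close>
  then have sat: "word_sat p (glue l u r)" using clsD by blast
  let ?w = "glue l u r"
  \<comment> \<open>Atoms that do not occur in \<open>p\<close> are made true everywhere, so that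
    all data hold; \<open>p\<close> cannot see the difference.\<close>
  define M where "M A = {n. A \<in> fst (?w n) \<or> A \<notin> batoms p}" for A
  have "word_sat p ?w \<longleftrightarrow> bsat UNIV (\<lambda>A. {n. A \<in> fst (?w n)}) p e"
  proof (rule word_sat_iff[OF p(1)])
    fix x n assume "x \<in> bfv p"
    then have x: "x \<in> V" "e x \<in> {0..int m}" using p(2) e by blast+
    show "x \<in> snd (?w n) \<longleftrightarrow> n = e x"
    proof (cases rule: glue_cases[of n l u r])
      case (2 i)
      then show ?thesis using u x(1) by (auto simp: fits_def)
    qed (use x marks u(1) in auto)
  qed
  also have "\<dots> \<longleftrightarrow> bsat UNIV M p e"
    by (intro bsat_cong) (auto simp: M_def)
  finally have "bsat UNIV M p e" using sat by simp
  moreover have "I A \<subseteq> M A" for A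
  proof
    fix n assume n: "n \<in> I A"
    then have "n \<in> {0..int m}" using I by blast
    then have "?w n = u ! nat n" "fits p V I e n (u ! nat n)"
      using u(1) u(2)[of "nat n"] by (auto simp: glue_def)
    then show "n \<in> M A" using n by (auto simp: M_def fits_def)
  qed
  ultimately show ?L by blast
qed

subsection \<open>The rewriting\<close>

text \<open>There are no truth constants in the language, so the empty case is expressed through
  \<open>t\<close>, which is therefore always free.\<close>

definition disj :: "var \<Rightarrow> form list \<Rightarrow> form" where
  "disj t \<phi>s = foldr Or \<phi>s (Neg (Equal t t))"

definition conj :: "var \<Rightarrow> form list \<Rightarrow> form" where
  "conj t \<phi>s = foldr And \<phi>s (Equal t t)"

lemma sat_disj: "sat D I (disj t \<phi>s) \<rho> e \<longleftrightarrow> (\<exists>\<phi>\<in>set \<phi>s. sat D I \<phi> \<rho> e)"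
  unfolding disj_def by (induction \<phi>s) auto

lemma sat_conj: "sat D I (conj t \<phi>s) \<rho> e \<longleftrightarrow> (\<forall>\<phi>\<in>set \<phi>s. sat D I \<phi> \<rho> e)"
  unfolding conj_def by (induction \<phi>s) auto

lemma fv_disj: "fv (disj t \<phi>s) = insert t (\<Union>\<phi>\<in>set \<phi>s. fv \<phi>)"
  unfolding disj_def by (induction \<phi>s) auto

lemma fv_conj: "fv (conj t \<phi>s) = insert t (\<Union>\<phi>\<in>set \<phi>s. fv \<phi>)"
  unfolding conj_def by (induction \<phi>s) auto

lemma FO_RPR_in_disj: "(\<And>\<phi>. \<phi> \<in> set \<phi>s \<Longrightarrow> FO_RPR_in \<Gamma> \<Delta> \<phi>) \<Longrightarrow> FO_RPR_in \<Gamma> \<Delta> (disj t \<phi>s)"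
  unfolding disj_def by (induction \<phi>s) (auto intro: FO_RPR_in.intros)

lemma FO_RPR_in_conj: "(\<And>\<phi>. \<phi> \<in> set \<phi>s \<Longrightarrow> FO_RPR_in \<Gamma> \<Delta> \<phi>) \<Longrightarrow> FO_RPR_in \<Gamma> \<Delta> (conj t \<phi>s)"
  unfolding conj_def by (induction \<phi>s) (auto intro: FO_RPR_in.intros)

lemma defined_rels_disj: "(\<And>\<phi>. \<phi> \<in> set \<phi>s \<Longrightarrow> defined_rels \<phi> = []) \<Longrightarrow> defined_rels (disj t \<phi>s) = []"
  unfolding disj_def by (induction \<phi>s) auto

lemma defined_rels_conj: "(\<And>\<phi>. \<phi> \<in> set \<phi>s \<Longrightarrow> defined_rels \<phi> = []) \<Longrightarrow> defined_rels (conj t \<phi>s) = []"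
  unfolding conj_def by (induction \<phi>s) auto

text \<open>The relation variable \<open>i\<close> will stand for the class
  \<open>classes ! i\<close>, \<open>ts\<close> for the parameters of the recursion and
  \<open>t\<close> for its time; \<open>s\<close> names a neighbour of \<open>t\<close>.\<close>

locale rpr_rewriting =
  fixes p :: bform and ts :: "var list" and t s :: var
    and atoms :: "atom list" and letters :: "letter list" and classes :: "letter list set list"
  assumes p: "cong_ok False p" "bfv p \<subseteq> set ts"
    and ts: "distinct ts" "t \<notin> set ts" "s \<noteq> t"
    and atoms: "set atoms = batoms p"
    and letters: "set letters = alphabet p (set ts)"
    and classes: "set classes = range (cls (word_sat p))"
begin

definition letter_form :: "letter \<Rightarrow> form" where
  "letter_form a = conj t (map (\<lambda>A. Neg (Atm A t)) (filter (\<lambda>A. A \<notin> fst a) atoms) @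
     map (\<lambda>x. if x \<in> snd a then Equal x t else Neg (Equal x t)) ts)"

definition first :: form where
  "first = Neg (Ex s (Succ t s))"

definition last :: form where
  "last = Neg (Ex s (Succ s t))"

text \<open>At time \<open>0\<close> the \<open>Prev\<close> atoms are false by default and only the
  first disjunct can hold; later \<open>first\<close> fails and only the second can. As the language
  demands, \<open>Prev\<close> is applied to the parameters \<open>ts\<close> and the recursion
  variable \<open>t\<close> themselves.\<close>

definition step_form :: "letter list set \<Rightarrow> form" where
  "step_form c = Or (And first (disj t (map letter_form (filter (\<lambda>a. cls (word_sat p) [a] = c) letters))))
     (disj t (concat (map (\<lambda>a. map (\<lambda>j. And (letter_form a) (Prev j ts t))
        (filter (\<lambda>j. class_step p (classes ! j) a = c) [0..<length classes])) letters)))"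

definition definitions :: "(rel \<times> var list \<times> form) list" where
  "definitions = map (\<lambda>i. (i, ts, step_form (classes ! i))) [0..<length classes]"

definition accept_form :: form where
  "accept_form = Ex t (And last
     (disj t (map (\<lambda>i. Rel i ts t) (filter (\<lambda>i. accepting p (classes ! i)) [0..<length classes]))))"

text \<open>The recursion detects a refuting model, hence the negation; the equations make every
  variable of \<open>ts\<close> free.\<close>

definition rewriting :: form where
  "rewriting = foldr (\<lambda>x. And (Equal x x)) ts (Neg (Rpr t definitions accept_form))"

lemma fv_letter_form: "fv (letter_form a) = insert t (set ts)"
  by (auto simp: letter_form_def fv_conj split: if_splits)

lemma fv_step_form: "fv (step_form c) \<subseteq> insert t (set ts)"
  by (auto simp: step_form_def first_def fv_disj fv_letter_form)

lemma fv_rewriting: "fv rewriting = set ts"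
proof -
  have "fv (Neg (Rpr t definitions accept_form)) \<subseteq> set ts"
    using fv_step_form by (auto simp: definitions_def accept_form_def last_def fv_disj)
  moreover have "fv (foldr (\<lambda>x. And (Equal x x)) xs \<phi>) = set xs \<union> fv \<phi>" for xs \<phi>
    by (induction xs) auto
  ultimately show ?thesis unfolding rewriting_def by blast
qed

lemma rewriting_FO_RPR: "rewriting \<in> FO_RPR"
proof -
  let ?\<Delta> = "{(Q', zs', t) |Q' zs' \<Theta>'. (Q', zs', \<Theta>') \<in> set definitions}"
  let ?\<Gamma> = "map_of (map (\<lambda>(Q, zs, \<Theta>). (Q, length zs)) definitions)"
  have letter: "FO_RPR_in \<Gamma> \<Delta> (letter_form a)" for \<Gamma> \<Delta> a
    unfolding letter_form_def by (rule FO_RPR_in_conj) (auto intro: FO_RPR_in.intros)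
  have \<Delta>: "(j, ts, t) \<in> ?\<Delta>" if "j < length classes" for j
    using that by (force simp: definitions_def)
  have step: "FO_RPR_in \<Gamma> (\<Delta> \<union> ?\<Delta>) (step_form c)" for \<Gamma> \<Delta> c
    unfolding step_form_def first_def using \<Delta>
    by (intro FO_RPR_in.intros FO_RPR_in_disj) (auto intro!: letter FO_RPR_in.intros)
  have \<Gamma>: "?\<Gamma> j = Some (length ts)" if "j < length classes" for j
  proof -
    have "map (\<lambda>(Q, zs, \<Theta>). (Q, length zs)) definitions = map (\<lambda>i. (i, length ts)) [0..<length classes]"
      by (simp add: definitions_def)
    then show ?thesis using that by (simp add: map_of_map_restrict)
  qed
  have accept: "FO_RPR_in (\<Gamma> ++ ?\<Gamma>) \<Delta> accept_form" for \<Gamma> \<Delta>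
    unfolding accept_form_def last_def using \<Gamma>
    by (intro FO_RPR_in.intros FO_RPR_in_disj) (auto intro!: FO_RPR_in.intros)
  have "FO_RPR_in Map.empty {} (Rpr t definitions accept_form)"
  proof (rule FO_RPR_in.intros(12))
    fix Q zs \<Theta> assume "(Q, zs, \<Theta>) \<in> set definitions"
    then obtain c where "zs = ts" "\<Theta> = step_form c" by (auto simp: definitions_def)
    then show "distinct (t # zs) \<and> fv \<Theta> \<subseteq> insert t (set zs) \<and>
        FO_RPR_in Map.empty (avoiding (insert t (set zs)) {} \<union> ?\<Delta>) \<Theta>"
      using ts fv_step_form step by simp
  qed (rule accept)
  then have "FO_RPR_in Map.empty {} (foldr (\<lambda>x. And (Equal x x)) xs (Neg (Rpr t definitions accept_form)))" for xs
    by (induction xs) (auto intro: FO_RPR_in.intros)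
  moreover have "defined_rels (letter_form a) = []" for a
    unfolding letter_form_def by (rule defined_rels_conj) auto
  then have "defined_rels (step_form c) = []" for c
    by (auto simp: step_form_def first_def intro!: defined_rels_disj)
  then have "defined_rels (Rpr t definitions accept_form) = [0..<length classes]"
    by (auto simp: definitions_def accept_form_def last_def comp_def intro!: defined_rels_disj)
  then have "defined_rels (foldr (\<lambda>x. And (Equal x x)) xs (Neg (Rpr t definitions accept_form))) =
      [0..<length classes]" for xs
    by (induction xs) auto
  ultimately show ?thesis by (simp add: FO_RPR_def rewriting_def)
qed

lemma sat_letter_form:
  assumes "a \<in> alphabet p (set ts)"
  shows "sat D I (letter_form a) \<rho> (e(t := k)) \<longleftrightarrow> fits p (set ts) I e k a"
proof -
  have "x \<noteq> t" if "x \<in> set ts" for x using ts that by blast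
  then have "sat D I (letter_form a) \<rho> (e(t := k)) \<longleftrightarrow>
      (\<forall>A\<in>{A \<in> batoms p. A \<notin> fst a}. k \<notin> I A) \<and> (\<forall>x\<in>set ts. x \<in> snd a \<longleftrightarrow> e x = k)"
    unfolding letter_form_def sat_conj set_append set_map set_filter atoms ball_Un ball_simps by auto
  then show ?thesis using assms by (auto simp: fits_def alphabet_def)
qed

lemma upds_step: "upds e (t # ts) (k # map e ts) = e(t := k)"
  by (simp add: upds_def map_of_zip_map fun_eq_iff)

lemma sat_step_form:
  "sat D I (step_form c) \<rho> (e(t := k)) \<longleftrightarrow> sat D I first \<rho> (e(t := k)) \<and>
      (\<exists>a\<in>set letters. cls (word_sat p) [a] = c \<and> fits p (set ts) I e k a) \<or>
    (\<exists>a\<in>set letters. \<exists>j<length classes. class_step p (classes ! j) a = c \<and>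
      fits p (set ts) I e k a \<and> \<rho> j (map e ts) (k - 1))"
proof -
  have map_e: "map (e(t := k)) ts = map e ts" using ts by (simp cong: map_cong)
  have letter: "sat D I (letter_form a) \<rho> (e(t := k)) \<longleftrightarrow> fits p (set ts) I e k a"
    if "a \<in> set letters" for a
    using that letters by (simp add: sat_letter_form)
  have "sat D I (disj t (map letter_form (filter (\<lambda>a. cls (word_sat p) [a] = c) letters))) \<rho> (e(t := k))
      \<longleftrightarrow> (\<exists>a\<in>set letters. cls (word_sat p) [a] = c \<and> sat D I (letter_form a) \<rho> (e(t := k)))"
    unfolding sat_disj set_map set_filter by blast
  moreover have "sat D I (disj t (concat (map (\<lambda>a. map (\<lambda>j. And (letter_form a) (Prev j ts t))
        (filter (\<lambda>j. class_step p (classes ! j) a = c) [0..<length classes])) letters))) \<rho> (e(t := k))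
      \<longleftrightarrow> (\<exists>a\<in>set letters. \<exists>j\<in>{0..<length classes}. class_step p (classes ! j) a = c \<and>
        sat D I (And (letter_form a) (Prev j ts t)) \<rho> (e(t := k)))"
    unfolding sat_disj set_concat set_map image_image set_filter set_upt by blast
  ultimately show ?thesis
    unfolding step_form_def sat.simps(10) by (simp add: letter map_e Bex_def cong: conj_cong)
qed

lemma rpr_env_reachable:
  fixes I :: interp and e :: asg and m :: nat
  defines "ds \<equiv> map (\<lambda>(Q, zs, \<Theta>). (Q, zs, sat {0..int m} I \<Theta>)) definitions"
  assumes "k \<le> m" "i < length classes"
  shows "rpr_env ds t \<rho> e i (map e ts) (int k) \<longleftrightarrow> reachable p (set ts) I e (classes ! i) k"
proof -
  have ds: "map_of ds i = Some (ts, sat {0..int m} I (step_form (classes ! i)))"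
    if "i < length classes" for i
  proof -
    have "ds = map (\<lambda>i. (i, ts, sat {0..int m} I (step_form (classes ! i)))) [0..<length classes]"
      by (simp add: ds_def definitions_def)
    then show ?thesis using that by (simp add: map_of_map_restrict)
  qed
  \<comment> \<open>Stage \<open>Suc k\<close> is the first one that fixes the relations at time
    \<open>k\<close>.\<close>
  have "rpr_upto ds t \<rho> e (Suc k) i (map e ts) (int k) \<longleftrightarrow>
      reachable p (set ts) I e (classes ! i) k"
    using assms(2,3)
  proof (induction k arbitrary: i)
    case 0
    have first: "sat {0..int m} I first \<rho>' (e(t := 0))" for \<rho>'
      using ts by (auto simp: first_def)
    have prev: "\<not> rpr_upto ds t \<rho> e 0 j (map e ts) n" if "j < length classes" for j n
      using ds[OF that] by simp
    show ?case
      using 0 first prev letters by (auto simp: ds upds_step sat_step_form reachable_0)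
  next
    case (Suc k)
    \<comment> \<open>The predecessor \<open>int k\<close> lies in the domain and witnesses that
      this point is not the first.\<close>
    have first: "\<not> sat {0..int m} I first \<rho>' (e(t := 1 + int k))" for \<rho>'
      using ts Suc.prems by (auto simp: first_def intro!: bexI[of _ "int k"])
    have "rpr_upto ds t \<rho> e (Suc (Suc k)) i (map e ts) (int (Suc k)) \<longleftrightarrow>
       sat {0..int m} I (step_form (classes ! i)) (rpr_upto ds t \<rho> e (Suc k)) (e(t := int (Suc k)))"
      using Suc.prems by (simp add: ds upds_step del: rpr_upto.simps(2)) (simp add: ds upds_step)
    also have "\<dots> \<longleftrightarrow> (\<exists>a\<in>set letters. \<exists>j<length classes. class_step p (classes ! j) a = classes ! i \<and>
       fits p (set ts) I e (int (Suc k)) a \<and> rpr_upto ds t \<rho> e (Suc k) j (map e ts) (int k))"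
      using first by (simp add: sat_step_form del: rpr_upto.simps)
    also have "\<dots> \<longleftrightarrow> (\<exists>a\<in>set letters. \<exists>j<length classes. class_step p (classes ! j) a = classes ! i \<and>
       fits p (set ts) I e (int (Suc k)) a \<and> reachable p (set ts) I e (classes ! j) k)"
      using Suc.IH Suc.prems(1) by (simp del: rpr_upto.simps cong: conj_cong)
    also have "\<dots> \<longleftrightarrow> reachable p (set ts) I e (classes ! i) (Suc k)"
    proof -
      have "c' \<in> set classes" if "reachable p (set ts) I e c' k" for c'
        using that classes by (auto simp: reachable_def)
      then show ?thesis unfolding reachable_Suc letters by (metis in_set_conv_nth)
    qed
    finally show ?case .
  qed
  moreover have "nat (int k + 1) = Suc k" by simp
  ultimately show ?thesis unfolding rpr_env_def by (simp del: rpr_upto.simps)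
qed

lemma sat_rewriting:
  fixes m :: nat
  assumes I: "\<And>A. I A \<subseteq> {0..int m}" and e: "e ` set ts \<subseteq> {0..int m}"
  shows "sat {0..int m} I rewriting \<rho> e \<longleftrightarrow> \<not> (\<exists>M. (\<forall>A. I A \<subseteq> M A) \<and> bsat UNIV M p e)"
proof -
  let ?ds = "map (\<lambda>(Q, zs, \<Theta>). (Q, zs, sat {0..int m} I \<Theta>)) definitions"
  let ?\<rho> = "rpr_env ?ds t \<rho> e"
  have last: "sat {0..int m} I last \<rho>' (e(t := d)) \<longleftrightarrow> d = int m" if "d \<in> {0..int m}" for d \<rho>'
    using that ts by (auto simp: last_def)
  have map_e: "map (e(t := k)) ts = map e ts" for k using ts by (simp cong: map_cong)
  have "sat {0..int m} I (Rpr t definitions accept_form) \<rho> e \<longleftrightarrow>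
      sat {0..int m} I (disj t (map (\<lambda>i. Rel i ts t)
        (filter (\<lambda>i. accepting p (classes ! i)) [0..<length classes]))) ?\<rho> (e(t := int m))"
    unfolding accept_form_def sat.simps using last by auto
  also have "\<dots> \<longleftrightarrow> (\<exists>i<length classes. accepting p (classes ! i) \<and> ?\<rho> i (map e ts) (int m))"
    by (auto simp: sat_disj map_e)
  also have "\<dots> \<longleftrightarrow> (\<exists>i<length classes. accepting p (classes ! i) \<and>
      reachable p (set ts) I e (classes ! i) m)"
    using rpr_env_reachable[of m m] by (simp cong: conj_cong)
  also have "\<dots> \<longleftrightarrow> (\<exists>c. reachable p (set ts) I e c m \<and> accepting p c)"
  proof -
    have "c \<in> set classes" if "accepting p c" for c
      using that classes by (auto simp: accepting_def)
    then show ?thesis by (metis in_set_conv_nth)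
  qed
  also have "\<dots> \<longleftrightarrow> (\<exists>M. (\<forall>A. I A \<subseteq> M A) \<and> bsat UNIV M p e)"
    using satisfiable_iff_reachable[OF p I e] by simp
  finally have "sat {0..int m} I (Neg (Rpr t definitions accept_form)) \<rho> e \<longleftrightarrow>
      \<not> (\<exists>M. (\<forall>A. I A \<subseteq> M A) \<and> bsat UNIV M p e)" by (simp only: sat.simps)
  moreover have "sat D I (foldr (\<lambda>x. And (Equal x x)) xs \<phi>) \<rho> e \<longleftrightarrow> sat D I \<phi> \<rho> e" for D xs \<phi>
    by (induction xs) auto
  ultimately show ?thesis unfolding rewriting_def by simp
qed

end

theorem rewritable_bool:
  assumes "OMQ \<O> \<psi> ts" "LTL_ontology BoxNext Bool \<O>"
  shows "rewritable FO_RPR \<O> \<psi> ts"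
proof -
  have \<psi>: "finite \<O>" "\<psi> \<in> MFO" "distinct ts" "set ts = fv \<psi>"
    using assms(1) by (auto simp: OMQ_def)
  \<comment> \<open>This formula describes the refuting models directly, so an arbitrary query
    formula is allowed.\<close>
  have "definable False integer_structures (set ts)
      (\<lambda>D I e. (\<forall>cl\<in>\<O>. clause_true I cl) \<and> \<not> sat UNIV I \<psi> (\<lambda>_ _ _. False) e)"
    using \<psi>
    by (intro definable_and definable_not definable_Ball definable_clause_true) (simp_all add: definable_MFO)
  then obtain p where p: "cong_ok False p" "bfv p \<subseteq> set ts" and bsat_p: "\<And>I e. bsat UNIV I p e \<longleftrightarrow>
      (\<forall>cl\<in>\<O>. clause_true I cl) \<and> \<not> sat UNIV I \<psi> (\<lambda>_ _ _. False) e"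
    unfolding definable_def by auto
  obtain t where t: "t \<notin> set ts" using ex_new_if_finite[OF infinite_UNIV_nat, of "set ts"] by auto
  obtain atoms where atoms: "set atoms = batoms p"
    using finite_list[OF finite_batoms] by blast
  have "finite (alphabet p (set ts))" by (simp add: alphabet_def finite_batoms)
  then obtain letters where letters: "set letters = alphabet p (set ts)"
    using finite_list by blast
  obtain classes where classes: "set classes = range (cls (word_sat p))"
    using finite_list[OF word_sat_finite_index] by blast
  interpret rpr_rewriting p ts t "Suc t" atoms letters classes
    using p \<psi>(3) t atoms letters classes by unfold_locales auto
  have "certain_answer \<O> \<psi> ts \<A> ls \<longleftrightarrow> holds_in_data \<A> rewriting ts ls"
    if \<A>: "data_instance \<A>" and ls: "length ls = length ts" "set ls \<subseteq> tem \<A>" for \<A> ls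
  proof -
    let ?e = "upds (\<lambda>_. 0) ts ls" and ?I = "\<lambda>A. {l. (A, l) \<in> \<A>}"
    obtain m where m: "tem \<A> = {0..int m}"
      using data_instance_structure(2)[OF \<A>] \<A> by (metis data_instance_def nat_0_le order_trans zero_le_one)
    have "?I A \<subseteq> {0..int m}" for A
    proof -
      obtain m' where "tem \<A> = {0..m'}" "\<forall>A. ?I A \<subseteq> {0..m'}"
        using data_structuresE[OF data_instance_structure(1)[OF \<A>]] by metis
      then show ?thesis using m by metis
    qed
    moreover have "?e ` set ts \<subseteq> {0..int m}" using upds_in ls m by blast
    ultimately have "sat {0..int m} ?I rewriting (\<lambda>_ _ _. False) ?e \<longleftrightarrow>
        \<not> (\<exists>M. (\<forall>A. ?I A \<subseteq> M A) \<and> bsat UNIV M p ?e)" by (rule sat_rewriting)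
    then show ?thesis
      unfolding certain_answer_def holds_in_data_def holds_def m bsat_p model_iff_is_model is_model_def
      by blast
  qed
  then show ?thesis
    unfolding rewritable_def using rewriting_FO_RPR fv_rewriting by blast
qed

theorem theoremC:
  shows "(\<forall>\<O> \<psi> ts. OMQ \<O> \<psi> ts \<and> LTL_ontology BoxNext Bool \<O>
            \<longrightarrow> rewritable FO_RPR \<O> \<psi> ts) \<and>
         (\<forall>\<O> \<psi> ts. OMQ \<O> \<psi> ts \<and> LTL_ontology Box Horn \<O> \<and> quasi_positive \<psi>
            \<longrightarrow> rewritable FO_less \<O> \<psi> ts) \<and>
         (\<forall>\<O> \<psi> ts. OMQ \<O> \<psi> ts \<and> LTL_ontology BoxNext Core \<O> \<and> quasi_positive \<psi>
            \<longrightarrow> rewritable FO_less_cong \<O> \<psi> ts)"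
  using rewritable_bool rewritable_box_horn rewritable_core by blast

end
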